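(* Assume that $(E,\mathcal E)$ is a Borel space. The space $L^2(E;\mathbb D^{1,2}(H))\subset L^2(\Omega\times E;H)$ is contained in $\mathrm{dom}(\delta^{(2)})$. The restriction $\delta|_{L^2(E;\mathbb D^{1,2}(H))}$ is continuous as a mapping from $L^2(E;\mathbb D^{1,2}(H))$ to $L^2(\Omega;H)$, and for all $\Phi,\Psi\in L^2(E;\mathbb D^{1,2}(H))$ we have $$\mathbb E\big\langle\delta(\Phi),\delta(\Psi)\big\rangle=\mathbb E\int_E\langle\Phi(x),\Psi(x)\rangle\,\mu(\mathrm dx)+\mathbb E\int_E\int_E\big\langle D_x\Phi(y),D_y\Psi(x)\big\rangle\,\mu(\mathrm dy)\,\mu(\mathrm dx).$$
   Context: Setting: $(E,\mathcal E,\mu)$ is a $\sigma$-finite measure space such that the diagonal $\{(x,y)\in E\times E:x=y\}$ belongs to $\mathcal E\otimes\mathcal E$. $(E,\mathcal E)$ is a Borel space if there is a measurable bijection with measurable inverse from $E$ onto a Borel subset of $[0,1]$. $\mathbf N$ is the space of all $\sigma$-finite $\mathbb N_0\cup\{+\infty\}$-valued measures on $(E,\mathcal E)$ with the $\sigma$-algebra generated by the maps $\eta\mapsto\eta(B)$, $B\in\mathcal E$. $(\Omega,\mathcal F,\mathbb P)$ is a complete probability space, $N:\Omega\to\mathbf N$ is a Poisson random measure with intensity measure $\mu$, represented as $N=\sum_{n=1}^{N(E)}\delta_{X_n}$ with $E$-valued random variables $X_1,X_2,\dots$, and $\mathcal F$ is the $\mathbb P$-completion of $\sigma(N)$. $H$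 is a separable real Hilbert space with inner product $\langle\cdot,\cdot\rangle$ and norm $\|\cdot\|$. $L^0(\cdot;H)$ denotes equivalence classes of strongly measurable functions and $L^p(\cdot;H)$ the usual Bochner spaces; product spaces carry product measures ($\Omega$ carries $\mathbb P$, $E$ carries $\mu$). Difference operator: for $F\in L^0(\Omega;H)$, $D_xF:=f(N+\delta_x)-f(N)$, where $f:\mathbf N\to H$ is measurable with $F=f(N)$ a.s. For $\Phi\in L^0(\Omega\times E;H)$ with $\Phi(y)=\varphi(N,y)$ $\mathbb P\otimes\mu$-a.e., $\varphi:\mathbf N\times E\to H$ measurable, $D_x\Phi(y):=\varphi(N+\delta_x,y)-\varphi(N,y)$, so $D\Phi\in L^0(\Omega\times E\times E;H)$. These are a.e. independent of the representatives. Sobolev space: for $p>1$, $\mathbb D^{1,p}(H)$ is the space of $F\in L^p(\Omega;H)$ with $DF\in L^p(\Omega\times E;H)$, with norm $(\|F\|_{L^p(\Omega;H)}^p+\|DF\|_{L^p(\Omega\times E;H)}^p)^{1/p}$. Kabanov–Skorohod integral: $\delta^{(2)}:\mathrm{dom}(\delta^{(2)})\subset L^2(\Omega\times E;H)\to L^2(\Omega;H)$ is the adjoint of the densely defined operator $D|_{\mathbb D^{1,2}(H)}:\mathbb D^{1,2}(H)\subset L^2(\Omega;H)\to L^2(\Omega\times E;H)$; one writes $\delta(\Phi):=\delta^{(2)}(\Phi)$. *)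

theory Defs
  imports "HOL-Probability.Probability"
begin

text \<open>
  Throughout, \<open>M\<close> is the measure space \<open>(E, \<E>, \<mu>)\<close>, \<open>P\<close> is the probability space
  \<open>(\<Omega>, \<F>, \<P>)\<close> and \<open>N\<close> is the random measure. The spaces \<open>L\<^sup>p\<close>, the Sobolev spaces and the
  spaces of vector-valued functions are represented by their sets of functions rather than
  by equivalence classes; the associated norms are then seminorms, vanishing exactly on the
  functions that are zero almost everywhere, and all operators below depend on their arguments
  only up to almost everywhere equality. In particular the choices below are immaterial in the
  setting of the theorem: of a representative \<open>f\<close> with \<open>F = f(N)\<close> in the difference operators, and
  of \<open>G\<close> in the definition of the adjoint, the Sobolev space being dense in \<open>L\<^sup>2(\<Omega>; H)\<close>.
\<close>

subsection \<open>Borel spaces and Poisson random measures\<close>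

definition borel_isomorphic :: "'e measure \<Rightarrow> bool" where
  "borel_isomorphic M \<longleftrightarrow>
     (\<exists>(B :: real set) f. B \<in> sets borel \<and> B \<subseteq> {0..1} \<and> bij_betw f (space M) B \<and>
        f \<in> M \<rightarrow>\<^sub>M restrict_space borel B \<and>
        the_inv_into (space M) f \<in> restrict_space borel B \<rightarrow>\<^sub>M M)"

definition config_set :: "'e measure \<Rightarrow> 'e measure set" where
  "config_set M = {\<eta>. sets \<eta> = sets M \<and> sigma_finite_measure \<eta> \<and>
     (\<forall>B\<in>sets M. emeasure \<eta> B \<in> range ennreal_of_enat)}"

definition config_space :: "'e measure \<Rightarrow> 'e measure measure" where
  "config_space M = sigma (config_set M)
     {{\<eta> \<in> config_set M. emeasure \<eta> B \<in> A} | B A. B \<in> sets M \<and> A \<in> sets borel}"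

definition add_dirac :: "'e measure \<Rightarrow> 'e \<Rightarrow> 'e measure" where
  "add_dirac \<eta> x = measure_of (space \<eta>) (sets \<eta>) (\<lambda>B. emeasure \<eta> B + indicator B x)"

text \<open>The Poisson distribution with parameter \<open>\<infinity>\<close> is the point mass at \<open>\<infinity>\<close>.\<close>

definition poisson_random_measure :: "'w measure \<Rightarrow> 'e measure \<Rightarrow> ('w \<Rightarrow> 'e measure) \<Rightarrow> bool" where
  "poisson_random_measure P M N \<longleftrightarrow>
     N \<in> P \<rightarrow>\<^sub>M config_space M \<and>
     (\<forall>B\<in>sets M. emeasure M B < \<infinity> \<longrightarrow>
        (\<forall>k::nat. measure P {\<omega>\<in>space P. emeasure (N \<omega>) B = of_nat k} =
           exp (- measure M B) * measure M B ^ k / fact k)) \<and>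
     (\<forall>B\<in>sets M. emeasure M B = \<infinity> \<longrightarrow> (AE \<omega> in P. emeasure (N \<omega>) B = \<infinity>)) \<and>
     (\<forall>(I :: nat set) B. finite I \<and> B ` I \<subseteq> sets M \<and> disjoint_family_on B I \<longrightarrow>
        prob_space.indep_vars P (\<lambda>_. borel) (\<lambda>i \<omega>. emeasure (N \<omega>) (B i)) I)"

text \<open>\<open>N = \<Sum>\<^bsub>n=1\<^esub>\<^bsup>N(E)\<^esup> \<delta>\<^bsub>X n\<^esub>\<close> almost surely; the points are numbered from \<open>0\<close> here.\<close>

definition sum_of_diracs :: "'w measure \<Rightarrow> 'e measure \<Rightarrow> ('w \<Rightarrow> 'e measure) \<Rightarrow> bool" where
  "sum_of_diracs P M N \<longleftrightarrow>
     (\<exists>X :: nat \<Rightarrow> 'w \<Rightarrow> 'e. (\<forall>n. X n \<in> P \<rightarrow>\<^sub>M M) \<and>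
        (AE \<omega> in P. \<forall>B\<in>sets M. emeasure (N \<omega>) B =
           (\<Sum>n. if of_nat n < emeasure (N \<omega>) (space M) then indicator B (X n \<omega>) else 0)))"

subsection \<open>Bochner spaces\<close>

definition Lp_space ::
    "real \<Rightarrow> 'a measure \<Rightarrow> ('a \<Rightarrow> 'h::{real_inner,banach,second_countable_topology}) set" where
  "Lp_space p A = {f \<in> borel_measurable A. integrable A (\<lambda>x. norm (f x) powr p)}"

definition Lp_norm ::
    "real \<Rightarrow> 'a measure \<Rightarrow> ('a \<Rightarrow> 'h::{real_inner,banach,second_countable_topology}) \<Rightarrow> real" where
  "Lp_norm p A f = (LINT x|A. norm (f x) powr p) powr (1 / p)"

text \<open>
  \<open>L\<^sup>p(A; V)\<close> for a space \<open>V\<close> with seminorm \<open>nrm\<close> that is not the universe of a type: functions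
  that are almost everywhere the \<open>nrm\<close>-limit of \<open>V\<close>-valued simple functions and whose norm is
  \<open>p\<close>-integrable. As the norm of such a function is only measurable up to null sets, its
  integral is taken in \<open>[0, \<infinity>]\<close>.
\<close>

definition bochner_Lp ::
    "real \<Rightarrow> 'a measure \<Rightarrow> 'v set \<Rightarrow> ('v \<Rightarrow> real) \<Rightarrow> ('a \<Rightarrow> 'v::minus) set" where
  "bochner_Lp p A V nrm = {u.
     (AE x in A. u x \<in> V) \<and>
     (\<exists>s. (\<forall>n::nat. simple_function A (s n) \<and> s n ` space A \<subseteq> V) \<and>
          (AE x in A. (\<lambda>n. nrm (u x - s n x)) \<longlonglongrightarrow> 0)) \<and>
     (\<integral>\<^sup>+ x. ennreal (nrm (u x) powr p) \<partial>A) < \<infinity>}"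

definition bochner_norm :: "real \<Rightarrow> 'a measure \<Rightarrow> ('v \<Rightarrow> real) \<Rightarrow> ('a \<Rightarrow> 'v) \<Rightarrow> real" where
  "bochner_norm p A nrm u = enn2real (\<integral>\<^sup>+ x. ennreal (nrm (u x) powr p) \<partial>A) powr (1 / p)"

definition continuous_wrt ::
    "'u set \<Rightarrow> ('u \<Rightarrow> real) \<Rightarrow> ('v \<Rightarrow> real) \<Rightarrow> ('u::minus \<Rightarrow> 'v::minus) \<Rightarrow> bool" where
  "continuous_wrt U nrmU nrmV T \<longleftrightarrow>
     (\<forall>u\<in>U. \<forall>\<epsilon>>0. \<exists>d>0. \<forall>v\<in>U. nrmU (v - u) < d \<longrightarrow> nrmV (T v - T u) < \<epsilon>)"

subsection \<open>Difference operators and Sobolev spaces\<close>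

definition diff_op ::
    "'w measure \<Rightarrow> 'e measure \<Rightarrow> ('w \<Rightarrow> 'e measure) \<Rightarrow>
     ('w \<Rightarrow> 'h::{real_inner,banach,second_countable_topology}) \<Rightarrow> 'w \<times> 'e \<Rightarrow> 'h" where
  "diff_op P M N F = (\<lambda>(\<omega>, x).
     let f = (SOME f. f \<in> borel_measurable (config_space M) \<and> (AE \<omega> in P. F \<omega> = f (N \<omega>)))
     in f (add_dirac (N \<omega>) x) - f (N \<omega>))"

text \<open>\<open>diff_op_process P M N \<Phi> (\<omega>, x, y)\<close> is \<open>(D\<^sub>x \<Phi>(y)) \<omega>\<close>: the added point comes first.\<close>

definition diff_op_process ::
    "'w measure \<Rightarrow> 'e measure \<Rightarrow> ('w \<Rightarrow> 'e measure) \<Rightarrow>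
     ('w \<times> 'e \<Rightarrow> 'h::{real_inner,banach,second_countable_topology}) \<Rightarrow> 'w \<times> 'e \<times> 'e \<Rightarrow> 'h" where
  "diff_op_process P M N \<Phi> = (\<lambda>(\<omega>, x, y).
     let \<phi> = (SOME \<phi>. \<phi> \<in> borel_measurable (config_space M \<Otimes>\<^sub>M M) \<and>
                (AE (\<omega>, y) in P \<Otimes>\<^sub>M M. \<Phi> (\<omega>, y) = \<phi> (N \<omega>, y)))
     in \<phi> (add_dirac (N \<omega>) x, y) - \<phi> (N \<omega>, y))"

definition sobolev ::
    "real \<Rightarrow> 'w measure \<Rightarrow> 'e measure \<Rightarrow> ('w \<Rightarrow> 'e measure) \<Rightarrow>
     ('w \<Rightarrow> 'h::{real_inner,banach,second_countable_topology}) set" where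
  "sobolev p P M N = {F \<in> Lp_space p P. diff_op P M N F \<in> Lp_space p (P \<Otimes>\<^sub>M M)}"

definition sobolev_norm ::
    "real \<Rightarrow> 'w measure \<Rightarrow> 'e measure \<Rightarrow> ('w \<Rightarrow> 'e measure) \<Rightarrow>
     ('w \<Rightarrow> 'h::{real_inner,banach,second_countable_topology}) \<Rightarrow> real" where
  "sobolev_norm p P M N F =
     (Lp_norm p P F powr p + Lp_norm p (P \<Otimes>\<^sub>M M) (diff_op P M N F) powr p) powr (1 / p)"

text \<open>
  \<open>L\<^sup>2(E; \<D>\<^bsup>1,2\<^esup>(H))\<close>, seen as a space of (jointly measurable) functions on \<open>\<Omega> \<times> E\<close>.
\<close>

definition L2_sobolev ::
    "'w measure \<Rightarrow> 'e measure \<Rightarrow> ('w \<Rightarrow> 'e measure) \<Rightarrow>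
     ('w \<times> 'e \<Rightarrow> 'h::{real_inner,banach,second_countable_topology}) set" where
  "L2_sobolev P M N = {\<Phi> \<in> borel_measurable (P \<Otimes>\<^sub>M M).
     (\<lambda>y \<omega>. \<Phi> (\<omega>, y)) \<in> bochner_Lp 2 M (sobolev 2 P M N) (sobolev_norm 2 P M N)}"

definition L2_sobolev_norm ::
    "'w measure \<Rightarrow> 'e measure \<Rightarrow> ('w \<Rightarrow> 'e measure) \<Rightarrow>
     ('w \<times> 'e \<Rightarrow> 'h::{real_inner,banach,second_countable_topology}) \<Rightarrow> real" where
  "L2_sobolev_norm P M N \<Phi> = bochner_norm 2 M (sobolev_norm 2 P M N) (\<lambda>y \<omega>. \<Phi> (\<omega>, y))"

subsection \<open>The Kabanov--Skorohod integral as adjoint of the difference operator\<close>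

definition KS_adjoint ::
    "'w measure \<Rightarrow> 'e measure \<Rightarrow> ('w \<Rightarrow> 'e measure) \<Rightarrow>
     ('w \<times> 'e \<Rightarrow> 'h::{real_inner,banach,second_countable_topology}) \<Rightarrow> ('w \<Rightarrow> 'h) \<Rightarrow> bool" where
  "KS_adjoint P M N \<Phi> G \<longleftrightarrow> G \<in> Lp_space 2 P \<and>
     (\<forall>F\<in>sobolev 2 P M N.
        (LINT z|(P \<Otimes>\<^sub>M M). diff_op P M N F z \<bullet> \<Phi> z) = (LINT \<omega>|P. F \<omega> \<bullet> G \<omega>))"

definition KS_dom ::
    "'w measure \<Rightarrow> 'e measure \<Rightarrow> ('w \<Rightarrow> 'e measure) \<Rightarrow>
     ('w \<times> 'e \<Rightarrow> 'h::{real_inner,banach,second_countable_topology}) set" where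
  "KS_dom P M N = {\<Phi> \<in> Lp_space 2 (P \<Otimes>\<^sub>M M). \<exists>G. KS_adjoint P M N \<Phi> G}"

definition KS_integral ::
    "'w measure \<Rightarrow> 'e measure \<Rightarrow> ('w \<Rightarrow> 'e measure) \<Rightarrow>
     ('w \<times> 'e \<Rightarrow> 'h::{real_inner,banach,second_countable_topology}) \<Rightarrow> 'w \<Rightarrow> 'h" where
  "KS_integral P M N \<Phi> = (SOME G. KS_adjoint P M N \<Phi> G)"

end

theory Submission
  imports Defs
begin

text \<open>
  The whole argument takes place on the law of \<open>N\<close>, a probability measure \<open>\<L>\<close> on the space of
  configurations. As the events are the completion of the \<open>\<sigma>\<close>-algebra generated by \<open>N\<close>, random variables
  and processes are of the form \<open>f(N)\<close> and \<open>\<phi>(N, x)\<close> up to null sets (\<open>representative\<close>,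
  \<open>process_representative\<close>), and \<open>D\<^sub>x\<close> just compares a function at \<open>\<eta> + \<delta>\<^sub>x\<close> and at \<open>\<eta>\<close>.

  The engine is the Mecke equation \<open>\<^bold>E \<integral> g(N, x) N(dx) = \<^bold>E \<integral> g(N + \<delta>\<^sub>x, x) \<mu>(dx)\<close> (\<open>mecke\<close>), which
  amounts to the identity \<open>k p\<^sub>\<lambda>(k) = \<lambda> p\<^sub>\<lambda>(k - 1)\<close> for the weights of the Poisson distribution. For a bounded
  process \<open>\<phi>\<close> vanishing outside of a set of finite measure, it shows that the pathwise integral
  \<open>\<delta>(\<phi>) = \<integral> \<phi>(N - \<delta>\<^sub>x, x) N(dx) - \<integral> \<phi>(N, x) \<mu>(dx)\<close> satisfies the duality
  \<open>\<^bold>E \<langle>F, \<delta>(\<phi>)\<rangle> = \<^bold>E \<integral> \<langle>D\<^sub>x F, \<phi>(x)\<rangle> \<mu>(dx)\<close> (\<open>duality_admissible\<close>). Moreover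
  \<open>D\<^sub>y \<delta>(\<phi>) = \<phi>(y) + \<delta>(D\<^sub>y \<phi>)\<close> holds path by path (\<open>compensated_add_dirac\<close>). Using the duality for
  \<open>F = \<delta>(\<phi>)\<close>, then the commutation relation and then the duality for \<open>F = \<psi>(y)\<close>, one arrives at the
  formula for \<open>\<^bold>E \<langle>\<delta>(\<phi>), \<delta>(\<psi>)\<rangle>\<close> (\<open>isometry_admissible\<close>).

  The second term of that formula is at most \<open>\<parallel>D\<phi>\<parallel> \<parallel>D\<psi>\<parallel>\<close> by the Cauchy--Schwarz inequality, so \<open>\<delta>\<close> is a
  contraction with respect to the graph norm \<open>(\<parallel>\<phi>\<parallel>\<^sup>2 + \<parallel>D\<phi>\<parallel>\<^sup>2)\<^bsup>1/2\<^esup>\<close>. The processes of the above kind are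
  dense for the graph norm (\<open>approximation\<close>), hence \<open>\<delta>\<close> extends, and duality and isometry pass to the limit
  (\<open>divergence_approximation\<close>, \<open>divergence_isometry\<close>). The extension is the adjoint, and the adjoint is unique
  because the Sobolev space contains enough indicators of events (\<open>divergence_unique\<close>). Finally, Tonelli's
  theorem identifies the graph norm with the norm of \<open>L\<^sup>2(E; \<D>\<^bsub>1,2\<^esub>(H))\<close> (\<open>slice_energy\<close>).
\<close>

section \<open>Square-integrable functions\<close>

definition square_integrable ::
    "'a measure \<Rightarrow> ('a \<Rightarrow> 'h::{real_inner,banach,second_countable_topology}) \<Rightarrow> bool" where
  "square_integrable Q f \<longleftrightarrow> f \<in> borel_measurable Q \<and> integrable Q (\<lambda>x. (norm (f x))\<^sup>2)"

definition sqnorm :: "'a measure \<Rightarrow> ('a \<Rightarrow> 'h::{real_inner,banach,second_countable_topology}) \<Rightarrow> real" where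
  "sqnorm Q f = (LINT x|Q. (norm (f x))\<^sup>2)"

lemma square_integrableD:
  assumes "square_integrable Q f"
  shows "f \<in> borel_measurable Q" "integrable Q (\<lambda>x. (norm (f x))\<^sup>2)"
  using assms by (auto simp: square_integrable_def)

lemma square_integrable_bound:
  fixes f :: "'a \<Rightarrow> 'h::{real_inner,banach,second_countable_topology}"
  assumes "f \<in> borel_measurable Q" "integrable Q g" "AE x in Q. (norm (f x))\<^sup>2 \<le> g x"
  shows "square_integrable Q f"
  unfolding square_integrable_def using assms
  by (auto intro!: Bochner_Integration.integrable_bound[OF assms(2)])

lemma sqnorm_nonneg [simp]: "0 \<le> sqnorm Q f"
  by (simp add: sqnorm_def)

lemma nn_integral_sqnorm:
  assumes "square_integrable Q f"
  shows "(\<integral>\<^sup>+ x. ennreal ((norm (f x))\<^sup>2) \<partial>Q) = ennreal (sqnorm Q f)"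
  using square_integrableD[OF assms] unfolding sqnorm_def by (intro nn_integral_eq_integral) auto

lemma square_integrable_iff_nn:
  assumes "f \<in> borel_measurable Q"
  shows "square_integrable Q f \<longleftrightarrow> (\<integral>\<^sup>+ x. ennreal ((norm (f x))\<^sup>2) \<partial>Q) < \<infinity>"
  using assms unfolding square_integrable_def integrable_iff_bounded by auto

lemma square_integrable_cong_AE:
  fixes f g :: "'a \<Rightarrow> 'h::{real_inner,banach,second_countable_topology}"
  assumes "f \<in> borel_measurable Q" "g \<in> borel_measurable Q" "AE x in Q. f x = g x"
  shows "square_integrable Q f \<longleftrightarrow> square_integrable Q g" "sqnorm Q f = sqnorm Q g"
proof -
  have *: "AE x in Q. (norm (f x))\<^sup>2 = (norm (g x))\<^sup>2" using assms(3) by eventually_elim simp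
  show "square_integrable Q f \<longleftrightarrow> square_integrable Q g"
    unfolding square_integrable_def using assms(1,2) integrable_cong_AE[OF _ _ *] by auto
  show "sqnorm Q f = sqnorm Q g"
    unfolding sqnorm_def using assms(1,2) by (intro integral_cong_AE[OF _ _ *]) auto
qed

lemma norm_diff_sq_le:
  "(norm (a - b))\<^sup>2 \<le> 2 * (norm a)\<^sup>2 + 2 * (norm (b :: 'h::real_normed_vector))\<^sup>2"
proof -
  have "(norm (a - b))\<^sup>2 \<le> (norm a + norm b)\<^sup>2"
    by (intro power_mono norm_triangle_ineq4) auto
  also have "\<dots> \<le> 2 * (norm a)\<^sup>2 + 2 * (norm b)\<^sup>2"
    using zero_le_power2[of "norm a - norm b"] by (simp add: power2_eq_square algebra_simps)
  finally show ?thesis .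
qed

lemma norm_add_sq_le:
  "(norm (a + b))\<^sup>2 \<le> 2 * (norm a)\<^sup>2 + 2 * (norm (b :: 'h::real_normed_vector))\<^sup>2"
  using norm_diff_sq_le[of a "- b"] by simp

lemma abs_inner_le_sq:
  "\<bar>a \<bullet> b\<bar> \<le> ((norm a)\<^sup>2 + (norm (b :: 'h::real_inner))\<^sup>2) / 2"
proof -
  have "\<bar>a \<bullet> b\<bar> \<le> norm a * norm b" by (rule Cauchy_Schwarz_ineq2)
  also have "\<dots> \<le> ((norm a)\<^sup>2 + (norm b)\<^sup>2) / 2"
    using zero_le_power2[of "norm a - norm b"] by (simp add: power2_eq_square algebra_simps)
  finally show ?thesis .
qed

lemma square_integrable_diff [intro]:
  assumes "square_integrable Q f" "square_integrable Q g"
  shows "square_integrable Q (\<lambda>x. f x - g x)"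
  using square_integrableD[OF assms(1)] square_integrableD[OF assms(2)]
  by (intro square_integrable_bound[where g="\<lambda>x. 2 * (norm (f x))\<^sup>2 + 2 * (norm (g x))\<^sup>2"])
     (auto intro!: norm_diff_sq_le borel_measurable_diff)

lemma square_integrable_inner [intro]:
  assumes "square_integrable Q f" "square_integrable Q g"
  shows "integrable Q (\<lambda>x. f x \<bullet> g x)"
proof (rule Bochner_Integration.integrable_bound)
  note f = square_integrableD[OF assms(1)] and g = square_integrableD[OF assms(2)]
  show "integrable Q (\<lambda>x. ((norm (f x))\<^sup>2 + (norm (g x))\<^sup>2) / 2)"
    using f g by auto
  show "(\<lambda>x. f x \<bullet> g x) \<in> borel_measurable Q" using f g by measurable
  show "AE x in Q. norm (f x \<bullet> g x) \<le> norm (((norm (f x))\<^sup>2 + (norm (g x))\<^sup>2) / 2)"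
    using abs_inner_le_sq by (intro AE_I2) (simp del: abs_divide)
qed

lemma sqnorm_eq_inner: "sqnorm Q f = (LINT x|Q. f x \<bullet> f x)"
  by (simp add: sqnorm_def power2_norm_eq_inner)

lemma sqnorm_diff:
  assumes "square_integrable Q f" "square_integrable Q g"
  shows "sqnorm Q (\<lambda>x. f x - g x) = sqnorm Q f - 2 * (LINT x|Q. f x \<bullet> g x) + sqnorm Q g"
proof -
  have "sqnorm Q (\<lambda>x. f x - g x) = (LINT x|Q. f x \<bullet> f x - 2 * (f x \<bullet> g x) + g x \<bullet> g x)"
    unfolding sqnorm_eq_inner by (simp add: inner_diff inner_commute algebra_simps)
  also have "\<dots> = sqnorm Q f - 2 * (LINT x|Q. f x \<bullet> g x) + sqnorm Q g"
    unfolding sqnorm_eq_inner using assms by (simp add: square_integrable_inner)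
  finally show ?thesis .
qed

lemma square_integrable_scaleR [intro]:
  assumes "square_integrable Q f"
  shows "square_integrable Q (\<lambda>x. c *\<^sub>R f x)"
  using assms unfolding square_integrable_def by (auto simp: power_mult_distrib)

lemma sqnorm_eq_0_AE:
  assumes "square_integrable Q f" "sqnorm Q f = 0"
  shows "AE x in Q. f x = 0"
proof -
  have "AE x in Q. (norm (f x))\<^sup>2 = 0"
    using square_integrableD[OF assms(1)] assms(2) integral_nonneg_eq_0_iff_AE[of Q "\<lambda>x. (norm (f x))\<^sup>2"]
    by (auto simp: sqnorm_def)
  then show ?thesis by eventually_elim simp
qed

lemma Cauchy_Schwarz_integral:
  assumes f: "square_integrable Q f" and g: "square_integrable Q g"
  shows "\<bar>LINT x|Q. f x \<bullet> g x\<bar> \<le> sqrt (sqnorm Q f) * sqrt (sqnorm Q g)"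
proof (cases "sqnorm Q g = 0")
  case True
  then have "AE x in Q. f x \<bullet> g x = 0" using sqnorm_eq_0_AE[OF g] by auto
  then have "(LINT x|Q. f x \<bullet> g x) = 0" by (rule integral_eq_zero_AE)
  then show ?thesis by simp
next
  case False
  define b where "b = (LINT x|Q. f x \<bullet> g x)"
  define c where "c = sqnorm Q g"
  have c: "c > 0" using False by (simp add: c_def less_le)
  have "0 \<le> sqnorm Q (\<lambda>x. f x - (b / c) *\<^sub>R g x)" by simp
  also have "\<dots> = sqnorm Q f - 2 * (LINT x|Q. f x \<bullet> ((b / c) *\<^sub>R g x)) + sqnorm Q (\<lambda>x. (b / c) *\<^sub>R g x)"
    using f g by (intro sqnorm_diff) auto
  also have "\<dots> = sqnorm Q f - 2 * (b / c) * b + (b / c)\<^sup>2 * c"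
    by (simp add: b_def c_def sqnorm_def power_mult_distrib power_divide)
  also have "\<dots> = sqnorm Q f - b\<^sup>2 / c" using c by (simp add: field_simps power2_eq_square)
  finally have "b\<^sup>2 \<le> sqnorm Q f * c" using c by (simp add: field_simps)
  then have "\<bar>b\<bar> \<le> sqrt (sqnorm Q f * c)"
    using real_le_rsqrt[of "\<bar>b\<bar>"] by simp
  then show ?thesis by (simp add: b_def c_def real_sqrt_mult)
qed

lemma integral_inner_tendsto:
  assumes fn: "\<And>n. square_integrable Q (fn n)" and f: "square_integrable Q f"
    and gn: "\<And>n. square_integrable Q (gn n)" and g: "square_integrable Q g"
    and fl: "(\<lambda>n. sqnorm Q (\<lambda>x. fn n x - f x)) \<longlonglongrightarrow> 0"
    and gl: "(\<lambda>n. sqnorm Q (\<lambda>x. gn n x - g x)) \<longlonglongrightarrow> 0"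
  shows "(\<lambda>n. LINT x|Q. fn n x \<bullet> gn n x) \<longlonglongrightarrow> (LINT x|Q. f x \<bullet> g x)"
proof -
  let ?u = "\<lambda>n x. fn n x - f x" and ?v = "\<lambda>n x. gn n x - g x"
  have u: "square_integrable Q (?u n)" and v: "square_integrable Q (?v n)" for n
    using fn f gn g by auto
  have eq: "(LINT x|Q. fn n x \<bullet> gn n x) =
      (LINT x|Q. ?u n x \<bullet> ?v n x) + (LINT x|Q. ?u n x \<bullet> g x) + (LINT x|Q. f x \<bullet> ?v n x) + (LINT x|Q. f x \<bullet> g x)" for n
  proof -
    have "(LINT x|Q. fn n x \<bullet> gn n x) =
      (LINT x|Q. ?u n x \<bullet> ?v n x + ?u n x \<bullet> g x + f x \<bullet> ?v n x + f x \<bullet> g x)"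
      by (intro Bochner_Integration.integral_cong) (auto simp: inner_diff algebra_simps)
    then show ?thesis using square_integrable_inner[OF u[of n] v[of n]]
        square_integrable_inner[OF u[of n] g] square_integrable_inner[OF f v[of n]]
        square_integrable_inner[OF f g] by simp
  qed
  have sq: "(\<lambda>n. sqrt (sqnorm Q (?u n))) \<longlonglongrightarrow> 0" "(\<lambda>n. sqrt (sqnorm Q (?v n))) \<longlonglongrightarrow> 0"
    using tendsto_real_sqrt[OF fl] tendsto_real_sqrt[OF gl] by simp_all
  have "(\<lambda>n. LINT x|Q. ?u n x \<bullet> ?v n x) \<longlonglongrightarrow> 0"
    by (rule Lim_null_comparison[OF _ tendsto_mult[OF sq, simplified]])
       (auto intro!: always_eventually Cauchy_Schwarz_integral u v)
  moreover have "(\<lambda>n. LINT x|Q. ?u n x \<bullet> g x) \<longlonglongrightarrow> 0"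
    by (rule Lim_null_comparison[OF _ tendsto_mult_right[OF sq(1), of "sqrt (sqnorm Q g)", simplified]])
       (use Cauchy_Schwarz_integral[OF u g] in \<open>auto intro!: always_eventually simp: mult.commute\<close>)
  moreover have "(\<lambda>n. LINT x|Q. f x \<bullet> ?v n x) \<longlonglongrightarrow> 0"
    by (rule Lim_null_comparison[OF _ tendsto_mult_right[OF sq(2), of "sqrt (sqnorm Q f)", simplified]])
       (use Cauchy_Schwarz_integral[OF f v] in \<open>auto intro!: always_eventually simp: mult.commute\<close>)
  ultimately show ?thesis unfolding eq
    by (auto intro!: tendsto_eq_intros)
qed

lemma sqnorm_triangle:
  assumes "square_integrable Q (\<lambda>z. f z - u z)" "square_integrable Q (\<lambda>z. g z - u z)"
  shows "sqnorm Q (\<lambda>z. f z - g z) \<le> 2 * sqnorm Q (\<lambda>z. f z - u z) + 2 * sqnorm Q (\<lambda>z. g z - u z)"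
proof -
  have fg: "f z - g z = (f z - u z) - (g z - u z)" for z by simp
  have "square_integrable Q (\<lambda>z. f z - g z)"
    unfolding fg by (rule square_integrable_diff[OF assms])
  note int = square_integrableD(2)[OF this] square_integrableD(2)[OF assms(1)] square_integrableD(2)[OF assms(2)]
  have "sqnorm Q (\<lambda>z. f z - g z) \<le> (LINT z|Q. 2 * (norm (f z - u z))\<^sup>2 + 2 * (norm (g z - u z))\<^sup>2)"
    unfolding sqnorm_def
  proof (rule integral_mono)
    show "(norm (f z - g z))\<^sup>2 \<le> 2 * (norm (f z - u z))\<^sup>2 + 2 * (norm (g z - u z))\<^sup>2" for z
      unfolding fg[of z] by (rule norm_diff_sq_le)
  qed (use int in auto)
  then show ?thesis using int by (simp add: sqnorm_def)
qed

lemma sqnorm_tendsto_0: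
  fixes f :: "nat \<Rightarrow> 'a \<Rightarrow> 'h::{real_inner,banach,second_countable_topology}"
  assumes f: "\<And>n. f n \<in> borel_measurable Q" and g: "integrable Q g"
    and bound: "\<And>n. AE z in Q. (norm (f n z))\<^sup>2 \<le> g z"
    and lim: "AE z in Q. (\<lambda>n. f n z) \<longlonglongrightarrow> 0"
  shows "(\<lambda>n. sqnorm Q (f n)) \<longlonglongrightarrow> 0"
proof -
  have "(\<lambda>n. LINT z|Q. (norm (f n z))\<^sup>2) \<longlonglongrightarrow> (LINT z|Q. 0)"
  proof (rule integral_dominated_convergence[OF _ _ g])
    show "AE z in Q. (\<lambda>n. (norm (f n z))\<^sup>2) \<longlonglongrightarrow> 0"
      using lim by eventually_elim (auto intro!: tendsto_eq_intros)
    show "AE z in Q. norm ((norm (f n z))\<^sup>2) \<le> g z" for n using bound[of n] by simp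
  qed (use f in auto)
  then show ?thesis by (simp add: sqnorm_def)
qed

lemma (in prob_space) square_integrable_imp_integrable:
  fixes f :: "'a \<Rightarrow> 'h::{real_inner,banach,second_countable_topology}"
  assumes "square_integrable M f"
  shows "integrable M f"
proof (rule Bochner_Integration.integrable_bound)
  show "integrable M (\<lambda>x. 1 + (norm (f x))\<^sup>2)" "f \<in> borel_measurable M"
    using square_integrableD[OF assms] by auto
  have "norm (f x) \<le> norm (1 + (norm (f x))\<^sup>2)" for x
    using zero_le_power2[of "norm (f x) - 1"] zero_le_power2[of "norm (f x)"]
    by (simp add: power2_diff) (smt (verit) norm_ge_zero)
  then show "AE x in M. norm (f x) \<le> norm (1 + (norm (f x))\<^sup>2)" by blast
qed

lemma (in prob_space) L1_le_L2:
  assumes "square_integrable M f"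
  shows "(LINT x|M. norm (f x)) \<le> sqrt (sqnorm M f)"
proof -
  have "square_integrable M (\<lambda>x. norm (f x))" "square_integrable M (\<lambda>x. 1::real)"
    using assms by (auto simp: square_integrable_def)
  from Cauchy_Schwarz_integral[OF this] show ?thesis by (simp add: sqnorm_def prob_space)
qed

text \<open>
  A Cauchy sequence in \<open>L\<^sup>2\<close> of a probability space is Cauchy in \<open>L\<^sup>1\<close>, so a subsequence converges almost
  surely by completeness of the Hilbert space; Fatou's lemma turns the Cauchy estimate into
  convergence of the whole sequence in \<open>L\<^sup>2\<close>.
\<close>

lemma (in prob_space) L2_complete:
  fixes f :: "nat \<Rightarrow> 'a \<Rightarrow> 'h::{real_inner,banach,second_countable_topology}"
  assumes f: "\<And>n. square_integrable M (f n)"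
    and cauchy: "\<And>e. e > 0 \<Longrightarrow> \<exists>k. \<forall>m\<ge>k. \<forall>n\<ge>k. sqnorm M (\<lambda>x. f m x - f n x) < e"
  obtains g where "square_integrable M g" "(\<lambda>n. sqnorm M (\<lambda>x. f n x - g x)) \<longlonglongrightarrow> 0"
proof -
  have [measurable]: "f n \<in> borel_measurable M" for n using f by (rule square_integrableD)
  have "\<exists>k. \<forall>i\<ge>k. \<forall>j\<ge>k. (LINT x|M. norm (f i x - f j x)) < e" if e: "e > 0" for e
  proof -
    obtain k where k: "\<And>m n. m \<ge> k \<Longrightarrow> n \<ge> k \<Longrightarrow> sqnorm M (\<lambda>x. f m x - f n x) < e\<^sup>2"
      using cauchy[OF zero_less_power[OF e, of 2]] by blast
    have "(LINT x|M. norm (f i x - f j x)) < e" if "i \<ge> k" "j \<ge> k" for i j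
    proof -
      have "(LINT x|M. norm (f i x - f j x)) \<le> sqrt (sqnorm M (\<lambda>x. f i x - f j x))"
        using f by (intro L1_le_L2) auto
      also have "\<dots> < sqrt (e\<^sup>2)" using k[OF that] by (rule real_sqrt_less_mono)
      finally show ?thesis using \<open>e > 0\<close> by simp
    qed
    then show ?thesis by blast
  qed
  with f obtain r where r: "strict_mono r" "AE x in M. Cauchy (\<lambda>i. f (r i) x)"
    by (elim cauchy_L1_AE_cauchy_subseq[OF square_integrable_imp_integrable, rotated]) auto
  define g where "g x = lim (\<lambda>i. f (r i) x)" for x
  have [measurable]: "g \<in> borel_measurable M" unfolding g_def by measurable
  have lim: "AE x in M. (\<lambda>i. f (r i) x) \<longlonglongrightarrow> g x"
    using r(2) by eventually_elim (simp add: g_def Cauchy_convergent convergent_LIMSEQ_iff[symmetric])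
  \<comment> \<open>Fatou's lemma along the subsequence\<close>
  have bound: "(\<integral>\<^sup>+ x. ennreal ((norm (f n x - g x))\<^sup>2) \<partial>M) \<le> ennreal e"
    if k: "\<forall>m\<ge>k. \<forall>n\<ge>k. sqnorm M (\<lambda>x. f m x - f n x) < e" and n: "n \<ge> k" for n k e
  proof -
    have "(\<integral>\<^sup>+ x. ennreal ((norm (f n x - g x))\<^sup>2) \<partial>M) =
        (\<integral>\<^sup>+ x. liminf (\<lambda>i. ennreal ((norm (f n x - f (r i) x))\<^sup>2)) \<partial>M)"
    proof (intro nn_integral_cong_AE, use lim in eventually_elim)
      fix x assume "(\<lambda>i. f (r i) x) \<longlonglongrightarrow> g x"
      then have "(\<lambda>i. ennreal ((norm (f n x - f (r i) x))\<^sup>2)) \<longlonglongrightarrow> ennreal ((norm (f n x - g x))\<^sup>2)"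
        by (intro tendsto_intros)
      then show "ennreal ((norm (f n x - g x))\<^sup>2) = liminf (\<lambda>i. ennreal ((norm (f n x - f (r i) x))\<^sup>2))"
        by (intro lim_imp_Liminf[symmetric]) auto
    qed
    also have "\<dots> \<le> liminf (\<lambda>i. \<integral>\<^sup>+ x. ennreal ((norm (f n x - f (r i) x))\<^sup>2) \<partial>M)"
      by (intro nn_integral_liminf) simp
    also have "\<dots> \<le> limsup (\<lambda>i. \<integral>\<^sup>+ x. ennreal ((norm (f n x - f (r i) x))\<^sup>2) \<partial>M)"
      by (rule Liminf_le_Limsup) simp
    also have "\<dots> \<le> ennreal e"
    proof (rule Limsup_bounded, rule eventually_sequentiallyI[of k])
      fix i assume "i \<ge> k"
      then have "r i \<ge> k" using seq_suble[OF r(1), of i] by linarith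
      then show "(\<integral>\<^sup>+ x. ennreal ((norm (f n x - f (r i) x))\<^sup>2) \<partial>M) \<le> ennreal e"
        using k n f by (subst nn_integral_sqnorm) (auto intro!: ennreal_leI simp: less_imp_le)
    qed
    finally show ?thesis .
  qed
  have sq: "square_integrable M (\<lambda>x. f n x - g x) \<and> sqnorm M (\<lambda>x. f n x - g x) \<le> e"
    if k: "\<forall>m\<ge>k. \<forall>n\<ge>k. sqnorm M (\<lambda>x. f m x - f n x) < e" and n: "n \<ge> k" "e > 0" for n k e
  proof -
    have 1: "square_integrable M (\<lambda>x. f n x - g x)"
      using le_less_trans[OF bound[OF k n(1)]] by (subst square_integrable_iff_nn) auto
    then show ?thesis using bound[OF k n(1)] n(2) by (simp add: nn_integral_sqnorm)
  qed
  obtain k where k: "\<forall>m\<ge>k. \<forall>n\<ge>k. sqnorm M (\<lambda>x. f m x - f n x) < 1"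
    using cauchy[of 1] by auto
  have "square_integrable M (\<lambda>x. f k x - g x)" using sq[OF k order_refl] by simp
  from square_integrable_diff[OF f[of k] this]
  have g: "square_integrable M g" by simp
  have "(\<lambda>n. sqnorm M (\<lambda>x. f n x - g x)) \<longlonglongrightarrow> 0"
  proof (rule LIMSEQ_I)
    fix e :: real assume "e > 0"
    then obtain k where k: "\<forall>m\<ge>k. \<forall>n\<ge>k. sqnorm M (\<lambda>x. f m x - f n x) < e / 2"
      using cauchy[of "e / 2"] by auto
    show "\<exists>k. \<forall>n\<ge>k. norm (sqnorm M (\<lambda>x. f n x - g x) - 0) < e"
    proof (intro exI[of _ k] allI impI)
      fix n assume "n \<ge> k"
      then have "sqnorm M (\<lambda>x. f n x - g x) \<le> e / 2" using sq[OF k] \<open>e > 0\<close> by simp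
      then show "norm (sqnorm M (\<lambda>x. f n x - g x) - 0) < e" using \<open>e > 0\<close> by simp
    qed
  qed
  with g that show ?thesis by blast
qed

section \<open>Measurability and integrability\<close>

lemma integrable_bounded_support:
  fixes f :: "'a \<Rightarrow> 'h::{banach,second_countable_topology}"
  assumes "f \<in> borel_measurable Q" "S \<in> sets Q" "emeasure Q S < \<infinity>"
    and bound: "\<And>z. z \<in> space Q \<Longrightarrow> norm (f z) \<le> c"
    and supp: "\<And>z. z \<in> space Q \<Longrightarrow> f z \<noteq> 0 \<Longrightarrow> z \<in> S"
  shows "integrable Q f"
proof (rule Bochner_Integration.integrable_bound)
  show "integrable Q (\<lambda>z. c * indicator S z)"
    using assms by (intro integrable_mult_right) simp
  have "norm (f z) \<le> norm (c * indicator S z)" if "z \<in> space Q" for z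
    using bound[OF that] supp[OF that] by (cases "f z = 0") auto
  then show "AE z in Q. norm (f z) \<le> norm (c * indicator S z)" by (rule AE_I2)
qed fact

lemma norm_integral_bounded_support:
  fixes f :: "'a \<Rightarrow> 'h::{banach,second_countable_topology}"
  assumes "integrable Q f" "S \<in> sets Q" "emeasure Q S < \<infinity>"
    and bound: "\<And>z. z \<in> space Q \<Longrightarrow> norm (f z) \<le> c"
    and supp: "\<And>z. z \<in> space Q \<Longrightarrow> f z \<noteq> 0 \<Longrightarrow> z \<in> S"
  shows "norm (integral\<^sup>L Q f) \<le> c * measure Q S"
proof -
  have "norm (integral\<^sup>L Q f) \<le> (LINT z|Q. norm (f z))" by (rule integral_norm_bound)
  also have "\<dots> \<le> (LINT z|Q. c * indicator S z)"
  proof (rule integral_mono)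
    show "integrable Q (\<lambda>z. norm (f z))" using assms(1) by simp
    show "integrable Q (\<lambda>z. c * indicator S z)" using assms(2,3) by (intro integrable_mult_right) simp
    show "norm (f z) \<le> c * indicator S z" if "z \<in> space Q" for z
      using bound[OF that] supp[OF that] by (cases "f z = 0") (auto split: split_indicator)
  qed
  finally show ?thesis using assms(2) by simp
qed

lemma AE_pair_fst:
  assumes "sigma_finite_measure K" and Q: "AE x in P. Q x"
  shows "AE z in P \<Otimes>\<^sub>M K. Q (fst z)"
proof -
  interpret K: sigma_finite_measure K by fact
  obtain U where U: "{x \<in> space P. \<not> Q x} \<subseteq> U" "emeasure P U = 0" "U \<in> sets P"
    using Q by (rule AE_E)
  have "U \<times> space K \<in> null_sets (P \<Otimes>\<^sub>M K)"
    using U K.emeasure_pair_measure_Times[OF U(3) sets.top] by (auto simp: null_sets_def)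
  then have "AE z in P \<Otimes>\<^sub>M K. z \<notin> U \<times> space K" by (rule AE_not_in)
  with AE_space show ?thesis
    by eventually_elim (use U(1) in \<open>auto simp: space_pair_measure\<close>)
qed

lemma measurable_integral_kernel:
  fixes f :: "'a \<times> 'b \<Rightarrow> 'h::{banach,second_countable_topology}"
  assumes f [measurable]: "f \<in> borel_measurable (M \<Otimes>\<^sub>M N)"
    and L [measurable]: "L \<in> M \<rightarrow>\<^sub>M subprob_algebra N"
  shows "(\<lambda>x. LINT y|L x. f (x, y)) \<in> borel_measurable M"
proof -
  note measurable_distr2 [measurable]
  have "(\<lambda>x. LINT z|distr (L x) (M \<Otimes>\<^sub>M N) (\<lambda>y. (x, y)). f z) \<in> borel_measurable M"
    by measurable
  then show ?thesis
  proof (rule measurable_cong[THEN iffD1, rotated])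
    fix x assume x [measurable]: "x \<in> space M"
    have "sets (L x) = sets N"
      using measurable_space[OF L x] by (simp add: space_subprob_algebra)
    then have "Pair x \<in> L x \<rightarrow>\<^sub>M M \<Otimes>\<^sub>M N"
      using x by (simp cong: measurable_cong_sets)
    then show "(LINT z|distr (L x) (M \<Otimes>\<^sub>M N) (\<lambda>y. (x, y)). f z) = (LINT y|L x. f (x, y))"
      by (subst integral_distr) auto
  qed
qed

text \<open>
  The Doob--Dynkin lemma up to null sets: a simple function factors because each of its finitely many
  level sets is a preimage under \<open>T\<close> up to a null set, and \<open>F\<close> is a limit of simple functions.
\<close>

lemma AE_factorization:
  fixes F :: "'a \<Rightarrow> 'h::{banach,second_countable_topology}"
  assumes T [measurable]: "T \<in> Q \<rightarrow>\<^sub>M R"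
    and sets: "\<And>A. A \<in> sets Q \<Longrightarrow> \<exists>B\<in>sets R. AE x in Q. x \<in> A \<longleftrightarrow> T x \<in> B"
    and F: "F \<in> borel_measurable Q"
  obtains f where "f \<in> borel_measurable R" "AE x in Q. F x = f (T x)"
proof -
  obtain s where s: "\<And>i. simple_function Q (s i)" "\<And>x. x \<in> space Q \<Longrightarrow> (\<lambda>i. s i x) \<longlonglongrightarrow> F x"
    using borel_measurable_implies_sequence_metric[OF F, of 0] by blast
  have "\<exists>g\<in>borel_measurable R. AE x in Q. s i x = g (T x)" for i
  proof -
    have fin: "finite (s i ` space Q)" and [measurable]: "\<And>y. s i -` {y} \<inter> space Q \<in> sets Q"
      using simple_functionD[OF s(1)] by auto
    obtain B where B: "\<And>y. B y \<in> sets R" "\<And>y. AE x in Q. x \<in> s i -` {y} \<inter> space Q \<longleftrightarrow> T x \<in> B y"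
      using sets[of "s i -` {y} \<inter> space Q" for y] by (auto simp: Bex_def) metis
    let ?g = "\<lambda>z. \<Sum>y\<in>s i ` space Q. indicator (B y) z *\<^sub>R y"
    have "AE x in Q. \<forall>y\<in>s i ` space Q. x \<in> s i -` {y} \<inter> space Q \<longleftrightarrow> T x \<in> B y"
      by (intro AE_finite_allI fin B)
    with AE_space[of Q] have "AE x in Q. s i x = ?g (T x)"
    proof eventually_elim
      fix x assume x: "x \<in> space Q" "\<forall>y\<in>s i ` space Q. x \<in> s i -` {y} \<inter> space Q \<longleftrightarrow> T x \<in> B y"
      have "?g (T x) = (\<Sum>y\<in>s i ` space Q. (if s i x = y then y else 0))"
        using x by (intro sum.cong) (auto simp: indicator_def)
      then show "s i x = ?g (T x)" using fin x by simp
    qed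
    moreover have "?g \<in> borel_measurable R" using B(1) by measurable
    ultimately show ?thesis by (intro bexI[of _ ?g])
  qed
  then obtain g where g: "\<And>i. g i \<in> borel_measurable R" "\<And>i. AE x in Q. s i x = g i (T x)"
    by metis
  have "AE x in Q. \<forall>i. s i x = g i (T x)" using g(2) by (simp add: AE_all_countable)
  with AE_space[of Q] have "AE x in Q. F x = lim (\<lambda>i. g i (T x))"
  proof eventually_elim
    fix x assume "x \<in> space Q" "\<forall>i. s i x = g i (T x)"
    then show "F x = lim (\<lambda>i. g i (T x))" using s(2)[of x] by (auto intro!: limI[symmetric])
  qed
  moreover have "(\<lambda>z. lim (\<lambda>i. g i z)) \<in> borel_measurable R" using g(1) by measurable
  ultimately show ?thesis using that[of "\<lambda>z. lim (\<lambda>i. g i z)"] by auto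
qed

text \<open>
  The pointwise version is the almost sure one for the measure whose only null set is \<open>{}\<close>.
\<close>

lemma factorization:
  fixes F :: "'a \<Rightarrow> 'h::{banach,second_countable_topology}"
  assumes T: "T \<in> Q \<rightarrow>\<^sub>M R"
    and sets: "\<And>A. A \<in> sets Q \<Longrightarrow> \<exists>B\<in>sets R. \<forall>x\<in>space Q. x \<in> A \<longleftrightarrow> T x \<in> B"
    and F: "F \<in> borel_measurable Q"
  obtains f where "f \<in> borel_measurable R" "\<And>x. x \<in> space Q \<Longrightarrow> F x = f (T x)"
proof -
  define Q' where "Q' = measure_of (space Q) (sets Q) (\<lambda>A. if A = {} then 0 else \<infinity> :: ennreal)"
  have sets': "sets Q' = sets Q" and space': "space Q' = space Q"
    by (auto simp: Q'_def)
  have em: "emeasure Q' A = (if A = {} then 0 else \<infinity>)" if "A \<in> sets Q" for A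
  proof (rule emeasure_measure_of[OF Q'_def])
    show "countably_additive (sets Q') (\<lambda>A. if A = {} then 0 else \<infinity> :: ennreal)"
    proof (rule countably_additiveI)
      fix A :: "nat \<Rightarrow> 'a set"
      show "(\<Sum>i. if A i = {} then 0 else \<infinity> :: ennreal) = (if (\<Union>i. A i) = {} then 0 else \<infinity>)"
      proof (cases "\<forall>i. A i = {}")
        case False
        then obtain i where i: "A i \<noteq> {}" by blast
        have "(\<infinity>::ennreal) \<le> (\<Sum>i. if A i = {} then 0 else \<infinity>)"
          using sum_le_suminf[of "\<lambda>i. if A i = {} then 0 else \<infinity> :: ennreal" "{i}"] i by simp
        then show ?thesis using i by (auto simp: top_unique)
      qed simp
    qed
  qed (use that sets.space_closed in \<open>auto simp: sets' positive_def\<close>)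
  have AE: "(AE x in Q'. P x) \<longleftrightarrow> (\<forall>x\<in>space Q. P x)" for P
  proof
    assume "AE x in Q'. P x"
    then obtain A where A: "{x \<in> space Q'. \<not> P x} \<subseteq> A" "A \<in> sets Q'" "emeasure Q' A = 0"
      by (rule AE_E)
    then have "A = {}" using em[of A] by (auto simp: sets' split: if_splits)
    then show "\<forall>x\<in>space Q. P x" using A(1) by (auto simp: space')
  qed (auto simp: space' intro!: AE_I2)
  obtain f where "f \<in> borel_measurable R" "AE x in Q'. F x = f (T x)"
  proof (rule AE_factorization[of T Q' R F])
    show "T \<in> Q' \<rightarrow>\<^sub>M R" "F \<in> borel_measurable Q'"
      using T F by (simp_all cong: measurable_cong_sets add: sets')
    show "\<exists>B\<in>sets R. AE x in Q'. (x \<in> A) = (T x \<in> B)" if "A \<in> sets Q'" for A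
      using sets[of A] that by (simp only: AE sets')
  qed
  then show ?thesis using that by (auto simp: AE)
qed

section \<open>The space of configurations\<close>

lemma config_setD:
  assumes "\<eta> \<in> config_set M"
  shows "sets \<eta> = sets M" "space \<eta> = space M" "sigma_finite_measure \<eta>"
  using assms by (auto simp: config_set_def dest: sets_eq_imp_space_eq)

lemma config_set_emeasure_cases:
  assumes "\<eta> \<in> config_set M" "B \<in> sets M"
  obtains (nat) k :: nat where "emeasure \<eta> B = of_nat k" | (infinite) "emeasure \<eta> B = \<infinity>"
proof -
  obtain e where "emeasure \<eta> B = ennreal_of_enat e"
    using assms by (auto simp: config_set_def)
  then show ?thesis using that by (cases e) auto
qed

lemma space_config_space [simp]: "space (config_space M) = config_set M"
  unfolding config_space_def by (rule space_measure_of) auto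

lemma measurable_emeasure_config:
  assumes "B \<in> sets M"
  shows "(\<lambda>\<eta>. emeasure \<eta> B) \<in> borel_measurable (config_space M)"
proof (rule measurableI)
  fix A :: "ennreal set" assume "A \<in> sets borel"
  then show "(\<lambda>\<eta>. emeasure \<eta> B) -` A \<inter> space (config_space M) \<in> sets (config_space M)"
    unfolding space_config_space unfolding config_space_def
    by (subst sets_measure_of) (use assms in \<open>auto intro!: sigma_sets.Basic\<close>)
qed auto

lemma measurable_emeasure_config' [measurable (raw)]:
  assumes "f \<in> X \<rightarrow>\<^sub>M config_space M" "B \<in> sets M"
  shows "(\<lambda>w. emeasure (f w) B) \<in> borel_measurable X"
  using measurable_compose[OF assms(1) measurable_emeasure_config[OF assms(2)]] by simp

lemma measurable_config_spaceI:
  assumes "\<And>w. w \<in> space X \<Longrightarrow> f w \<in> config_set M"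
    and "\<And>B. B \<in> sets M \<Longrightarrow> (\<lambda>w. emeasure (f w) B) \<in> borel_measurable X"
  shows "f \<in> X \<rightarrow>\<^sub>M config_space M"
  unfolding config_space_def
proof (rule measurable_measure_of)
  fix U assume "U \<in> {{\<eta> \<in> config_set M. emeasure \<eta> B \<in> A} |B A. B \<in> sets M \<and> A \<in> sets borel}"
  then obtain B A where U: "U = {\<eta> \<in> config_set M. emeasure \<eta> B \<in> A}" "B \<in> sets M" "A \<in> sets borel"
    by blast
  have "f -` U \<inter> space X = (\<lambda>w. emeasure (f w) B) -` A \<inter> space X"
    using assms(1) U by auto
  then show "f -` U \<inter> space X \<in> sets X"
    using measurable_sets[OF assms(2) U(3)] U(2) by simp
qed (use assms(1) in auto)

subsection \<open>Adding a point\<close>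

lemma sets_add_dirac [simp]: "sets (add_dirac \<eta> x) = sets \<eta>"
  and space_add_dirac [simp]: "space (add_dirac \<eta> x) = space \<eta>"
  by (simp_all add: add_dirac_def)

lemma emeasure_add_dirac:
  assumes "B \<in> sets \<eta>"
  shows "emeasure (add_dirac \<eta> x) B = emeasure \<eta> B + indicator B x"
proof (rule emeasure_measure_of[OF add_dirac_def])
  show "countably_additive (sets (add_dirac \<eta> x)) (\<lambda>B. emeasure \<eta> B + indicator B x)"
  proof (rule countably_additiveI)
    fix A :: "nat \<Rightarrow> 'a set"
    assume A: "range A \<subseteq> sets (add_dirac \<eta> x)" "disjoint_family A"
    then show "(\<Sum>i. emeasure \<eta> (A i) + indicator (A i) x) = emeasure \<eta> (\<Union> (range A)) + indicator (\<Union> (range A)) x"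
      by (subst suminf_add[symmetric]) (auto simp: suminf_emeasure suminf_indicator)
  qed
qed (use assms sets.space_closed in \<open>auto simp: positive_def\<close>)

lemma add_dirac_in_config_set [intro, simp]:
  assumes "\<eta> \<in> config_set M"
  shows "add_dirac \<eta> x \<in> config_set M"
proof -
  note \<eta> = config_setD[OF assms]
  interpret sigma_finite_measure \<eta> by fact
  have "sigma_finite_measure (add_dirac \<eta> x)"
  proof
    obtain A :: "nat \<Rightarrow> _" where A: "range A \<subseteq> sets \<eta>" "(\<Union>i. A i) = space \<eta>" "\<And>i. emeasure \<eta> (A i) \<noteq> \<infinity>"
      using sigma_finite by metis
    then show "\<exists>A. countable A \<and> A \<subseteq> sets (add_dirac \<eta> x) \<and> \<Union> A = space (add_dirac \<eta> x) \<and>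
        (\<forall>a\<in>A. emeasure (add_dirac \<eta> x) a \<noteq> \<infinity>)"
      by (intro exI[of _ "range A"]) (auto simp: emeasure_add_dirac subset_eq split: split_indicator)
  qed
  moreover have "emeasure (add_dirac \<eta> x) B \<in> range ennreal_of_enat" if B: "B \<in> sets M" for B
  proof -
    have "indicator B x \<in> range ennreal_of_enat"
      using rangeI[of ennreal_of_enat 0] rangeI[of ennreal_of_enat 1] by (cases "x \<in> B") auto
    moreover have "emeasure \<eta> B \<in> range ennreal_of_enat"
      using assms B by (auto simp: config_set_def)
    ultimately obtain a b where "indicator B x = ennreal_of_enat a" "emeasure \<eta> B = ennreal_of_enat b"
      by auto
    then have "emeasure (add_dirac \<eta> x) B = ennreal_of_enat (b + a)"
      using B \<eta> by (simp add: emeasure_add_dirac)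
    then show ?thesis by blast
  qed
  ultimately show ?thesis using \<eta> by (auto simp: config_set_def)
qed

lemma add_dirac_commute: "add_dirac (add_dirac \<eta> x) y = add_dirac (add_dirac \<eta> y) x"
  by (rule measure_eqI) (auto simp: emeasure_add_dirac ac_simps)

lemma measurable_add_dirac [measurable (raw)]:
  assumes f: "f \<in> X \<rightarrow>\<^sub>M config_space M" and g: "g \<in> X \<rightarrow>\<^sub>M M"
  shows "(\<lambda>w. add_dirac (f w) (g w)) \<in> X \<rightarrow>\<^sub>M config_space M"
proof (rule measurable_config_spaceI)
  have f': "f w \<in> config_set M" if "w \<in> space X" for w
    using measurable_space[OF f that] by simp
  show "add_dirac (f w) (g w) \<in> config_set M" if "w \<in> space X" for w
    using f'[OF that] by auto
  fix B assume B [measurable]: "B \<in> sets M"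
  have "(\<lambda>w. emeasure (f w) B + indicator B (g w)) \<in> borel_measurable X"
    using f g by measurable
  then show "(\<lambda>w. emeasure (add_dirac (f w) (g w)) B) \<in> borel_measurable X"
    by (rule measurable_cong[THEN iffD1, rotated])
       (use B config_setD(1)[OF f'] in \<open>simp add: emeasure_add_dirac\<close>)
qed

lemma nn_integral_add_dirac:
  assumes g: "g \<in> borel_measurable \<eta>" and x: "x \<in> space \<eta>"
  shows "(\<integral>\<^sup>+ y. g y \<partial>add_dirac \<eta> x) = (\<integral>\<^sup>+ y. g y \<partial>\<eta>) + g x"
proof -

  have [measurable_cong]: "sets (add_dirac \<eta> x) = sets \<eta>" by simp
  show ?thesis using g
  proof induct
    case (cong f g)
    have "(\<integral>\<^sup>+ y. f y \<partial>add_dirac \<eta> x) = (\<integral>\<^sup>+ y. g y \<partial>add_dirac \<eta> x)"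
      using cong(3) by (intro nn_integral_cong) simp
    also have "\<dots> = (\<integral>\<^sup>+ y. f y \<partial>\<eta>) + f x"
      using cong(3) x unfolding cong(4) by (simp cong: nn_integral_cong)
    finally show ?case .
  next
    case (set A)
    then show ?case by (simp add: emeasure_add_dirac)
  next
    case (mult u c)
    then show ?case by (simp add: nn_integral_cmult distrib_left)
  next
    case (add u v)
    then show ?case by (simp add: nn_integral_add ac_simps)
  next
    case (seq U)
    have SUP: "integral\<^sup>N \<nu> (Sup (range U)) = (SUP i. integral\<^sup>N \<nu> (U i))" if "sets \<nu> = sets \<eta>" for \<nu>
    proof -
      have "integral\<^sup>N \<nu> (Sup (range U)) = (\<integral>\<^sup>+ y. (SUP i. U i y) \<partial>\<nu>)"
        by (intro nn_integral_cong) (simp add: image_comp)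
      then show ?thesis
        using seq(1,4) that by (simp add: nn_integral_monotone_convergence_SUP cong: measurable_cong_sets)
    qed
    have "incseq (\<lambda>i. integral\<^sup>N \<eta> (U i))" "incseq (\<lambda>i. U i x)"
      using seq(4) by (auto simp: incseq_def le_fun_def intro!: nn_integral_mono)
    then show ?case
      unfolding SUP[OF refl] SUP[OF sets_add_dirac] seq(3) by (simp add: ennreal_SUP_add image_comp)
  qed
qed

lemma integrable_add_dirac:
  fixes f :: "'a \<Rightarrow> 'h::{banach,second_countable_topology}"
  assumes "integrable \<eta> f" "x \<in> space \<eta>"
  shows "integrable (add_dirac \<eta> x) f"
  using assms unfolding integrable_iff_bounded
  by (auto simp: nn_integral_add_dirac cong: measurable_cong_sets)

lemma integral_add_dirac_real:
  fixes f :: "'a \<Rightarrow> real"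
  assumes f: "integrable \<eta> f" and x: "x \<in> space \<eta>"
  shows "(LINT y|add_dirac \<eta> x. f y) = (LINT y|\<eta>. f y) + f x"
proof -
  have fin: "(\<integral>\<^sup>+ y. ennreal (f y) \<partial>\<eta>) < \<infinity>" "(\<integral>\<^sup>+ y. ennreal (- f y) \<partial>\<eta>) < \<infinity>"
    using f by (auto simp: real_integrable_def less_top)
  have [measurable]: "f \<in> borel_measurable \<eta>" using f by auto
  show ?thesis
    using f fin x by (cases "f x \<ge> 0")
      (simp_all add: real_lebesgue_integral_def integrable_add_dirac nn_integral_add_dirac enn2real_plus ennreal_neg)
qed

text \<open>
  Testing against vectors reduces the claim to real functions, where positive and negative parts can
  be treated with \<open>nn_integral_add_dirac\<close>.
\<close>

lemma integral_add_dirac: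
  fixes f :: "'a \<Rightarrow> 'h::{real_inner,banach,second_countable_topology}"
  assumes f: "integrable \<eta> f" and x: "x \<in> space \<eta>"
  shows "(LINT y|add_dirac \<eta> x. f y) = (LINT y|\<eta>. f y) + f x"
proof (rule vector_eq_rdot[THEN iffD1], rule allI)
  fix v :: 'h
  have "v \<bullet> (LINT y|add_dirac \<eta> x. f y) = (LINT y|add_dirac \<eta> x. v \<bullet> f y)"
    using integrable_add_dirac[OF f x] by simp
  also have "\<dots> = (LINT y|\<eta>. v \<bullet> f y) + v \<bullet> f x"
    using f x by (intro integral_add_dirac_real) auto
  also have "\<dots> = v \<bullet> ((LINT y|\<eta>. f y) + f x)"
    using f by (simp add: inner_add_right)
  finally show "(LINT y|add_dirac \<eta> x. f y) \<bullet> v = ((LINT y|\<eta>. f y) + f x) \<bullet> v"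
    by (simp add: inner_commute)
qed

text \<open>
  Removing a point is a measurable operation on processes: the map \<open>(\<eta>, x) \<mapsto> (\<eta> + \<delta>\<^sub>x, x)\<close> generates the
  whole product \<open>\<sigma>\<close>-algebra, because \<open>\<eta>(B) = (\<eta> + \<delta>\<^sub>x)(B) - 1\<^sub>B(x)\<close> recovers the counts of \<open>\<eta>\<close>. Hence
  every process factors through it. The function \<open>\<theta>\<close> plays the role of \<open>(\<eta>, x) \<mapsto> \<phi>(\<eta> - \<delta>\<^sub>x, x)\<close>.
\<close>

lemma point_removal:
  fixes \<phi> :: "'e measure \<times> 'e \<Rightarrow> 'h::{banach,second_countable_topology}"
  assumes \<phi>: "\<phi> \<in> borel_measurable (config_space M \<Otimes>\<^sub>M M)"
  obtains \<theta> where "\<theta> \<in> borel_measurable (config_space M \<Otimes>\<^sub>M M)"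
    "\<And>\<eta> x. \<eta> \<in> config_set M \<Longrightarrow> x \<in> space M \<Longrightarrow> \<phi> (\<eta>, x) = \<theta> (add_dirac \<eta> x, x)"
proof -
  let ?Q = "config_space M \<Otimes>\<^sub>M M"
  define T :: "'e measure \<times> 'e \<Rightarrow> 'e measure \<times> 'e" where "T p = (add_dirac (fst p) (snd p), snd p)" for p
  have T: "T \<in> ?Q \<rightarrow>\<^sub>M ?Q" unfolding T_def by measurable
  define V where "V = vimage_algebra (space ?Q) T ?Q"
  have spV: "space V = config_set M \<times> space M" by (simp add: V_def space_pair_measure)
  have TV: "T \<in> V \<rightarrow>\<^sub>M ?Q" unfolding V_def
    by (rule measurable_vimage_algebra1) (use measurable_space[OF T] in auto)
  have "(\<lambda>p. (fst p, snd p)) \<in> V \<rightarrow>\<^sub>M ?Q"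
  proof (rule measurable_Pair)
    show "snd \<in> V \<rightarrow>\<^sub>M M"
      using measurable_compose[OF TV measurable_snd] by (simp add: T_def)
    show "fst \<in> V \<rightarrow>\<^sub>M config_space M"
    proof (rule measurable_config_spaceI)
      fix B assume B [measurable]: "B \<in> sets M"
      \<comment> \<open>the mass of \<open>\<eta>\<close> is that of \<open>\<eta> + \<delta>\<^sub>x\<close> diminished by \<open>1\<^sub>B(x)\<close>, also where it is infinite\<close>
      have "(\<lambda>q. emeasure (fst q) B - indicator B (snd q)) \<in> borel_measurable ?Q" by measurable
      from measurable_compose[OF TV this]
      have "(\<lambda>p. emeasure (add_dirac (fst p) (snd p)) B - indicator B (snd p)) \<in> borel_measurable V"
        by (simp add: T_def)
      then show "(\<lambda>p. emeasure (fst p) B) \<in> borel_measurable V"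
      proof (rule measurable_cong[THEN iffD1, rotated])
        fix p assume "p \<in> space V"
        then have "B \<in> sets (fst p)" using B spV config_setD(1)[of "fst p" M] by auto
        then show "emeasure (add_dirac (fst p) (snd p)) B - indicator B (snd p) = emeasure (fst p) B"
          by (simp add: emeasure_add_dirac split: split_indicator)
      qed
    qed (auto simp: spV)
  qed
  then have "A \<in> sets V" if "A \<in> sets ?Q" for A
    using measurable_sets[of "\<lambda>p. p" V ?Q A] that sets.sets_into_space[OF that] spV
    by (simp add: space_pair_measure Int_absorb2)
  then have "\<exists>B\<in>sets ?Q. \<forall>p\<in>space ?Q. p \<in> A \<longleftrightarrow> T p \<in> B" if "A \<in> sets ?Q" for A
    using that unfolding V_def by (fastforce simp: sets_vimage_algebra2 measurable_space[OF T] Pi_def)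
  then obtain \<theta> where \<theta>: "\<theta> \<in> borel_measurable ?Q" "\<And>p. p \<in> space ?Q \<Longrightarrow> \<phi> p = \<theta> (T p)"
    using factorization[OF T _ \<phi>] by metis
  then have "\<phi> (\<eta>, x) = \<theta> (add_dirac \<eta> x, x)" if "\<eta> \<in> config_set M" "x \<in> space M" for \<eta> x
    using \<theta>(2)[of "(\<eta>, x)"] that by (simp add: T_def space_pair_measure)
  with \<theta>(1) show ?thesis using that by blast
qed

subsection \<open>Integrals with respect to a configuration\<close>

text \<open>
  Restricting a configuration to \<open>A\<close> and dividing by the number of points gives a kernel of
  subprobability measures, for which measurability of integrals is standard. As \<open>measure \<eta> A\<close> and
  division by zero are \<open>0\<close> by convention, the kernel vanishes where \<open>\<eta>(A)\<close> is \<open>0\<close> or \<open>\<infinity>\<close>.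
\<close>

definition normalized :: "'e set \<Rightarrow> 'e measure \<Rightarrow> 'e measure" where
  "normalized A \<eta> = density \<eta> (\<lambda>x. ennreal (indicator A x / measure \<eta> A))"

lemma emeasure_normalized:
  assumes "A \<in> sets \<eta>" "B \<in> sets \<eta>"
  shows "emeasure (normalized A \<eta>) B = ennreal (1 / measure \<eta> A) * emeasure \<eta> (A \<inter> B)"
proof -
  have [measurable]: "A \<in> sets \<eta>" "B \<in> sets \<eta>" using assms by auto
  have "emeasure (normalized A \<eta>) B = (\<integral>\<^sup>+ x. ennreal (1 / measure \<eta> A) * indicator (A \<inter> B) x \<partial>\<eta>)"
    unfolding normalized_def by (subst emeasure_density) (auto intro!: nn_integral_cong split: split_indicator)
  then show ?thesis by (simp add: nn_integral_cmult)
qed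

lemma measurable_normalized:
  assumes A [measurable]: "A \<in> sets M" and ne: "space M \<noteq> {}"
  shows "normalized A \<in> config_space M \<rightarrow>\<^sub>M subprob_algebra M"
proof (rule measurable_subprob_algebra)
  fix \<eta> assume "\<eta> \<in> space (config_space M)"
  then have "\<eta> \<in> config_set M" by simp
  note \<eta> = config_setD(1,2)[OF this]
  show "sets (normalized A \<eta>) = sets M" using \<eta> by (simp add: normalized_def)
  have "ennreal (1 / measure \<eta> A) * emeasure \<eta> (A \<inter> space \<eta>) \<le> 1"
  proof (cases "emeasure \<eta> A = \<infinity>")
    case True
    then show ?thesis by (simp add: measure_def)
  next
    case False
    then show ?thesis using \<eta> A
      by (auto simp: emeasure_eq_ennreal_measure Int_absorb2 sets.sets_into_space
          ennreal_mult[symmetric] divide_simps)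
  qed
  then have "emeasure (normalized A \<eta>) (space \<eta>) \<le> 1"
    using \<eta> A by (subst emeasure_normalized) auto
  then show "subprob_space (normalized A \<eta>)"
    using ne \<eta> by (intro subprob_spaceI) (auto simp: normalized_def)
next
  fix B assume B [measurable]: "B \<in> sets M"
  have "(\<lambda>\<eta>. ennreal (1 / enn2real (emeasure \<eta> A)) * emeasure \<eta> (A \<inter> B)) \<in> borel_measurable (config_space M)"
    by measurable
  then show "(\<lambda>\<eta>. emeasure (normalized A \<eta>) B) \<in> borel_measurable (config_space M)"
    by (rule measurable_cong[THEN iffD1, rotated])
       (use A B config_setD(1)[of _ M] in \<open>simp add: emeasure_normalized measure_def\<close>)
qed

lemma AE_eq_0_if_measure_eq_0:
  assumes A: "A \<in> sets \<eta>" and null: "measure \<eta> A = 0"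
    and supp: "\<And>x. x \<in> space \<eta> \<Longrightarrow> g x \<noteq> 0 \<Longrightarrow> x \<in> A \<and> emeasure \<eta> A < \<infinity>"
  shows "AE x in \<eta>. g x = 0"
proof (cases "emeasure \<eta> A = 0")
  case True
  then have "AE x in \<eta>. x \<notin> A" using A by (intro AE_not_in) (auto simp: null_sets_def)
  with AE_space[of \<eta>] show ?thesis
    by eventually_elim (use supp in auto)
next
  case False
  then have "emeasure \<eta> A = \<infinity>" using null
    by (auto simp: measure_def enn2real_eq_0_iff)
  then show ?thesis using supp by (intro AE_I2) auto
qed

lemma nn_integral_normalized:
  assumes g [measurable]: "g \<in> borel_measurable \<eta>" and A [measurable]: "A \<in> sets \<eta>"
    and supp: "\<And>x. x \<in> space \<eta> \<Longrightarrow> g x \<noteq> 0 \<Longrightarrow> x \<in> A \<and> emeasure \<eta> A < \<infinity>"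
  shows "ennreal (enn2real (emeasure \<eta> A)) * (\<integral>\<^sup>+ x. g x \<partial>normalized A \<eta>) = (\<integral>\<^sup>+ x. g x \<partial>\<eta>)"
proof (cases "measure \<eta> A = 0")
  case True
  have "AE x in \<eta>. g x = 0"
    using True A supp by (intro AE_eq_0_if_measure_eq_0[of A]) auto
  then have "(\<integral>\<^sup>+ x. g x \<partial>\<eta>) = 0" by (subst nn_integral_0_iff_AE) auto
  then show ?thesis using True by (simp add: measure_def)
next
  case False
  have "(\<integral>\<^sup>+ x. g x \<partial>normalized A \<eta>) = (\<integral>\<^sup>+ x. ennreal (1 / measure \<eta> A) * g x \<partial>\<eta>)"
    unfolding normalized_def
    by (subst nn_integral_density)
       (auto intro!: nn_integral_cong split: split_indicator dest: supp)
  also have "\<dots> = ennreal (1 / measure \<eta> A) * (\<integral>\<^sup>+ x. g x \<partial>\<eta>)"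
    by (simp add: nn_integral_cmult)
  finally show ?thesis using False
    by (simp add: measure_def mult.assoc[symmetric] ennreal_mult[symmetric])
qed

text \<open>
  The identity on configurations is not a uniformly \<open>\<sigma>\<close>-finite kernel, which is why the integrand is
  confined to a set \<open>A\<close> and to configurations with finitely many points in \<open>A\<close>.
\<close>

lemma measurable_nn_integral_config:
  assumes g: "g \<in> borel_measurable (config_space M \<Otimes>\<^sub>M M)" and A: "A \<in> sets M"
    and supp: "\<And>\<eta> x. \<eta> \<in> config_set M \<Longrightarrow> x \<in> space M \<Longrightarrow> g (\<eta>, x) \<noteq> 0 \<Longrightarrow> x \<in> A \<and> emeasure \<eta> A < \<infinity>"
  shows "(\<lambda>\<eta>. \<integral>\<^sup>+ x. g (\<eta>, x) \<partial>\<eta>) \<in> borel_measurable (config_space M)"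
proof (cases "space M = {}")
  case True
  have "(\<integral>\<^sup>+ x. g (\<eta>, x) \<partial>\<eta>) = 0" if "\<eta> \<in> config_set M" for \<eta>
    using True config_setD[OF that] by (simp add: nn_integral_empty)
  then show ?thesis by (subst measurable_cong[where g="\<lambda>_. 0"]) auto
next
  case False
  have [measurable]: "normalized A \<in> config_space M \<rightarrow>\<^sub>M subprob_algebra M"
    using measurable_normalized[OF A False] .
  have "(\<lambda>\<eta>. ennreal (enn2real (emeasure \<eta> A)) * (\<integral>\<^sup>+ x. g (\<eta>, x) \<partial>normalized A \<eta>))
      \<in> borel_measurable (config_space M)"
    using nn_integral_measurable_subprob_algebra2[of "\<lambda>\<eta> x. g (\<eta>, x)" "config_space M" M "normalized A"] g A
    by measurable
  then show ?thesis
  proof (rule measurable_cong[THEN iffD1, rotated])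
    fix \<eta> assume "\<eta> \<in> space (config_space M)"
    then have \<eta>: "\<eta> \<in> config_set M" by simp
    note [simp] = config_setD[OF \<eta>]
    have [measurable]: "(\<lambda>x. g (\<eta>, x)) \<in> borel_measurable \<eta>"
      using measurable_Pair2[OF g, of \<eta>] \<eta> by (simp cong: measurable_cong_sets)
    have [measurable]: "A \<in> sets \<eta>" using A by simp
    show "ennreal (enn2real (emeasure \<eta> A)) * (\<integral>\<^sup>+ x. g (\<eta>, x) \<partial>normalized A \<eta>) = (\<integral>\<^sup>+ x. g (\<eta>, x) \<partial>\<eta>)"
      using supp[OF \<eta>] A by (intro nn_integral_normalized) auto
  qed
qed

lemma measurable_integral_config:
  fixes g :: "'e measure \<times> 'e \<Rightarrow> 'h::{banach,second_countable_topology}"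
  assumes g: "g \<in> borel_measurable (config_space M \<Otimes>\<^sub>M M)" and A: "A \<in> sets M"
    and supp: "\<And>\<eta> x. \<eta> \<in> config_set M \<Longrightarrow> x \<in> space M \<Longrightarrow> g (\<eta>, x) \<noteq> 0 \<Longrightarrow> x \<in> A \<and> emeasure \<eta> A < \<infinity>"
  shows "(\<lambda>\<eta>. LINT x|\<eta>. g (\<eta>, x)) \<in> borel_measurable (config_space M)"
proof (cases "space M = {}")
  case True
  have "(LINT x|\<eta>. g (\<eta>, x)) = 0" if "\<eta> \<in> config_set M" for \<eta>
    using True config_setD[OF that] by (intro integral_eq_zero_AE AE_I2) simp
  then show ?thesis by (subst measurable_cong[where g="\<lambda>_. 0"]) auto
next
  case False
  have [measurable]: "normalized A \<in> config_space M \<rightarrow>\<^sub>M subprob_algebra M"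
    using measurable_normalized[OF A False] .
  have "(\<lambda>\<eta>. enn2real (emeasure \<eta> A) *\<^sub>R (LINT x|normalized A \<eta>. g (\<eta>, x)))
      \<in> borel_measurable (config_space M)"
    using measurable_integral_kernel[OF g, of "normalized A"] A by measurable
  then show ?thesis
  proof (rule measurable_cong[THEN iffD1, rotated])
    fix \<eta> assume "\<eta> \<in> space (config_space M)"
    then have \<eta>: "\<eta> \<in> config_set M" by simp
    note [simp] = config_setD[OF \<eta>]
    have [measurable]: "(\<lambda>x. g (\<eta>, x)) \<in> borel_measurable \<eta>"
      using measurable_Pair2[OF g, of \<eta>] \<eta> by (simp cong: measurable_cong_sets)
    have [measurable]: "A \<in> sets \<eta>" using A by simp
    show "enn2real (emeasure \<eta> A) *\<^sub>R (LINT x|normalized A \<eta>. g (\<eta>, x)) = (LINT x|\<eta>. g (\<eta>, x))"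
    proof (cases "measure \<eta> A = 0")
      case True
      have "AE x in \<eta>. g (\<eta>, x) = 0"
        using True A supp[OF \<eta>] by (intro AE_eq_0_if_measure_eq_0[of A]) auto
      then have "(LINT x|\<eta>. g (\<eta>, x)) = 0" by (rule integral_eq_zero_AE)
      then show ?thesis using True by (simp add: measure_def)
    next
      case False
      have "(LINT x|normalized A \<eta>. g (\<eta>, x)) = (LINT x|\<eta>. (1 / measure \<eta> A) *\<^sub>R g (\<eta>, x))"
        unfolding normalized_def
        by (subst integral_density)
           (auto intro!: Bochner_Integration.integral_cong split: split_indicator dest: supp[OF \<eta>]
             simp del: integral_scaleR_right)
      then show ?thesis using False by (simp add: measure_def)
    qed
  qed
qed

subsection \<open>A generating system\<close>

definition count_events :: "'e measure \<Rightarrow> 'e measure set set" where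
  "count_events M = {{\<eta> \<in> config_set M. \<forall>(B, k)\<in>S. emeasure \<eta> B = of_nat k} | S :: ('e set \<times> nat) set.
     finite S \<and> (\<forall>(B, k)\<in>S. B \<in> sets M \<and> emeasure M B < \<infinity>)}"

lemma Int_stable_count_events: "Int_stable (count_events M)"
proof (rule Int_stableI)
  fix U V assume "U \<in> count_events M" "V \<in> count_events M"
  then obtain S T where
    U: "U = {\<eta> \<in> config_set M. \<forall>(B, k)\<in>S. emeasure \<eta> B = of_nat k}" and
    V: "V = {\<eta> \<in> config_set M. \<forall>(B, k)\<in>T. emeasure \<eta> B = of_nat k}" and
    ST: "finite S" "\<forall>(B, k)\<in>S. B \<in> sets M \<and> emeasure M B < \<infinity>"
      "finite T" "\<forall>(B, k)\<in>T. B \<in> sets M \<and> emeasure M B < \<infinity>"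
    unfolding count_events_def by blast
  have "U \<inter> V = {\<eta> \<in> config_set M. \<forall>(B, k)\<in>S \<union> T. emeasure \<eta> B = of_nat k}"
    unfolding U V by auto
  moreover have "finite (S \<union> T)" "\<forall>(B, k)\<in>S \<union> T. B \<in> sets M \<and> emeasure M B < \<infinity>"
    using ST by auto
  ultimately show "U \<inter> V \<in> count_events M" unfolding count_events_def by blast
qed

lemma count_event_in_sets:
  assumes S: "finite S" "\<And>B k. (B, k) \<in> S \<Longrightarrow> B \<in> sets M"
  shows "{\<eta> \<in> config_set M. \<forall>(B, k)\<in>S. emeasure \<eta> B = of_nat k} \<in> sets (config_space M)"
proof -
  have "{\<eta> \<in> space (config_space M). emeasure \<eta> (fst p) = of_nat (snd p)} \<in> sets (config_space M)"
    if "p \<in> S" for p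
  proof -
    have [measurable]: "fst p \<in> sets M" using S(2)[of "fst p" "snd p"] that by simp
    show ?thesis by measurable
  qed
  then have "{\<eta> \<in> space (config_space M). \<forall>p\<in>S. emeasure \<eta> (fst p) = of_nat (snd p)} \<in> sets (config_space M)"
    by (intro sets.sets_Collect_finite_All S)
  then show ?thesis by (simp add: case_prod_unfold)
qed

text \<open>
  Sets of finite measure suffice: a set is the increasing union of its intersections with an
  exhausting sequence. Prescribed finite counts suffice since a count only takes values in
  \<open>\<nat> \<union> {\<infinity>}\<close>.
\<close>

lemma sets_config_space_count_events:
  assumes "sigma_finite_measure M"
  shows "sets (config_space M) = sigma_sets (config_set M) (count_events M)"
proof
  show "sigma_sets (config_set M) (count_events M) \<subseteq> sets (config_space M)"
    using sets.sigma_sets_subset[of "count_events M" "config_space M"] count_event_in_sets[of _ M]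
    unfolding space_config_space by (fastforce simp: count_events_def)
  interpret sigma_finite_measure M by fact
  define V where "V = sigma (config_set M) (count_events M)"
  have Pow: "count_events M \<subseteq> Pow (config_set M)" by (auto simp: count_events_def)
  have spV: "space V = config_set M" and setsV: "sets V = sigma_sets (config_set M) (count_events M)"
    using Pow by (auto simp: V_def)
  have fin: "(\<lambda>\<eta>. emeasure \<eta> B) \<in> borel_measurable V" if B: "B \<in> sets M" "emeasure M B < \<infinity>" for B
  proof (rule measurableI)
    let ?E = "\<lambda>k::nat. {\<eta> \<in> config_set M. emeasure \<eta> B = of_nat k}"
    have E: "?E k \<in> sets V" for k
      unfolding setsV by (rule sigma_sets.Basic)
        (use B in \<open>auto simp: count_events_def intro!: exI[of _ "{(B, k)}"]\<close>)
    fix A :: "ennreal set"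
    have "(\<lambda>\<eta>. emeasure \<eta> B) -` A \<inter> space V =
        (\<Union>k\<in>{k. of_nat k \<in> A}. ?E k) \<union> (if \<infinity> \<in> A then space V - (\<Union>k. ?E k) else {})" (is "?L = ?R")
    proof (intro set_eqI)
      fix \<eta> show "\<eta> \<in> ?L \<longleftrightarrow> \<eta> \<in> ?R"
      proof (cases "\<eta> \<in> config_set M")
        case True
        then show ?thesis using B(1) by (cases rule: config_set_emeasure_cases) (auto simp: spV)
      qed (auto simp: spV)
    qed
    moreover have "?R \<in> sets V"
      using E by (auto intro!: sets.Un sets.countable_UN' sets.Diff sets.top)
    ultimately show "(\<lambda>\<eta>. emeasure \<eta> B) -` A \<inter> space V \<in> sets V" by simp
  qed auto
  obtain A :: "nat \<Rightarrow> _" where A: "range A \<subseteq> sets M" "(\<Union>i. A i) = space M" "\<And>i. emeasure M (A i) \<noteq> \<infinity>" "incseq A"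
    using sigma_finite_incseq by metis
  have "(\<lambda>\<eta>. \<eta>) \<in> V \<rightarrow>\<^sub>M config_space M"
  proof (rule measurable_config_spaceI)
    fix B assume B: "B \<in> sets M"
    have "emeasure M (B \<inter> A n) < \<infinity>" for n
      using le_less_trans[OF emeasure_mono[of "B \<inter> A n" "A n" M]] A by (auto simp: less_top)
    then have "(\<lambda>\<eta>. SUP n. emeasure \<eta> (B \<inter> A n)) \<in> borel_measurable V"
      using A B by (intro borel_measurable_SUP fin) auto
    then show "(\<lambda>\<eta>. emeasure \<eta> B) \<in> borel_measurable V"
    proof (rule measurable_cong[THEN iffD1, rotated])
      fix \<eta> assume "\<eta> \<in> space V"
      then have "sets \<eta> = sets M" using config_setD(1)[of \<eta> M] by (auto simp: spV)
      then have "(SUP n. emeasure \<eta> (B \<inter> A n)) = emeasure \<eta> (\<Union>n. B \<inter> A n)"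
        using A B by (intro SUP_emeasure_incseq) (auto simp: incseq_def, blast)
      also have "(\<Union>n. B \<inter> A n) = B" using A(2) sets.sets_into_space[OF B] by blast
      finally show "(SUP n. emeasure \<eta> (B \<inter> A n)) = emeasure \<eta> B" .
    qed
  qed (simp add: spV)
  then show "sets (config_space M) \<subseteq> sigma_sets (config_set M) (count_events M)"
    using measurable_sets[of "\<lambda>\<eta>. \<eta>" V "config_space M"] sets.sets_into_space[of _ "config_space M"]
    by (fastforce simp: spV setsV Int_absorb2)
qed

section \<open>The Mecke equation\<close>

text \<open>
  The law of a Poisson random measure, given by its finite-dimensional distributions on disjoint sets. The
  families are indexed by sets of sets because they are going to consist of the atoms of a finite family
  of sets, and an atom is determined by the members that contain it.
\<close>

locale poisson_law = M: sigma_finite_measure M + prob_space \<L>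
  for M :: "'e measure" and \<L> :: "'e measure measure" +
  assumes sets_law: "sets \<L> = sets (config_space M)"
    and joint_law: "\<And>(Q :: 'e set set set) C k. finite Q \<Longrightarrow> disjoint_family_on C Q \<Longrightarrow>
      (\<And>J. J \<in> Q \<Longrightarrow> C J \<in> sets M \<and> emeasure M (C J) < \<infinity>) \<Longrightarrow>
      measure \<L> {\<eta> \<in> config_set M. \<forall>J\<in>Q. emeasure \<eta> (C J) = of_nat (k J)} =
        (\<Prod>J\<in>Q. exp (- measure M (C J)) * measure M (C J) ^ k J / fact (k J))"
begin

lemma space_law [simp]: "space \<L> = config_set M"
  using sets_eq_imp_space_eq[OF sets_law] by simp

lemma sets_law_cong [measurable_cong]: "sets \<L> = sets (config_space M)"
  by (rule sets_law)

lemma sets_law_pair: "sets (\<L> \<Otimes>\<^sub>M X) = sets (config_space M \<Otimes>\<^sub>M X)"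
  by (intro sets_pair_measure_cong sets_law refl)

lemma measurable_law_iff: "borel_measurable \<L> = borel_measurable (config_space M)"
  by (rule measurable_cong_sets[OF sets_law refl])

lemma measurable_law_pair_iff: "borel_measurable (\<L> \<Otimes>\<^sub>M X) = borel_measurable (config_space M \<Otimes>\<^sub>M X)"
  by (rule measurable_cong_sets[OF sets_law_pair refl])

lemma config_set_in_events [measurable, simp]: "config_set M \<in> events"
  using sets.top[of \<L>] by simp

sublocale LM: pair_sigma_finite \<L> M ..

sublocale MM: pair_sigma_finite M M ..

sublocale LMM: pair_sigma_finite \<L> "M \<Otimes>\<^sub>M M" ..

text \<open>
  The Poisson weights sum up to one, which leaves no mass for an infinite count.
\<close>

lemma AE_finite_count:
  assumes B: "B \<in> sets M" "emeasure M B < \<infinity>"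
  shows "AE \<eta> in \<L>. emeasure \<eta> B < \<infinity>"
proof -
  let ?E = "\<lambda>k::nat. {\<eta> \<in> config_set M. emeasure \<eta> B = of_nat k}"
  have E: "?E k \<in> sets \<L>" for k
    using count_event_in_sets[of "{(B, k)}" M] B by (simp add: sets_law)
  have "measure \<L> (?E k) = exp (- measure M B) * (measure M B ^ k /\<^sub>R fact k)" for k
    using joint_law[of "{{}}" "\<lambda>_. B" "\<lambda>_. k"] B by (simp add: disjoint_family_on_def field_simps)
  moreover have "(\<lambda>k. exp (- measure M B) * (measure M B ^ k /\<^sub>R fact k)) sums (exp (- measure M B) * exp (measure M B))"
    by (intro sums_mult exp_converges)
  moreover have "(\<lambda>k. measure \<L> (?E k)) sums measure \<L> (\<Union>k. ?E k)"
    using E by (intro finite_measure_UNION) (auto simp: disjoint_family_on_def)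
  ultimately have "measure \<L> (\<Union>k. ?E k) = 1"
    using sums_unique2 by (fastforce simp: exp_minus)
  then have "AE \<eta> in \<L>. \<eta> \<in> (\<Union>k. ?E k)"
    using E prob_eq_1[of "\<Union>k. ?E k"] by auto
  then show ?thesis by eventually_elim (auto simp: of_nat_less_top)
qed

text \<open>
  Both sides of the Mecke equation for \<open>g(\<eta>, x) = 1\<^sub>U(\<eta>) 1\<^sub>A(x)\<close>, as measures in \<open>U\<close>.
\<close>

definition count_weighted :: "'e set \<Rightarrow> 'e measure measure" where
  "count_weighted A = density \<L> (\<lambda>\<eta>. emeasure \<eta> A)"

definition point_added :: "'e set \<Rightarrow> 'e measure measure" where
  "point_added A = distr (density (\<L> \<Otimes>\<^sub>M M) (\<lambda>z. indicator A (snd z))) (config_space M)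
     (\<lambda>z. add_dirac (fst z) (snd z))"

lemma measurable_emeasure_law [measurable]:
  "B \<in> sets M \<Longrightarrow> (\<lambda>\<eta>. emeasure \<eta> B) \<in> borel_measurable \<L>"
  by (simp add: measurable_emeasure_config measurable_cong_sets[OF sets_law refl])

lemma emeasure_count_weighted:
  assumes [measurable]: "A \<in> sets M" "U \<in> sets (config_space M)"
  shows "emeasure (count_weighted A) U = (\<integral>\<^sup>+ \<eta>. emeasure \<eta> A * indicator U \<eta> \<partial>\<L>)"
  unfolding count_weighted_def by (subst emeasure_density) (auto simp: sets_law)

lemma emeasure_point_added:
  assumes A [measurable]: "A \<in> sets M" and U [measurable]: "U \<in> sets (config_space M)"
  shows "emeasure (point_added A) U =
    (\<integral>\<^sup>+ \<eta>. \<integral>\<^sup>+ x. indicator A x * indicator U (add_dirac \<eta> x) \<partial>M \<partial>\<L>)"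
proof -
  have "emeasure (point_added A) U =
      (\<integral>\<^sup>+ z. indicator U z \<partial>point_added A)"
    by (subst nn_integral_indicator) (auto simp: point_added_def)
  also have "\<dots> = (\<integral>\<^sup>+ z. indicator A (snd z) * indicator U (add_dirac (fst z) (snd z)) \<partial>(\<L> \<Otimes>\<^sub>M M))"
    unfolding point_added_def by (subst nn_integral_distr, simp, simp, subst nn_integral_density) simp_all
  also have "\<dots> = (\<integral>\<^sup>+ \<eta>. \<integral>\<^sup>+ x. indicator A x * indicator U (add_dirac \<eta> x) \<partial>M \<partial>\<L>)"
    by (subst M.nn_integral_fst[symmetric]) (simp_all)
  finally show ?thesis .
qed

text \<open>
  The Poisson weights satisfy \<open>k p\<^sub>\<lambda>(k) = \<lambda> p\<^sub>\<lambda>(k - 1)\<close>; by independence this survives prescribing the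
  counts of the other sets. It is the Mecke equation for the event \<open>V k\<close> and the set \<open>C J\<close>.
\<close>

lemma poisson_shift:
  assumes Q: "finite Q" "disjoint_family_on C Q"
      "\<And>J. J \<in> Q \<Longrightarrow> C J \<in> sets M \<and> emeasure M (C J) < \<infinity>"
    and J: "J \<in> (Q :: 'e set set set)"
  defines "V \<equiv> \<lambda>k. {\<eta> \<in> config_set M. \<forall>J\<in>Q. emeasure \<eta> (C J) = of_nat (k J)}"
  shows "of_nat (k J) * emeasure \<L> (V k) =
    (if k J = 0 then 0 else emeasure M (C J) * emeasure \<L> (V (k(J := k J - 1))))"
proof (cases "k J")
  case (Suc n)
  let ?p = "\<lambda>J m. exp (- measure M (C J)) * measure M (C J) ^ m / fact m"
  have V: "emeasure \<L> (V k) = ennreal (\<Prod>J\<in>Q. ?p J (k J))" for k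
    unfolding V_def using joint_law[OF Q] by (subst emeasure_eq_measure) simp
  have 1: "(\<Prod>J\<in>Q. ?p J (k J)) = ?p J (Suc n) * (\<Prod>I\<in>Q - {J}. ?p I (k I))"
    using Q(1) J Suc by (subst prod.remove[of _ J]) auto
  have 2: "(\<Prod>I\<in>Q. ?p I ((k(J := n)) I)) = ?p J n * (\<Prod>I\<in>Q - {J}. ?p I (k I))"
    using Q(1) J by (subst prod.remove[of _ J]) auto
  have Suc_p: "real (Suc n) * ?p J (Suc n) = measure M (C J) * ?p J n"
    by (simp add: field_simps del: of_nat_Suc)
  have "of_nat (k J) * emeasure \<L> (V k) = ennreal (real (Suc n) * (\<Prod>J\<in>Q. ?p J (k J)))"
    unfolding V Suc by (simp add: ennreal_of_nat_eq_real_of_nat ennreal_mult' del: of_nat_Suc)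
  also have "real (Suc n) * (\<Prod>J\<in>Q. ?p J (k J)) = measure M (C J) * (\<Prod>I\<in>Q. ?p I ((k(J := n)) I))"
    unfolding 1 2 mult.assoc[symmetric] Suc_p ..
  also have "ennreal \<dots> = ennreal (measure M (C J)) * emeasure \<L> (V (k(J := n)))"
    unfolding V by (rule ennreal_mult') simp
  also have "ennreal (measure M (C J)) = emeasure M (C J)"
    using Q(3)[OF J] by (intro emeasure_eq_ennreal_measure[symmetric]) auto
  finally show ?thesis using Suc by (simp add: fun_upd_def)
qed simp

text \<open>
  Both measures are determined by their values on count events. The sets in a count event, and the
  set \<open>A\<close>, are unions of finitely many disjoint atoms, so such an event is, up to null sets, a
  countable disjoint union of events prescribing the number of points in each atom. For those,
  \<open>poisson_shift\<close> applies to each atom contained in \<open>A\<close>.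
\<close>

lemma count_weighted_eq_point_added:
  assumes A: "A \<in> sets M" "emeasure M A < \<infinity>"
  shows "count_weighted A = point_added A"
proof -
  have eq: "emeasure (count_weighted A) U = emeasure (point_added A) U" if U: "U \<in> count_events M" for U
  proof -
    obtain S where S: "finite S" "\<And>B k. (B, k) \<in> S \<Longrightarrow> B \<in> sets M \<and> emeasure M B < \<infinity>"
      and U_eq: "U = {\<eta> \<in> config_set M. \<forall>(B, k)\<in>S. emeasure \<eta> B = of_nat k}"
      using U unfolding count_events_def by blast
    \<comment> \<open>the atoms of the family formed by \<open>A\<close> and the sets in \<open>S\<close>, indexed by the members that contain them;
      the empty index is left out, since the points outside of all members may form a set of infinite measure\<close>
    define \<F> where "\<F> = insert A (fst ` S)"
    define Q where "Q = Pow \<F> - {{}}"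
    define C where "C J = {x \<in> space M. \<forall>B\<in>\<F>. x \<in> B \<longleftrightarrow> B \<in> J}" for J
    have fin: "finite \<F>" "finite Q" using S(1) by (auto simp: \<F>_def Q_def)
    have \<F>: "B \<in> sets M \<and> emeasure M B < \<infinity>" if "B \<in> \<F>" for B
      using that A S(2) unfolding \<F>_def by (auto simp: image_iff) 
    have C_sets: "C J \<in> sets M" for J
      unfolding C_def
    proof (intro sets.sets_Collect_finite_All fin)
      fix B assume "B \<in> \<F>"
      then have [measurable]: "B \<in> sets M" using \<F> by blast
      show "{x \<in> space M. x \<in> B \<longleftrightarrow> B \<in> J} \<in> sets M" by measurable
    qed
    have disj: "disjoint_family_on C Q"
      unfolding disjoint_family_on_def C_def Q_def by blast
    have C_fin: "emeasure M (C J) < \<infinity>" if J: "J \<in> Q" for J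
    proof -
      obtain B where "B \<in> J" "B \<in> \<F>" using J unfolding Q_def by blast
      then have "emeasure M (C J) \<le> emeasure M B"
        using \<F> by (intro emeasure_mono) (auto simp: C_def)
      then show ?thesis using \<F>[OF \<open>B \<in> \<F>\<close>] by (auto elim: le_less_trans)
    qed
    have decomp: "B = (\<Union>J\<in>{J\<in>Q. B \<in> J}. C J)" if "B \<in> \<F>" for B
    proof
      show "B \<subseteq> (\<Union>J\<in>{J\<in>Q. B \<in> J}. C J)"
      proof
        fix x assume "x \<in> B"
        then have "x \<in> C {B'\<in>\<F>. x \<in> B'}" "{B'\<in>\<F>. x \<in> B'} \<in> Q" "B \<in> {B'\<in>\<F>. x \<in> B'}"
          using \<F>[OF that] sets.sets_into_space that by (auto simp: C_def Q_def)
        then show "x \<in> (\<Union>J\<in>{J\<in>Q. B \<in> J}. C J)" by blast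
      qed
    qed (use that in \<open>auto simp: C_def\<close>)
    have sum_C: "emeasure \<eta> B = (\<Sum>J\<in>{J\<in>Q. B \<in> J}. emeasure \<eta> (C J))"
      if "B \<in> \<F>" "\<eta> \<in> config_set M" for B \<eta>
    proof -
      have "(\<Sum>J\<in>{J\<in>Q. B \<in> J}. emeasure \<eta> (C J)) = emeasure \<eta> (\<Union>J\<in>{J\<in>Q. B \<in> J}. C J)"
        using C_sets disj fin config_setD(1)[OF that(2)]
        by (intro sum_emeasure) (auto intro: disjoint_family_on_mono)
      then show ?thesis using decomp[OF that(1)] by simp
    qed
    define V where "V k = {\<eta> \<in> config_set M. \<forall>J\<in>Q. emeasure \<eta> (C J) = of_nat (k J)}" for k
    have V: "V k \<in> sets (config_space M)" for k
    proof -
      have "V k = {\<eta> \<in> config_set M. \<forall>(B, k)\<in>(\<lambda>J. (C J, k J)) ` Q. emeasure \<eta> B = of_nat k}"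
        by (auto simp: V_def)
      then show ?thesis using count_event_in_sets[of "(\<lambda>J. (C J, k J)) ` Q" M] C_sets fin by auto
    qed
    \<comment> \<open>the counts of the atoms for which the counts of the sets are as prescribed by \<open>S\<close>\<close>
    define K where "K = {k \<in> Pi\<^sub>E Q (\<lambda>_. UNIV). \<forall>(B, l)\<in>S. (\<Sum>J\<in>{J\<in>Q. B \<in> J}. k J) = l}"
    have K: "countable K"
      unfolding K_def using countable_PiE[OF fin(2), of "\<lambda>_. UNIV :: nat set"]
      by (rule countable_subset[rotated]) auto
    have V_disj: "disjoint_family_on V K"
    proof (unfold disjoint_family_on_def, intro ballI impI, rule ccontr)
      fix k l assume kl: "k \<in> K" "l \<in> K" "k \<noteq> l" "V k \<inter> V l \<noteq> {}"
      then have "k J = l J" if "J \<in> Q" for J using that by (fastforce simp: V_def)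
      then have "k = l" using kl by (intro PiE_ext[of k Q _ l]) (auto simp: K_def)
      then show False using kl by simp
    qed
    have split: "emeasure \<nu> U = (\<integral>\<^sup>+ k. emeasure \<nu> (V k) \<partial>count_space K)"
      if \<nu>: "sets \<nu> = sets (config_space M)" and AE: "AE \<eta> in \<nu>. \<forall>J\<in>Q. emeasure \<eta> (C J) < \<infinity>" for \<nu>
    proof -
      have "AE \<eta> in \<nu>. \<eta> \<in> U \<longleftrightarrow> \<eta> \<in> (\<Union>k\<in>K. V k)"
        using AE AE_space[of \<nu>]
      proof eventually_elim
        fix \<eta> assume *: "\<forall>J\<in>Q. emeasure \<eta> (C J) < \<infinity>" "\<eta> \<in> space \<nu>"
        then have \<eta>: "\<eta> \<in> config_set M" using sets_eq_imp_space_eq[OF \<nu>] by simp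
        have "\<exists>n::nat. emeasure \<eta> (C J) = of_nat n" if "J \<in> Q" for J
          using config_set_emeasure_cases[OF \<eta> C_sets[of J]] *(1) that by (metis infinity_ennreal_def less_irrefl)
        then obtain n where n: "\<And>J. J \<in> Q \<Longrightarrow> emeasure \<eta> (C J) = of_nat (n J)" by metis
        have count: "emeasure \<eta> B = of_nat (\<Sum>J\<in>{J\<in>Q. B \<in> J}. n J)" if "(B, l) \<in> S" for B l
          using sum_C[OF _ \<eta>, of B] that n by (force simp: \<F>_def)
        show "\<eta> \<in> U \<longleftrightarrow> \<eta> \<in> (\<Union>k\<in>K. V k)"
        proof
          assume "\<eta> \<in> U"
          then have "(\<Sum>J\<in>{J\<in>Q. B \<in> J}. n J) = l" if "(B, l) \<in> S" for B l
          proof -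
            have "(of_nat (\<Sum>J\<in>{J\<in>Q. B \<in> J}. n J) :: ennreal) = of_nat l"
              using count[OF that] that \<open>\<eta> \<in> U\<close> by (auto simp: U_eq simp del: of_nat_sum)
            then show ?thesis by (simp only: of_nat_eq_iff)
          qed
          then have "restrict n Q \<in> K" by (auto simp: K_def)
          moreover have "\<eta> \<in> V (restrict n Q)" using n \<eta> by (auto simp: V_def)
          ultimately show "\<eta> \<in> (\<Union>k\<in>K. V k)" by blast
        next
          assume "\<eta> \<in> (\<Union>k\<in>K. V k)"
          then obtain k where k: "k \<in> K" "\<eta> \<in> V k" by blast
          then have "n J = k J" if "J \<in> Q" for J using n[OF that] that by (auto simp: V_def)
          then have "(\<Sum>J\<in>{J\<in>Q. B \<in> J}. n J) = l" if "(B, l) \<in> S" for B l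
            using k(1) that by (auto simp: K_def)
          then show "\<eta> \<in> U" using count \<eta> by (auto simp: U_eq)
        qed
      qed
      then have "emeasure \<nu> U = emeasure \<nu> (\<Union>k\<in>K. V k)"
        using V K count_event_in_sets[OF S(1)] S(2) U_eq
        by (intro emeasure_eq_AE) (auto simp: \<nu>)
      also have "\<dots> = (\<integral>\<^sup>+ k. emeasure \<nu> (V k) \<partial>count_space K)"
        using V K V_disj by (intro emeasure_UN_countable) (auto simp: \<nu>)
      finally show ?thesis .
    qed
    have AE_C: "AE \<eta> in \<L>. \<forall>J\<in>Q. emeasure \<eta> (C J) < \<infinity>"
      using fin C_sets C_fin by (intro AE_finite_allI AE_finite_count) auto
    have AE1: "AE \<eta> in count_weighted A. \<forall>J\<in>Q. emeasure \<eta> (C J) < \<infinity>"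
      unfolding count_weighted_def using AE_C A by (subst AE_density) auto
    have AE2: "AE \<eta> in point_added A. \<forall>J\<in>Q. emeasure \<eta> (C J) < \<infinity>"
    proof -
      have "AE z in \<L> \<Otimes>\<^sub>M M. \<forall>J\<in>Q. emeasure (add_dirac (fst z) (snd z)) (C J) < \<infinity>"
      proof -
        have [measurable]: "C J \<in> sets M" for J by (rule C_sets)
        have "AE \<eta> in \<L>. AE x in M. \<forall>J\<in>Q. emeasure (add_dirac \<eta> x) (C J) < \<infinity>"
          using AE_C AE_space[of \<L>]
          by eventually_elim
            (auto simp: emeasure_add_dirac C_sets config_setD(1) less_top[symmetric] split: split_indicator)
        then show ?thesis
          using fin by (intro LM.AE_pair_measure) (auto intro!: sets.sets_Collect_finite_All)
      qed
      then have "AE z in density (\<L> \<Otimes>\<^sub>M M) (\<lambda>z. indicator A (snd z)).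
          \<forall>J\<in>Q. emeasure (add_dirac (fst z) (snd z)) (C J) < \<infinity>"
        using A by (subst AE_density) auto
      moreover have "{\<eta> \<in> config_set M. \<forall>J\<in>Q. emeasure \<eta> (C J) < \<infinity>} \<in> sets (config_space M)"
      proof -
        have [measurable]: "C J \<in> sets M" for J by (rule C_sets)
        have "{\<eta> \<in> space (config_space M). \<forall>J\<in>Q. emeasure \<eta> (C J) < \<infinity>} \<in> sets (config_space M)"
        proof (intro sets.sets_Collect_finite_All fin)
          show "{\<eta> \<in> space (config_space M). emeasure \<eta> (C J) < \<infinity>} \<in> sets (config_space M)" for J
            by measurable
        qed
        then show ?thesis by simp
      qed
      ultimately show ?thesis
        unfolding point_added_def by (subst AE_distr_iff) auto
    qed
    \<comment> \<open>a point added in the atom \<open>C J\<close> accounts for one of the \<open>k J\<close> points required there\<close>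
    have V_add: "indicator (C J) x * indicator (V k) (add_dirac \<eta> x) =
        (if k J = 0 then 0 else indicator (C J) x * indicator (V (k(J := k J - 1))) \<eta> :: ennreal)"
      if J: "J \<in> Q" and \<eta>: "\<eta> \<in> config_set M" for J x \<eta> k
    proof (cases "x \<in> C J")
      case True
      then have x: "x \<in> C I \<longleftrightarrow> I = J" if "I \<in> Q" for I
        using disj J that by (auto simp: disjoint_family_on_def)
      have "add_dirac \<eta> x \<in> V k \<longleftrightarrow>
          (\<forall>I\<in>Q. emeasure \<eta> (C I) + (if I = J then 1 else 0) = of_nat (k I))"
        using \<eta> C_sets config_setD(1)[OF \<eta>] x
        by (auto simp: V_def emeasure_add_dirac indicator_def)
      also have "\<dots> \<longleftrightarrow> k J \<noteq> 0 \<and> \<eta> \<in> V (k(J := k J - 1))"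
      proof (cases "k J")
        case 0
        then show ?thesis using J by (auto intro!: bexI[of _ J])
      next
        case (Suc n)
        have "a + 1 = of_nat (Suc n) \<longleftrightarrow> a = of_nat n" for a :: ennreal
          by (simp add: add.commute[of a] ennreal_add_left_cancel)
        then show ?thesis using \<eta> Suc by (auto simp: V_def)
      qed
      finally show ?thesis using True by (auto simp: indicator_def)
    qed simp
    have "emeasure (count_weighted A) (V k) = emeasure (point_added A) (V k)" for k
    proof -
      let ?QA = "{J\<in>Q. A \<in> J}"
      have AF: "A \<in> \<F>" by (simp add: \<F>_def)
      have "emeasure (count_weighted A) (V k) = (\<integral>\<^sup>+ \<eta>. of_nat (\<Sum>J\<in>?QA. k J) * indicator (V k) \<eta> \<partial>\<L>)"
        using A V unfolding emeasure_count_weighted[OF A(1) V]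
        by (intro nn_integral_cong) (auto simp: sum_C[OF AF] V_def split: split_indicator)
      also have "\<dots> = of_nat (\<Sum>J\<in>?QA. k J) * emeasure \<L> (V k)"
        using V by (subst nn_integral_cmult_indicator) (auto simp: sets_law)
      also have "\<dots> = (\<Sum>J\<in>?QA. of_nat (k J) * emeasure \<L> (V k))"
        by (simp add: sum_distrib_right)
      also have "\<dots> = (\<Sum>J\<in>?QA. if k J = 0 then 0 else emeasure M (C J) * emeasure \<L> (V (k(J := k J - 1))))"
        unfolding V_def using fin disj C_sets C_fin by (intro sum.cong refl poisson_shift) auto
      also have "\<dots> = (\<Sum>J\<in>?QA. \<integral>\<^sup>+ \<eta>. \<integral>\<^sup>+ x. indicator (C J) x * indicator (V k) (add_dirac \<eta> x) \<partial>M \<partial>\<L>)"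
      proof (intro sum.cong refl)
        fix J assume J: "J \<in> ?QA"
        have [measurable]: "C J \<in> sets M" "V k \<in> sets \<L>" for J k by (auto simp: C_sets V sets_law)
        have "(\<integral>\<^sup>+ \<eta>. \<integral>\<^sup>+ x. indicator (C J) x * indicator (V k) (add_dirac \<eta> x) \<partial>M \<partial>\<L>) =
          (\<integral>\<^sup>+ \<eta>. (if k J = 0 then 0 else emeasure M (C J) * indicator (V (k(J := k J - 1))) \<eta>) \<partial>\<L>)"
          using J by (intro nn_integral_cong) (simp add: V_add nn_integral_multc)
        also have "\<dots> = (if k J = 0 then 0 else emeasure M (C J) * emeasure \<L> (V (k(J := k J - 1))))"
          by (simp add: nn_integral_cmult_indicator)
        finally show "(if k J = 0 then 0 else emeasure M (C J) * emeasure \<L> (V (k(J := k J - 1)))) =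
          (\<integral>\<^sup>+ \<eta>. \<integral>\<^sup>+ x. indicator (C J) x * indicator (V k) (add_dirac \<eta> x) \<partial>M \<partial>\<L>)" ..
      qed
      also have "\<dots> = (\<integral>\<^sup>+ \<eta>. \<integral>\<^sup>+ x. (\<Sum>J\<in>?QA. indicator (C J) x) * indicator (V k) (add_dirac \<eta> x) \<partial>M \<partial>\<L>)"
      proof -
        have [measurable]: "C J \<in> sets M" "V k \<in> sets (config_space M)" for J k by (auto simp: C_sets V)
        have inner: "(\<integral>\<^sup>+ x. (\<Sum>J\<in>?QA. indicator (C J) x) * indicator (V k) (add_dirac \<eta> x) \<partial>M) =
            (\<Sum>J\<in>?QA. \<integral>\<^sup>+ x. indicator (C J) x * indicator (V k) (add_dirac \<eta> x) \<partial>M)"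
          if "\<eta> \<in> space \<L>" for \<eta>
        proof -
          have [measurable]: "(\<lambda>_. \<eta>) \<in> M \<rightarrow>\<^sub>M config_space M" using that by simp
          show ?thesis unfolding sum_distrib_right by (rule nn_integral_sum) measurable
        qed
        show ?thesis
          by (simp only: inner cong: nn_integral_cong) (rule nn_integral_sum[symmetric], measurable)
      qed
      also have "\<dots> = emeasure (point_added A) (V k)"
        unfolding emeasure_point_added[OF A(1) V]
      proof (intro nn_integral_cong)
        fix \<eta> x
        have "(\<Sum>J\<in>?QA. indicator (C J) x) = (indicator (\<Union>J\<in>?QA. C J) x :: ennreal)"
          using fin disj by (intro indicator_UN_disjoint[symmetric]) (auto intro: disjoint_family_on_mono)
        then show "(\<Sum>J\<in>?QA. indicator (C J) x) * indicator (V k) (add_dirac \<eta> x) =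
            (indicator A x * indicator (V k) (add_dirac \<eta> x) :: ennreal)"
          using decomp[OF AF] by simp
      qed
      finally show ?thesis .
    qed
    then show ?thesis
      using split[OF _ AE1] split[OF _ AE2] by (simp add: count_weighted_def point_added_def sets_law)
  qed
  have top: "config_set M \<in> count_events M"
    by (auto simp: count_events_def intro!: exI[of _ "{}"])
  show ?thesis
  proof (rule measure_eqI_generator_eq[OF Int_stable_count_events, where A="\<lambda>_. config_set M" and \<Omega>="config_set M"])
    show "emeasure (count_weighted A) (config_set M) \<noteq> \<infinity>"
    proof -
      have "emeasure (point_added A) (space (config_space M)) =
          (\<integral>\<^sup>+ \<eta>. \<integral>\<^sup>+ x. indicator A x \<partial>M \<partial>\<L>)"
        unfolding emeasure_point_added[OF A(1) sets.top] by (intro nn_integral_cong) simp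
      then show ?thesis using eq[OF top] A by (simp add: emeasure_space_1[simplified])
    qed
  qed (use eq top sets_config_space_count_events M.sigma_finite_measure_axioms in
       \<open>auto simp: count_weighted_def point_added_def sets_law count_events_def\<close>)
qed

text \<open>
  Both sides are integrals of \<open>g\<close> with respect to measures on the product space, the Campbell measure
  restricted to \<open>A\<close> on the left. They agree on rectangles \<open>U \<times> B\<close>, where they reduce to
  \<open>count_weighted (A \<inter> B)\<close> and \<open>point_added (A \<inter> B)\<close> evaluated at \<open>U\<close>.
\<close>

theorem mecke:
  assumes g: "g \<in> borel_measurable (config_space M \<Otimes>\<^sub>M M)" and A: "A \<in> sets M" "emeasure M A < \<infinity>"
    and supp: "\<And>\<eta> x. \<eta> \<in> config_set M \<Longrightarrow> x \<in> space M \<Longrightarrow> g (\<eta>, x) \<noteq> 0 \<Longrightarrow> x \<in> A \<and> emeasure \<eta> A < \<infinity>"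
  shows "(\<integral>\<^sup>+ \<eta>. \<integral>\<^sup>+ x. g (\<eta>, x) \<partial>\<eta> \<partial>\<L>) = (\<integral>\<^sup>+ \<eta>. \<integral>\<^sup>+ x. g (add_dirac \<eta> x, x) \<partial>M \<partial>\<L>)"
proof (cases "space M = {}")
  case True
  have "(\<integral>\<^sup>+ x. g (\<eta>, x) \<partial>\<eta>) = 0" if "\<eta> \<in> config_set M" for \<eta>
    using True config_setD[OF that] by (simp add: nn_integral_empty)
  moreover have "(\<integral>\<^sup>+ x. g (add_dirac \<eta> x, x) \<partial>M) = 0" for \<eta>
    using True by (simp add: nn_integral_empty)
  ultimately show ?thesis by (simp cong: nn_integral_cong_simp)
next
  case False
  let ?CM = "config_space M \<Otimes>\<^sub>M M"
  note g [measurable] and A(1) [measurable]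
  define \<kappa> where "\<kappa> \<eta> = distr (normalized A \<eta>) ?CM (\<lambda>x. (\<eta>, x))" for \<eta>
  note measurable_normalized[OF A(1) False, measurable] measurable_distr2 [measurable]
  have \<kappa> [measurable]: "\<kappa> \<in> config_space M \<rightarrow>\<^sub>M subprob_algebra ?CM"
    unfolding \<kappa>_def by measurable
  have ne: "space \<L> \<noteq> {}" by (rule not_empty)
  \<comment> \<open>the Campbell measure: \<open>\<eta>\<close> is weighted by the number of its points in \<open>A\<close>, one of which is then chosen uniformly\<close>
  define L where "L = count_weighted A \<bind> \<kappa>"
  define R where "R = distr (density (\<L> \<Otimes>\<^sub>M M) (\<lambda>z. indicator A (snd z))) ?CM (\<lambda>z. (add_dirac (fst z) (snd z), snd z))"
  have sets_cw: "sets (count_weighted A) = sets (config_space M)"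
    by (simp add: count_weighted_def sets_law)
  have norm_config: "Pair \<eta> \<in> normalized A \<eta> \<rightarrow>\<^sub>M ?CM" if "\<eta> \<in> config_set M" for \<eta>
    using that config_setD[OF that] by (simp add: normalized_def cong: measurable_cong_sets)
  have L: "integral\<^sup>N L h = (\<integral>\<^sup>+ \<eta>. emeasure \<eta> A * (\<integral>\<^sup>+ x. h (\<eta>, x) \<partial>normalized A \<eta>) \<partial>\<L>)"
    if [measurable]: "h \<in> borel_measurable ?CM" for h
  proof -
    have "integral\<^sup>N L h = (\<integral>\<^sup>+ \<eta>. integral\<^sup>N (\<kappa> \<eta>) h \<partial>count_weighted A)"
      unfolding L_def
      by (rule nn_integral_bind[where B="?CM"]) (use \<kappa> in \<open>simp_all cong: measurable_cong_sets add: sets_cw\<close>)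
    also have "\<dots> = (\<integral>\<^sup>+ \<eta>. emeasure \<eta> A * integral\<^sup>N (\<kappa> \<eta>) h \<partial>\<L>)"
      unfolding count_weighted_def by (intro nn_integral_density) measurable
    also have "\<dots> = (\<integral>\<^sup>+ \<eta>. emeasure \<eta> A * (\<integral>\<^sup>+ x. h (\<eta>, x) \<partial>normalized A \<eta>) \<partial>\<L>)"
      using norm_config unfolding \<kappa>_def by (intro nn_integral_cong) (simp add: nn_integral_distr)
    finally show ?thesis .
  qed
  have R: "integral\<^sup>N R h = (\<integral>\<^sup>+ \<eta>. \<integral>\<^sup>+ x. indicator A x * h (add_dirac \<eta> x, x) \<partial>M \<partial>\<L>)"
    if [measurable]: "h \<in> borel_measurable ?CM" for h
    unfolding R_def
    by (simp add: nn_integral_distr nn_integral_density) (subst M.nn_integral_fst[symmetric]; simp)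
  have sets_L: "sets L = sets ?CM"
    unfolding L_def by (rule sets_bind) (use \<kappa> ne measurable_space[OF \<kappa>] in
      \<open>auto simp: count_weighted_def space_subprob_algebra\<close>)
  have sets_R: "sets R = sets ?CM" by (simp add: R_def)
  have rect: "emeasure L (U \<times> B) = emeasure R (U \<times> B)"
    if UB: "U \<in> sets (config_space M)" "B \<in> sets M" for U B
  proof -
    note UB [measurable]
    have "emeasure L (U \<times> B) = (\<integral>\<^sup>+ z. indicator (U \<times> B) z \<partial>L)"
      using UB by (simp add: sets_L)
    also have "\<dots> = (\<integral>\<^sup>+ \<eta>. emeasure \<eta> A * (\<integral>\<^sup>+ x. indicator U \<eta> * indicator B x \<partial>normalized A \<eta>) \<partial>\<L>)"
      using UB by (subst L) (auto simp: indicator_times)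
    also have "\<dots> = (\<integral>\<^sup>+ \<eta>. emeasure \<eta> (A \<inter> B) * indicator U \<eta> \<partial>\<L>)"
      using AE_finite_count[OF A] AE_space
    proof (intro nn_integral_cong_AE, eventually_elim)
      fix \<eta> assume *: "emeasure \<eta> A < \<infinity>" "\<eta> \<in> space \<L>"
      then have sets: "sets \<eta> = sets M" using config_setD(1) by auto
      then have B: "B \<in> sets (normalized A \<eta>)" using UB by (simp add: normalized_def)
      have "emeasure \<eta> A * emeasure (normalized A \<eta>) B = emeasure \<eta> (A \<inter> B)"
      proof (cases "emeasure \<eta> A = 0")
        case True
        then have "emeasure \<eta> (A \<inter> B) = 0"
          using emeasure_mono[of "A \<inter> B" A \<eta>] sets A by simp
        then show ?thesis using True by simp
      next
        case False
        have "emeasure \<eta> A = ennreal (measure \<eta> A)"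
          using *(1) by (intro emeasure_eq_ennreal_measure) simp
        moreover have "measure \<eta> A > 0"
          using *(1) False by (simp add: measure_def enn2real_positive_iff zero_less_iff_neq_zero)
        ultimately show ?thesis
          using sets A UB by (simp add: emeasure_normalized mult.assoc[symmetric] ennreal_mult'[symmetric])
      qed
      then show "emeasure \<eta> A * (\<integral>\<^sup>+ x. indicator U \<eta> * indicator B x \<partial>normalized A \<eta>) =
          emeasure \<eta> (A \<inter> B) * indicator U \<eta>"
        using B by (simp add: nn_integral_cmult_indicator mult.commute mult.left_commute split: split_indicator)
    qed
    also have "\<dots> = emeasure (count_weighted (A \<inter> B)) U"
      using A UB by (subst emeasure_count_weighted) auto
    also have "\<dots> = emeasure (point_added (A \<inter> B)) U"
    proof -
      have "emeasure M (A \<inter> B) \<le> emeasure M A" using A by (intro emeasure_mono) auto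
      then show ?thesis
        using A UB by (subst count_weighted_eq_point_added) (auto intro: le_less_trans)
    qed
    also have "\<dots> = (\<integral>\<^sup>+ z. indicator (U \<times> B) z \<partial>R)"
    proof -
      have AB: "A \<inter> B \<in> sets M" using A UB by auto
      have [measurable]: "U \<times> B \<in> sets ?CM" using UB by auto
      show ?thesis
        unfolding emeasure_point_added[OF AB UB(1)]
        by (subst R, measurable) (auto intro!: nn_integral_cong split: split_indicator)
    qed
    also have "\<dots> = emeasure R (U \<times> B)" using UB by (simp add: sets_R)
    finally show ?thesis .
  qed
  have "L = R"
  proof (rule measure_eqI_generator_eq[OF Int_stable_pair_measure_generator[of "config_space M" M],
        where A="\<lambda>_. config_set M \<times> space M" and \<Omega>="config_set M \<times> space M"])
    show "sets L = sigma_sets (config_set M \<times> space M) {a \<times> b |a b. a \<in> sets (config_space M) \<and> b \<in> sets M}"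
      "sets R = sigma_sets (config_set M \<times> space M) {a \<times> b |a b. a \<in> sets (config_space M) \<and> b \<in> sets M}"
      by (simp_all add: sets_L sets_R sets_pair_measure)
    show "emeasure L (config_set M \<times> space M) \<noteq> \<infinity>"
    proof -
      have "emeasure L (config_set M \<times> space M) = emeasure R (config_set M \<times> space M)"
        using rect[OF sets.top sets.top] by simp
      also have "\<dots> = (\<integral>\<^sup>+ z. 1 \<partial>R)"
        by (subst nn_integral_const) (simp add: R_def space_pair_measure)
      also have "\<dots> = emeasure M A"
        using A by (subst R) (auto simp: emeasure_space_1[simplified])
      finally show ?thesis using A by simp
    qed
    show "range (\<lambda>_. config_set M \<times> space M) \<subseteq> {a \<times> b |a b. a \<in> sets (config_space M) \<and> b \<in> sets M}"
      using sets.top[of "config_space M"] by auto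
  qed (use rect sets.sets_into_space[of _ "config_space M"] sets.sets_into_space[of _ M] in \<open>force+\<close>)
  have "(\<integral>\<^sup>+ \<eta>. \<integral>\<^sup>+ x. g (\<eta>, x) \<partial>\<eta> \<partial>\<L>) = integral\<^sup>N L g"
    unfolding L[OF g] using AE_finite_count[OF A] AE_space
  proof (intro nn_integral_cong_AE, eventually_elim)
    fix \<eta> assume *: "emeasure \<eta> A < \<infinity>" "\<eta> \<in> space \<L>"
    then have \<eta>: "\<eta> \<in> config_set M" by simp
    note [simp] = config_setD(1,2)[OF \<eta>]
    have "(\<lambda>x. g (\<eta>, x)) \<in> borel_measurable \<eta>"
      using measurable_Pair2[OF g, of \<eta>] \<eta> by (simp cong: measurable_cong_sets)
    then show "(\<integral>\<^sup>+ x. g (\<eta>, x) \<partial>\<eta>) = emeasure \<eta> A * (\<integral>\<^sup>+ x. g (\<eta>, x) \<partial>normalized A \<eta>)"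
      using nn_integral_normalized[of "\<lambda>x. g (\<eta>, x)" \<eta> A] supp[OF \<eta>] * A by simp
  qed
  also have "\<dots> = (\<integral>\<^sup>+ \<eta>. \<integral>\<^sup>+ x. indicator A x * g (add_dirac \<eta> x, x) \<partial>M \<partial>\<L>)"
    unfolding \<open>L = R\<close> by (rule R) (rule g)
  also have "\<dots> = (\<integral>\<^sup>+ \<eta>. \<integral>\<^sup>+ x. g (add_dirac \<eta> x, x) \<partial>M \<partial>\<L>)"
  proof (intro nn_integral_cong)
    fix \<eta> x assume "\<eta> \<in> space \<L>" "x \<in> space M"
    then show "indicator A x * g (add_dirac \<eta> x, x) = g (add_dirac \<eta> x, x)"
      using supp[of "add_dirac \<eta> x" x] by (cases "g (add_dirac \<eta> x, x) = 0") auto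
  qed
  finally show ?thesis .
qed

subsection \<open>Consequences of the Mecke equation\<close>

text \<open>
  With \<open>x\<close> confined to a set \<open>A\<close> of finite measure, the law of \<open>N + \<delta>\<^sub>x\<close> under \<open>\<P> \<otimes> \<mu>\<close> has the density
  \<open>\<eta>(A)\<close> with respect to the law of \<open>N\<close>, by the Mecke equation; so it has no new null sets. This makes
  the difference operators independent of the representatives.
\<close>

lemma AE_add_dirac:
  assumes Q: "AE \<eta> in \<L>. Q \<eta>"
  shows "AE z in \<L> \<Otimes>\<^sub>M M. Q (add_dirac (fst z) (snd z))"
proof -
  obtain U where U: "{\<eta> \<in> space \<L>. \<not> Q \<eta>} \<subseteq> U" "emeasure \<L> U = 0" "U \<in> sets \<L>"
    using Q by (rule AE_E)
  have U' [measurable]: "U \<in> sets (config_space M)" using U(3) by (simp add: sets_law)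
  obtain A :: "nat \<Rightarrow> _" where A: "range A \<subseteq> sets M" "(\<Union>i. A i) = space M" "\<And>i. emeasure M (A i) \<noteq> \<infinity>"
    using M.sigma_finite by metis
  have "AE z in \<L> \<Otimes>\<^sub>M M. snd z \<in> A n \<longrightarrow> add_dirac (fst z) (snd z) \<notin> U" for n
  proof -
    have An [measurable]: "A n \<in> sets M" using A by auto
    have "AE \<eta> in \<L>. \<eta> \<notin> U"
      using U by (intro AE_not_in) (simp add: null_sets_def)
    then have "AE \<eta> in \<L>. emeasure \<eta> (A n) * indicator U \<eta> = 0"
      by eventually_elim simp
    then have "emeasure (count_weighted (A n)) U = 0"
      unfolding emeasure_count_weighted[OF An U'] by (subst nn_integral_0_iff_AE) auto
    then have "emeasure (point_added (A n)) U = 0"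
      using count_weighted_eq_point_added[OF An] A by (simp add: less_top)
    then have "(\<integral>\<^sup>+ z. indicator (A n) (snd z) * indicator U (add_dirac (fst z) (snd z)) \<partial>(\<L> \<Otimes>\<^sub>M M)) = 0"
      unfolding emeasure_point_added[OF An U'] by (subst M.nn_integral_fst[symmetric]) simp_all
    then have "AE z in \<L> \<Otimes>\<^sub>M M. indicator (A n) (snd z) * indicator U (add_dirac (fst z) (snd z)) = (0 :: ennreal)"
      by (subst (asm) nn_integral_0_iff_AE) auto
    then show ?thesis by eventually_elim (auto split: split_indicator_asm)
  qed
  then have "AE z in \<L> \<Otimes>\<^sub>M M. \<forall>n. snd z \<in> A n \<longrightarrow> add_dirac (fst z) (snd z) \<notin> U"
    by (intro AE_all_countable[THEN iffD2] allI)
  with AE_space show ?thesis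
  proof eventually_elim
    fix z assume z: "z \<in> space (\<L> \<Otimes>\<^sub>M M)" "\<forall>n. snd z \<in> A n \<longrightarrow> add_dirac (fst z) (snd z) \<notin> U"
    then have "snd z \<in> (\<Union>i. A i)" using A(2) by (auto simp: space_pair_measure)
    then have "add_dirac (fst z) (snd z) \<notin> U" using z(2) by auto
    moreover have "add_dirac (fst z) (snd z) \<in> space \<L>" using z(1) by (auto simp: space_pair_measure)
    ultimately show "Q (add_dirac (fst z) (snd z))" using U(1) by blast
  qed
qed

text \<open>
  The Mecke equation with \<open>g(\<eta>, x) = \<eta>(A) 1\<^sub>A(x)\<close> bounds the second moment of \<open>N(A)\<close> by
  \<open>(\<mu>(A) + 1) \<mu>(A)\<close>.
\<close>

lemma square_integrable_count:
  assumes A: "A \<in> sets M" "emeasure M A < \<infinity>"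
  shows "square_integrable \<L> (\<lambda>\<eta>. measure \<eta> A)"
proof -
  note A(1) [measurable]
  let ?g = "\<lambda>(\<eta>, x). if emeasure \<eta> A < \<infinity> then emeasure \<eta> A * indicator A x else 0"
  have "(\<integral>\<^sup>+ \<eta>. ennreal ((norm (measure \<eta> A))\<^sup>2) \<partial>\<L>) = (\<integral>\<^sup>+ \<eta>. \<integral>\<^sup>+ x. ?g (\<eta>, x) \<partial>\<eta> \<partial>\<L>)"
    using AE_finite_count[OF A] AE_space
  proof (intro nn_integral_cong_AE, eventually_elim)
    fix \<eta> assume *: "emeasure \<eta> A < \<infinity>" "\<eta> \<in> space \<L>"
    then have "A \<in> sets \<eta>" using config_setD(1)[of \<eta> M] A by simp
    then have "(\<integral>\<^sup>+ x. ?g (\<eta>, x) \<partial>\<eta>) = emeasure \<eta> A * emeasure \<eta> A"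
      using * by (simp add: nn_integral_cmult_indicator)
    also have "emeasure \<eta> A = ennreal (measure \<eta> A)"
      using * by (intro emeasure_eq_ennreal_measure) auto
    finally show "ennreal ((norm (measure \<eta> A))\<^sup>2) = (\<integral>\<^sup>+ x. ?g (\<eta>, x) \<partial>\<eta>)"
      by (simp add: power2_eq_square ennreal_mult)
  qed
  also have "\<dots> = (\<integral>\<^sup>+ \<eta>. \<integral>\<^sup>+ x. ?g (add_dirac \<eta> x, x) \<partial>M \<partial>\<L>)"
    by (rule mecke[OF _ A]) (auto split: if_splits split_indicator_asm)
  also have "\<dots> \<le> (\<integral>\<^sup>+ \<eta>. (emeasure \<eta> A + 1) * emeasure M A \<partial>\<L>)"
  proof (intro nn_integral_mono)
    fix \<eta> assume "\<eta> \<in> space \<L>"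
    then have "A \<in> sets \<eta>" using config_setD(1)[of \<eta> M] A by simp
    then have "(\<integral>\<^sup>+ x. ?g (add_dirac \<eta> x, x) \<partial>M) \<le> (\<integral>\<^sup>+ x. (emeasure \<eta> A + 1) * indicator A x \<partial>M)"
      by (intro nn_integral_mono) (auto simp: emeasure_add_dirac split: split_indicator)
    then show "(\<integral>\<^sup>+ x. ?g (add_dirac \<eta> x, x) \<partial>M) \<le> (emeasure \<eta> A + 1) * emeasure M A"
      by (simp add: nn_integral_cmult_indicator)
  qed
  also have "\<dots> = (\<integral>\<^sup>+ \<eta>. emeasure \<eta> A + 1 \<partial>\<L>) * emeasure M A"
    by (rule nn_integral_multc) measurable
  also have "(\<integral>\<^sup>+ \<eta>. emeasure \<eta> A + 1 \<partial>\<L>) = emeasure M A + 1"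
  proof -
    have "(\<integral>\<^sup>+ \<eta>. emeasure \<eta> A \<partial>\<L>) = (\<integral>\<^sup>+ \<eta>. emeasure \<eta> A * indicator (space (config_space M)) \<eta> \<partial>\<L>)"
      by (intro nn_integral_cong) simp
    also have "\<dots> = emeasure (point_added A) (space (config_space M))"
      using emeasure_count_weighted[OF A(1) sets.top] count_weighted_eq_point_added[OF A] by simp
    also have "\<dots> = (\<integral>\<^sup>+ \<eta>. \<integral>\<^sup>+ x. indicator A x \<partial>M \<partial>\<L>)"
      unfolding emeasure_point_added[OF A(1) sets.top] by (intro nn_integral_cong) simp
    also have "\<dots> = emeasure M A" by (simp add: emeasure_space_1[simplified])
    finally show ?thesis by (simp add: nn_integral_add emeasure_space_1[simplified])
  qed
  also have "(emeasure M A + 1) * emeasure M A < \<infinity>"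
    using A by (simp add: ennreal_mult_less_top)
  finally show ?thesis
    by (subst square_integrable_iff_nn) (auto simp: measure_def)
qed

lemma mecke_integral:
  fixes h :: "'e measure \<times> 'e \<Rightarrow> real"
  assumes h [measurable]: "h \<in> borel_measurable (config_space M \<Otimes>\<^sub>M M)" and A: "A \<in> sets M" "emeasure M A < \<infinity>"
    and supp: "\<And>\<eta> x. \<eta> \<in> config_set M \<Longrightarrow> x \<in> space M \<Longrightarrow> h (\<eta>, x) \<noteq> 0 \<Longrightarrow> x \<in> A \<and> emeasure \<eta> A < \<infinity>"
    and fin: "(\<integral>\<^sup>+ \<eta>. \<integral>\<^sup>+ x. ennreal \<bar>h (\<eta>, x)\<bar> \<partial>\<eta> \<partial>\<L>) < \<infinity>"
  shows "integrable (\<L> \<Otimes>\<^sub>M M) (\<lambda>z. h (add_dirac (fst z) (snd z), snd z))"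
    and "integrable \<L> (\<lambda>\<eta>. LINT x|\<eta>. h (\<eta>, x))"
    and "(LINT \<eta>|\<L>. LINT x|\<eta>. h (\<eta>, x)) = (LINT z|(\<L> \<Otimes>\<^sub>M M). h (add_dirac (fst z) (snd z), snd z))"
proof -
  let ?h' = "\<lambda>z. h (add_dirac (fst z) (snd z), snd z)"
  have mecke': "(\<integral>\<^sup>+ \<eta>. \<integral>\<^sup>+ x. f (h (\<eta>, x)) \<partial>\<eta> \<partial>\<L>) = (\<integral>\<^sup>+ z. f (?h' z) \<partial>(\<L> \<Otimes>\<^sub>M M))"
    and meas: "(\<lambda>\<eta>. \<integral>\<^sup>+ x. f (h (\<eta>, x)) \<partial>\<eta>) \<in> borel_measurable \<L>"
    if f [measurable]: "f \<in> borel_measurable borel" "f 0 = 0" for f :: "real \<Rightarrow> ennreal"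
  proof -
    have supp': "x \<in> A \<and> emeasure \<eta> A < \<infinity>" if "\<eta> \<in> config_set M" "x \<in> space M" "f (h (\<eta>, x)) \<noteq> 0" for \<eta> x
      using supp[OF that(1,2)] that(3) f(2) by (cases "h (\<eta>, x) = 0") auto
    have "(\<integral>\<^sup>+ \<eta>. \<integral>\<^sup>+ x. f (h (\<eta>, x)) \<partial>\<eta> \<partial>\<L>) = (\<integral>\<^sup>+ \<eta>. \<integral>\<^sup>+ x. f (h (add_dirac \<eta> x, x)) \<partial>M \<partial>\<L>)"
      by (rule mecke[where g="\<lambda>z. f (h z)", OF _ A supp']) auto
    also have "\<dots> = (\<integral>\<^sup>+ z. f (?h' z) \<partial>(\<L> \<Otimes>\<^sub>M M))"
      by (subst M.nn_integral_fst[symmetric]) simp_all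
    finally show "(\<integral>\<^sup>+ \<eta>. \<integral>\<^sup>+ x. f (h (\<eta>, x)) \<partial>\<eta> \<partial>\<L>) = (\<integral>\<^sup>+ z. f (?h' z) \<partial>(\<L> \<Otimes>\<^sub>M M))" .
    show "(\<lambda>\<eta>. \<integral>\<^sup>+ x. f (h (\<eta>, x)) \<partial>\<eta>) \<in> borel_measurable \<L>"
      unfolding measurable_law_iff
      by (rule measurable_nn_integral_config[where g="\<lambda>z. f (h z)", OF _ A(1) supp']) auto
  qed
  \<comment> \<open>\<open>F 1\<close> and \<open>F (-1)\<close> are the integrals of the positive and of the negative part\<close>
  define F where "F s \<eta> = (\<integral>\<^sup>+ x. ennreal (s * h (\<eta>, x)) \<partial>\<eta>)" for s \<eta>
  have F_eq: "(\<integral>\<^sup>+ \<eta>. F s \<eta> \<partial>\<L>) = (\<integral>\<^sup>+ z. ennreal (s * ?h' z) \<partial>(\<L> \<Otimes>\<^sub>M M))"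
    and F_meas [measurable]: "F s \<in> borel_measurable \<L>" for s
    unfolding F_def using mecke'[of "\<lambda>r. ennreal (s * r)"] meas[of "\<lambda>r. ennreal (s * r)"] by auto
  have int': "integrable (\<L> \<Otimes>\<^sub>M M) ?h'"
    using fin mecke'[of "\<lambda>r. ennreal \<bar>r\<bar>"] by (simp add: integrable_iff_bounded)
  then show "integrable (\<L> \<Otimes>\<^sub>M M) ?h'" .
  have F_fin: "(\<integral>\<^sup>+ \<eta>. F s \<eta> \<partial>\<L>) < \<infinity>" if "\<bar>s\<bar> = 1" for s
  proof -
    have "(\<integral>\<^sup>+ \<eta>. F s \<eta> \<partial>\<L>) \<le> (\<integral>\<^sup>+ \<eta>. \<integral>\<^sup>+ x. ennreal \<bar>h (\<eta>, x)\<bar> \<partial>\<eta> \<partial>\<L>)"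
    proof -
      have "s * r \<le> \<bar>r\<bar>" for r
        using that by (cases "s \<ge> 0") auto
      then show ?thesis unfolding F_def by (intro nn_integral_mono ennreal_leI)
    qed
    then show ?thesis using fin by (rule le_less_trans)
  qed
  have F_AE: "AE \<eta> in \<L>. F s \<eta> \<noteq> \<infinity>" if "\<bar>s\<bar> = 1" for s
    using F_fin[OF that] by (intro nn_integral_PInf_AE) auto
  have F_int: "integrable \<L> (\<lambda>\<eta>. enn2real (F s \<eta>))"
    and F_val: "(LINT \<eta>|\<L>. enn2real (F s \<eta>)) = enn2real (\<integral>\<^sup>+ \<eta>. F s \<eta> \<partial>\<L>)" if "\<bar>s\<bar> = 1" for s
  proof -
    have *: "(\<integral>\<^sup>+ \<eta>. ennreal (enn2real (F s \<eta>)) \<partial>\<L>) = (\<integral>\<^sup>+ \<eta>. F s \<eta> \<partial>\<L>)"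
      using F_AE[OF that] by (intro nn_integral_cong_AE) (auto simp: less_top)
    show "integrable \<L> (\<lambda>\<eta>. enn2real (F s \<eta>))"
      using F_fin[OF that] * by (simp add: integrable_iff_bounded)
    show "(LINT \<eta>|\<L>. enn2real (F s \<eta>)) = enn2real (\<integral>\<^sup>+ \<eta>. F s \<eta> \<partial>\<L>)"
      using * by (subst integral_eq_nn_integral) auto
  qed
  have AE_eq: "AE \<eta> in \<L>. (LINT x|\<eta>. h (\<eta>, x)) = enn2real (F 1 \<eta>) - enn2real (F (-1) \<eta>)"
    using F_AE[of 1, simplified] F_AE[of "-1", simplified] AE_space
  proof eventually_elim
    fix \<eta> assume *: "F 1 \<eta> \<noteq> top" "F (- 1) \<eta> \<noteq> top" "\<eta> \<in> space \<L>"
    then have \<eta>: "\<eta> \<in> config_set M" by simp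
    have "(\<lambda>x. h (\<eta>, x)) \<in> borel_measurable \<eta>"
      using measurable_Pair2[OF h, of \<eta>] \<eta> config_setD(1)[OF \<eta>] by (simp cong: measurable_cong_sets)
    then have "integrable \<eta> (\<lambda>x. h (\<eta>, x))"
      using * by (auto simp: real_integrable_def F_def)
    then show "(LINT x|\<eta>. h (\<eta>, x)) = enn2real (F 1 \<eta>) - enn2real (F (- 1) \<eta>)"
      by (simp add: real_lebesgue_integral_def F_def)
  qed
  have inner_meas: "(\<lambda>\<eta>. LINT x|\<eta>. h (\<eta>, x)) \<in> borel_measurable \<L>"
    unfolding measurable_law_iff by (rule measurable_integral_config[OF h A(1) supp])
  show "integrable \<L> (\<lambda>\<eta>. LINT x|\<eta>. h (\<eta>, x))"
  proof (rule integrable_cong_AE[THEN iffD2, OF inner_meas _ AE_eq])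
    show "integrable \<L> (\<lambda>\<eta>. enn2real (F 1 \<eta>) - enn2real (F (-1) \<eta>))"
      using F_int[of 1] F_int[of "-1"] by simp
  qed measurable
  have "(LINT \<eta>|\<L>. LINT x|\<eta>. h (\<eta>, x)) = (LINT \<eta>|\<L>. enn2real (F 1 \<eta>) - enn2real (F (-1) \<eta>))"
    using inner_meas AE_eq by (intro integral_cong_AE) auto
  also have "\<dots> = enn2real (\<integral>\<^sup>+ \<eta>. F 1 \<eta> \<partial>\<L>) - enn2real (\<integral>\<^sup>+ \<eta>. F (-1) \<eta> \<partial>\<L>)"
    using F_int[of 1] F_int[of "-1"] F_val[of 1] F_val[of "-1"] by simp
  also have "\<dots> = (LINT z|(\<L> \<Otimes>\<^sub>M M). ?h' z)"
    unfolding F_eq using int' by (simp add: real_lebesgue_integral_def)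
  finally show "(LINT \<eta>|\<L>. LINT x|\<eta>. h (\<eta>, x)) = (LINT z|(\<L> \<Otimes>\<^sub>M M). ?h' z)" .
qed

end

section \<open>Differences and compensated integrals\<close>

definition point_diff :: "('e measure \<Rightarrow> 'h::minus) \<Rightarrow> 'e measure \<times> 'e \<Rightarrow> 'h" where
  "point_diff f = (\<lambda>(\<eta>, x). f (add_dirac \<eta> x) - f \<eta>)"

definition process_diff :: "('e measure \<times> 'e \<Rightarrow> 'h::minus) \<Rightarrow> 'e measure \<times> 'e \<times> 'e \<Rightarrow> 'h" where
  "process_diff \<phi> = (\<lambda>(\<eta>, x, y). \<phi> (add_dirac \<eta> x, y) - \<phi> (\<eta>, y))"

definition swap_points :: "'w \<times> 'e \<times> 'e \<Rightarrow> 'w \<times> 'e \<times> 'e" where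
  "swap_points = (\<lambda>(\<eta>, x, y). (\<eta>, y, x))"

text \<open>
  A process is encoded by the function \<open>\<theta>\<close> from which it arises by adding the point first; thus
  \<open>\<theta>(\<eta>, x)\<close> is the value of the process \<open>shifted \<theta>\<close> at \<open>(\<eta> - \<delta>\<^sub>x, x)\<close> if \<open>x\<close> is an atom of \<open>\<eta>\<close>, and
  \<open>compensated M \<theta>\<close> is \<open>\<integral> \<phi>(\<eta> - \<delta>\<^sub>x, x) \<eta>(dx) - \<integral> \<phi>(\<eta>, x) \<mu>(dx)\<close> for \<open>\<phi> = shifted \<theta>\<close>.
\<close>

definition shifted :: "('e measure \<times> 'e \<Rightarrow> 'h) \<Rightarrow> 'e measure \<times> 'e \<Rightarrow> 'h" where
  "shifted \<theta> = (\<lambda>(\<eta>, x). \<theta> (add_dirac \<eta> x, x))"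

definition compensated ::
    "'e measure \<Rightarrow> ('e measure \<times> 'e \<Rightarrow> 'h::{banach,second_countable_topology}) \<Rightarrow> 'e measure \<Rightarrow> 'h" where
  "compensated M \<theta> \<eta> = (LINT x|\<eta>. \<theta> (\<eta>, x)) - (LINT x|M. shifted \<theta> (\<eta>, x))"

context poisson_law
begin

lemma measurable_point_diff:
  fixes f :: "_ \<Rightarrow> 'h::{real_normed_vector,second_countable_topology}"
  assumes [measurable]: "f \<in> borel_measurable (config_space M)"
  shows "point_diff f \<in> borel_measurable (\<L> \<Otimes>\<^sub>M M)"
  unfolding point_diff_def by measurable

lemma measurable_process_diff:
  fixes \<phi> :: "_ \<Rightarrow> 'h::{real_normed_vector,second_countable_topology}"
  assumes [measurable]: "\<phi> \<in> borel_measurable (config_space M \<Otimes>\<^sub>M M)"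
  shows "process_diff \<phi> \<in> borel_measurable (\<L> \<Otimes>\<^sub>M (M \<Otimes>\<^sub>M M))"
  unfolding process_diff_def by measurable

lemma measurable_swap_points [measurable]:
  "swap_points \<in> \<L> \<Otimes>\<^sub>M (M \<Otimes>\<^sub>M M) \<rightarrow>\<^sub>M \<L> \<Otimes>\<^sub>M (M \<Otimes>\<^sub>M M)"
  unfolding swap_points_def by measurable

lemma distr_swap_points:
  "distr (\<L> \<Otimes>\<^sub>M (M \<Otimes>\<^sub>M M)) (\<L> \<Otimes>\<^sub>M (M \<Otimes>\<^sub>M M)) swap_points = \<L> \<Otimes>\<^sub>M (M \<Otimes>\<^sub>M M)"
proof -
  have swap: "distr (M \<Otimes>\<^sub>M M) (M \<Otimes>\<^sub>M M) (\<lambda>(x, y). (y, x)) = M \<Otimes>\<^sub>M M"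
    using MM.distr_pair_swap by simp
  have "distr \<L> \<L> (\<lambda>\<eta>. \<eta>) \<Otimes>\<^sub>M distr (M \<Otimes>\<^sub>M M) (M \<Otimes>\<^sub>M M) (\<lambda>(x, y). (y, x)) =
      distr (\<L> \<Otimes>\<^sub>M (M \<Otimes>\<^sub>M M)) (\<L> \<Otimes>\<^sub>M (M \<Otimes>\<^sub>M M)) (\<lambda>(\<eta>, p). (\<eta>, (\<lambda>(x, y). (y, x)) p))"
    by (rule pair_measure_distr) (auto simp: swap MM.P.sigma_finite_measure_axioms)
  also have "(\<lambda>(\<eta>, p). (\<eta>, (\<lambda>(x, y). (y, x)) p)) = swap_points"
    by (auto simp: swap_points_def)
  finally show ?thesis by (simp add: swap distr_id)
qed

text \<open>
  The measure on triples is invariant under exchanging the two points, as a product with equal factors.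
\<close>

lemma square_integrable_swap:
  fixes u :: "_ \<Rightarrow> 'h::{real_inner,banach,second_countable_topology}"
  assumes u: "square_integrable (\<L> \<Otimes>\<^sub>M (M \<Otimes>\<^sub>M M)) u"
  shows "square_integrable (\<L> \<Otimes>\<^sub>M (M \<Otimes>\<^sub>M M)) (\<lambda>w. u (swap_points w))"
    "sqnorm (\<L> \<Otimes>\<^sub>M (M \<Otimes>\<^sub>M M)) (\<lambda>w. u (swap_points w)) = sqnorm (\<L> \<Otimes>\<^sub>M (M \<Otimes>\<^sub>M M)) u"
proof -
  let ?Q = "\<L> \<Otimes>\<^sub>M (M \<Otimes>\<^sub>M M)"
  have [measurable]: "u \<in> borel_measurable ?Q" using square_integrableD[OF u] by simp
  have "integrable (distr ?Q ?Q swap_points) (\<lambda>w. (norm (u w))\<^sup>2)"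
    using square_integrableD[OF u] by (simp add: distr_swap_points)
  then have "integrable ?Q (\<lambda>w. (norm (u (swap_points w)))\<^sup>2)"
    by (subst (asm) integrable_distr_eq) simp_all
  then show "square_integrable ?Q (\<lambda>w. u (swap_points w))"
    by (simp add: square_integrable_def)
  have "sqnorm ?Q u = (LINT w|distr ?Q ?Q swap_points. (norm (u w))\<^sup>2)"
    by (simp add: distr_swap_points sqnorm_def)
  also have "\<dots> = sqnorm ?Q (\<lambda>w. u (swap_points w))"
    unfolding sqnorm_def by (rule integral_distr) measurable
  finally show "sqnorm ?Q (\<lambda>w. u (swap_points w)) = sqnorm ?Q u" ..
qed

text \<open>
  Fubini's theorem on a triple product, with the middle variable integrated last.
\<close>

lemma Fubini_bounded_support:
  fixes G :: "'e measure \<times> 'e \<times> 'e \<Rightarrow> real"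
  assumes G [measurable]: "G \<in> borel_measurable (\<L> \<Otimes>\<^sub>M (M \<Otimes>\<^sub>M M))"
    and AB [measurable]: "A \<in> sets M" "B \<in> sets M" and fin: "emeasure M A < \<infinity>" "emeasure M B < \<infinity>"
    and bound: "\<And>\<eta> x y. \<eta> \<in> config_set M \<Longrightarrow> x \<in> space M \<Longrightarrow> y \<in> space M \<Longrightarrow> norm (G (\<eta>, x, y)) \<le> c"
    and supp: "\<And>\<eta> x y. \<eta> \<in> config_set M \<Longrightarrow> x \<in> space M \<Longrightarrow> y \<in> space M \<Longrightarrow> G (\<eta>, x, y) \<noteq> 0 \<Longrightarrow> x \<in> A \<and> y \<in> B"
  shows "(LINT x|M. LINT z|(\<L> \<Otimes>\<^sub>M M). G (fst z, x, snd z)) = (LINT w|(\<L> \<Otimes>\<^sub>M (M \<Otimes>\<^sub>M M)). G w)"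
proof -
  have int: "integrable (\<L> \<Otimes>\<^sub>M (M \<Otimes>\<^sub>M M)) G"
  proof (rule integrable_bounded_support[where S="space \<L> \<times> (A \<times> B)" and c=c])
    have "emeasure (\<L> \<Otimes>\<^sub>M (M \<Otimes>\<^sub>M M)) (space \<L> \<times> (A \<times> B)) = emeasure M A * emeasure M B"
      by (subst MM.P.emeasure_pair_measure_Times)
        (auto simp: M.emeasure_pair_measure_Times emeasure_space_1[simplified])
    then show "emeasure (\<L> \<Otimes>\<^sub>M (M \<Otimes>\<^sub>M M)) (space \<L> \<times> (A \<times> B)) < \<infinity>"
      using fin by (simp add: ennreal_mult_less_top)
  qed (use bound supp in \<open>auto simp: space_pair_measure\<close>)
  \<comment> \<open>integrating out \<open>y\<close> first reduces the exchange of \<open>x\<close> and \<open>\<eta>\<close> to functions of two variables\<close>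
  define J where "J z = (LINT y|M. G (fst z, snd z, y))" for z
  have J_meas [measurable]: "J \<in> borel_measurable (\<L> \<Otimes>\<^sub>M M)" unfolding J_def by measurable
  have int_y: "integrable M (\<lambda>y. G (\<eta>, x, y))" if "\<eta> \<in> config_set M" "x \<in> space M" for \<eta> x
    using fin(2) AB(2) bound[OF that] supp[OF that] that
    by (intro integrable_bounded_support[where S=B and c=c]) auto
  have int_J: "integrable (\<L> \<Otimes>\<^sub>M M) J"
  proof (rule integrable_bounded_support[where S="space \<L> \<times> A" and c="c * measure M B"])
    have "emeasure (\<L> \<Otimes>\<^sub>M M) (space \<L> \<times> A) = emeasure M A"
      by (subst M.emeasure_pair_measure_Times) (auto simp: emeasure_space_1[simplified])
    then show "emeasure (\<L> \<Otimes>\<^sub>M M) (space \<L> \<times> A) < \<infinity>" using fin by simp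
    fix z assume z: "z \<in> space (\<L> \<Otimes>\<^sub>M M)"
    then have z': "fst z \<in> config_set M" "snd z \<in> space M" by (auto simp: space_pair_measure)
    show "norm (J z) \<le> c * measure M B"
      unfolding J_def using int_y[OF z'] AB(2) fin(2) bound[OF z'] supp[OF z']
      by (intro norm_integral_bounded_support) auto
    assume "J z \<noteq> 0"
    moreover have "J z = 0" if "\<And>y. y \<in> space M \<Longrightarrow> G (fst z, snd z, y) = 0"
      unfolding J_def using that by (intro integral_eq_zero_AE AE_I2)
    ultimately have "\<exists>y\<in>space M. G (fst z, snd z, y) \<noteq> 0" by blast
    then show "z \<in> space \<L> \<times> A" using supp[OF z'] z' by (cases z) auto
  qed measurable
  have "(LINT w|(\<L> \<Otimes>\<^sub>M (M \<Otimes>\<^sub>M M)). G w) = (LINT \<eta>|\<L>. LINT p|(M \<Otimes>\<^sub>M M). G (\<eta>, p))"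
    by (rule LMM.integral_fst'[OF int, symmetric])
  also have "\<dots> = (LINT \<eta>|\<L>. LINT x|M. J (\<eta>, x))"
  proof (intro Bochner_Integration.integral_cong refl)
    fix \<eta> assume "\<eta> \<in> space \<L>"
    then have \<eta>: "\<eta> \<in> config_set M" by simp
    have "integrable (M \<Otimes>\<^sub>M M) (\<lambda>p. G (\<eta>, p))"
    proof (rule integrable_bounded_support[where S="A \<times> B" and c=c])
      show "(\<lambda>p. G (\<eta>, p)) \<in> borel_measurable (M \<Otimes>\<^sub>M M)"
        using measurable_Pair2[OF G, of \<eta>] \<eta> by simp
      show "emeasure (M \<Otimes>\<^sub>M M) (A \<times> B) < \<infinity>"
        using fin by (simp add: M.emeasure_pair_measure_Times ennreal_mult_less_top)
    qed (use bound[OF \<eta>] supp[OF \<eta>] in \<open>auto simp: space_pair_measure\<close>)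
    from MM.integral_fst'[OF this] show "(LINT p|(M \<Otimes>\<^sub>M M). G (\<eta>, p)) = (LINT x|M. J (\<eta>, x))"
      by (simp add: J_def)
  qed
  also have "\<dots> = (LINT x|M. LINT \<eta>|\<L>. J (\<eta>, x))"
    using LM.integral_fst'[OF int_J] LM.integral_snd[of "\<lambda>\<eta> x. J (\<eta>, x)"] int_J by simp
  also have "\<dots> = (LINT x|M. LINT z|(\<L> \<Otimes>\<^sub>M M). G (fst z, x, snd z))"
  proof (intro Bochner_Integration.integral_cong refl)
    fix x assume x: "x \<in> space M"
    have "integrable (\<L> \<Otimes>\<^sub>M M) (\<lambda>z. G (fst z, x, snd z))"
    proof (rule integrable_bounded_support[where S="space \<L> \<times> B" and c=c])
      show "(\<lambda>z. G (fst z, x, snd z)) \<in> borel_measurable (\<L> \<Otimes>\<^sub>M M)"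
        using x by measurable
      have "emeasure (\<L> \<Otimes>\<^sub>M M) (space \<L> \<times> B) = emeasure M B"
        by (subst M.emeasure_pair_measure_Times) (auto simp: emeasure_space_1[simplified])
      then show "emeasure (\<L> \<Otimes>\<^sub>M M) (space \<L> \<times> B) < \<infinity>" using fin by simp
    qed (use bound[OF _ x] supp[OF _ x] in \<open>auto simp: space_pair_measure\<close>)
    from LM.integral_fst'[OF this]
    show "(LINT \<eta>|\<L>. J (\<eta>, x)) = (LINT z|(\<L> \<Otimes>\<^sub>M M). G (fst z, x, snd z))"
      by (simp add: J_def)
  qed
  finally show ?thesis ..
qed

end

locale poisson_law_exhausted = poisson_law +
  fixes E :: "nat \<Rightarrow> 'a set"
  assumes E_sets [measurable]: "E n \<in> sets M"
    and E_finite: "emeasure M (E n) < \<infinity>"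
    and E_mono: "m \<le> n \<Longrightarrow> E m \<subseteq> E n"
    and E_cover: "(\<Union>n. E n) = space M"
begin

definition locally_finite :: "'a measure \<Rightarrow> bool" where
  "locally_finite \<eta> \<longleftrightarrow> (\<forall>n. emeasure \<eta> (E n) < \<infinity>)"

lemma AE_locally_finite: "AE \<eta> in \<L>. locally_finite \<eta>"
  unfolding locally_finite_def using AE_finite_count E_finite by (simp add: AE_all_countable)

lemma locally_finite_add_dirac [simp]:
  "\<eta> \<in> config_set M \<Longrightarrow> locally_finite (add_dirac \<eta> x) \<longleftrightarrow> locally_finite \<eta>"
  by (auto simp: locally_finite_def emeasure_add_dirac config_setD(1) less_top[symmetric] split: split_indicator)

lemma measurable_locally_finite [measurable]:
  "Measurable.pred (config_space M) locally_finite"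
  unfolding locally_finite_def by measurable

text \<open>
  These functions encode bounded processes that vanish outside of one of the sets \<open>E n\<close>. Excluding
  configurations that are not locally finite changes nothing almost surely but makes all pathwise
  integrals exist for every configuration; fixing the increasing sequence \<open>E\<close> in advance makes
  differences of admissible functions admissible.
\<close>

definition admissible ::
    "nat \<Rightarrow> real \<Rightarrow> ('a measure \<times> 'a \<Rightarrow> 'h::{real_inner,banach,second_countable_topology}) \<Rightarrow> bool" where
  "admissible n K \<theta> \<longleftrightarrow> 0 \<le> K \<and> \<theta> \<in> borel_measurable (config_space M \<Otimes>\<^sub>M M) \<and>
     (\<forall>\<eta>\<in>config_set M. \<forall>x\<in>space M. norm (\<theta> (\<eta>, x)) \<le> K \<and>
        (\<theta> (\<eta>, x) \<noteq> 0 \<longrightarrow> x \<in> E n \<and> locally_finite \<eta>))"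

lemma admissibleD:
  assumes "admissible n K \<theta>"
  shows "0 \<le> K" "\<theta> \<in> borel_measurable (config_space M \<Otimes>\<^sub>M M)"
    "\<And>\<eta> x. \<eta> \<in> config_set M \<Longrightarrow> x \<in> space M \<Longrightarrow> norm (\<theta> (\<eta>, x)) \<le> K"
    "\<And>\<eta> x. \<eta> \<in> config_set M \<Longrightarrow> x \<in> space M \<Longrightarrow> \<theta> (\<eta>, x) \<noteq> 0 \<Longrightarrow> x \<in> E n"
    "\<And>\<eta> x. \<eta> \<in> config_set M \<Longrightarrow> x \<in> space M \<Longrightarrow> \<theta> (\<eta>, x) \<noteq> 0 \<Longrightarrow> locally_finite \<eta>"
  using assms by (auto simp: admissible_def)

lemma measurable_shifted:
  assumes "\<theta> \<in> borel_measurable (config_space M \<Otimes>\<^sub>M M)"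
  shows "shifted \<theta> \<in> borel_measurable (config_space M \<Otimes>\<^sub>M M)"
  using assms unfolding shifted_def by measurable

lemma shiftedD:
  assumes \<theta>: "admissible n K \<theta>" and "\<eta> \<in> config_set M" "x \<in> space M"
  shows "norm (shifted \<theta> (\<eta>, x)) \<le> K" "shifted \<theta> (\<eta>, x) \<noteq> 0 \<Longrightarrow> x \<in> E n"
    "shifted \<theta> (\<eta>, x) \<noteq> 0 \<Longrightarrow> locally_finite \<eta>"
  using admissibleD(3-5)[OF \<theta>, of "add_dirac \<eta> x" x] assms by (auto simp: shifted_def)

lemma measurable_section:
  assumes "f \<in> borel_measurable (config_space M \<Otimes>\<^sub>M M)" "\<eta> \<in> config_set M"
  shows "(\<lambda>x. f (\<eta>, x)) \<in> borel_measurable M"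
  using measurable_Pair2[OF assms(1), of \<eta>] assms(2) by simp

text \<open>
  The configuration that the integrand depends on may differ from the one that is integrated against:
  the commutation relation involves the integral of \<open>\<theta> (\<eta> + \<delta>\<^sub>y, x)\<close> with respect to \<open>\<eta>(dx)\<close>.
\<close>

lemma integrable_config:
  assumes \<theta>: "admissible n K \<theta>" and \<eta>: "\<eta> \<in> config_set M" "\<eta>' \<in> config_set M"
    and fin: "locally_finite \<eta>' \<Longrightarrow> locally_finite \<eta>"
  shows "integrable \<eta> (\<lambda>x. \<theta> (\<eta>', x))"
proof (cases "locally_finite \<eta>'")
  case True
  note \<theta> = admissibleD[OF \<theta>]
  show ?thesis
  proof (rule integrable_bounded_support[where S="E n" and c=K])
    show "(\<lambda>x. \<theta> (\<eta>', x)) \<in> borel_measurable \<eta>"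
      using measurable_section[OF \<theta>(2) \<eta>(2)] config_setD(1)[OF \<eta>(1)] by (simp cong: measurable_cong_sets)
  qed (use \<theta> True fin \<eta> config_setD(1,2)[OF \<eta>(1)] in \<open>auto simp: locally_finite_def\<close>)
next
  case False
  then have "\<theta> (\<eta>', x) = 0" if "x \<in> space \<eta>" for x
    using admissibleD(5)[OF \<theta> \<eta>(2), of x] config_setD(2)[OF \<eta>(1)] that by auto
  then show ?thesis by (subst Bochner_Integration.integrable_cong[where g="\<lambda>_. 0"]) auto
qed

lemma integrable_shifted:
  assumes \<theta>: "admissible n K \<theta>" and \<eta>: "\<eta> \<in> config_set M"
  shows "integrable M (\<lambda>x. shifted \<theta> (\<eta>, x))"
  using shiftedD[OF \<theta> \<eta>] E_finite
    measurable_section[OF measurable_shifted[OF admissibleD(2)[OF \<theta>]] \<eta>]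
  by (intro integrable_bounded_support[where S="E n" and c=K]) auto

lemma measurable_compensated_integrals:
  assumes \<theta>: "admissible n K \<theta>"
  shows "(\<lambda>\<eta>. LINT x|\<eta>. \<theta> (\<eta>, x)) \<in> borel_measurable \<L>"
    "(\<lambda>\<eta>. LINT x|M. shifted \<theta> (\<eta>, x)) \<in> borel_measurable \<L>"
proof -
  show "(\<lambda>\<eta>. LINT x|\<eta>. \<theta> (\<eta>, x)) \<in> borel_measurable \<L>"
    unfolding measurable_law_iff
    using admissibleD[OF \<theta>] by (intro measurable_integral_config[where A="E n"]) (auto simp: locally_finite_def)
  have [measurable]: "shifted \<theta> \<in> borel_measurable (config_space M \<Otimes>\<^sub>M M)"
    using measurable_shifted[OF admissibleD(2)[OF \<theta>]] .
  show "(\<lambda>\<eta>. LINT x|M. shifted \<theta> (\<eta>, x)) \<in> borel_measurable \<L>" by measurable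
qed

lemma measurable_compensated:
  assumes "admissible n K \<theta>"
  shows "compensated M \<theta> \<in> borel_measurable \<L>"
  unfolding compensated_def[abs_def] using measurable_compensated_integrals[OF assms] by measurable

lemma norm_compensated_le:
  assumes \<theta>: "admissible n K \<theta>" and \<eta>: "\<eta> \<in> config_set M"
  shows "norm (compensated M \<theta> \<eta>) \<le> K * measure \<eta> (E n) + K * measure M (E n)"
proof -
  have "norm (LINT x|\<eta>. \<theta> (\<eta>, x)) \<le> K * measure \<eta> (E n)"
  proof (cases "locally_finite \<eta>")
    case True
    then show ?thesis using integrable_config[OF \<theta> \<eta> \<eta>] admissibleD[OF \<theta>] \<eta> config_setD(1,2)[OF \<eta>]
      by (intro norm_integral_bounded_support) (auto simp: locally_finite_def)
  next
    case False
    then have "\<theta> (\<eta>, x) = 0" if "x \<in> space \<eta>" for x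
      using admissibleD(5)[OF \<theta> \<eta>, of x] config_setD(2)[OF \<eta>] that by auto
    then have "(LINT x|\<eta>. \<theta> (\<eta>, x)) = 0" by (intro integral_eq_zero_AE AE_I2)
    then show ?thesis using admissibleD(1)[OF \<theta>] by simp
  qed
  moreover have "norm (LINT x|M. shifted \<theta> (\<eta>, x)) \<le> K * measure M (E n)"
    using integrable_shifted[OF \<theta> \<eta>] shiftedD[OF \<theta> \<eta>] E_finite
    by (intro norm_integral_bounded_support) auto
  ultimately show ?thesis
    unfolding compensated_def by (intro order_trans[OF norm_triangle_ineq4] add_mono)
qed

text \<open>
  The bound by a multiple of \<open>N(E n) + \<mu>(E n)\<close> is square integrable because \<open>N(E n)\<close> has a finite second
  moment.
\<close>

lemma square_integrable_compensated:
  assumes \<theta>: "admissible n K \<theta>"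
  shows "square_integrable \<L> (compensated M \<theta>)"
proof (rule square_integrable_bound)
  let ?b = "\<lambda>\<eta>. 2 * (K * measure \<eta> (E n))\<^sup>2 + 2 * (K * measure M (E n))\<^sup>2"
  have "integrable \<L> (\<lambda>\<eta>. (measure \<eta> (E n))\<^sup>2)"
    using square_integrableD(2)[OF square_integrable_count[OF E_sets E_finite]] by simp
  then show "integrable \<L> ?b" by (simp add: power_mult_distrib)
  show "AE \<eta> in \<L>. (norm (compensated M \<theta> \<eta>))\<^sup>2 \<le> ?b \<eta>"
  proof (rule AE_I2)
    fix \<eta> assume "\<eta> \<in> space \<L>"
    then have "(norm (compensated M \<theta> \<eta>))\<^sup>2 \<le> (K * measure \<eta> (E n) + K * measure M (E n))\<^sup>2"
      by (intro power_mono norm_compensated_le[OF \<theta>]) auto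
    also have "\<dots> \<le> ?b \<eta>"
      using norm_add_sq_le[of "K * measure \<eta> (E n)" "K * measure M (E n)"] by simp
    finally show "(norm (compensated M \<theta> \<eta>))\<^sup>2 \<le> ?b \<eta>" .
  qed
qed (rule measurable_compensated[OF \<theta>])

lemma square_integrable_shifted:
  fixes \<theta> :: "_ \<Rightarrow> 'h::{real_inner,banach,second_countable_topology}"
  assumes \<theta>: "admissible n K \<theta>"
  shows "square_integrable (\<L> \<Otimes>\<^sub>M M) (shifted \<theta>)"
  unfolding square_integrable_def
proof
  show meas: "shifted \<theta> \<in> borel_measurable (\<L> \<Otimes>\<^sub>M M)"
    unfolding measurable_law_pair_iff by (rule measurable_shifted[OF admissibleD(2)[OF \<theta>]])
  show "integrable (\<L> \<Otimes>\<^sub>M M) (\<lambda>z. (norm (shifted \<theta> z))\<^sup>2)"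
  proof (rule integrable_bounded_support[where S="space \<L> \<times> E n" and c="K\<^sup>2"])
    have "emeasure (\<L> \<Otimes>\<^sub>M M) (space \<L> \<times> E n) = emeasure M (E n)"
      by (subst M.emeasure_pair_measure_Times) (auto simp: emeasure_space_1[simplified])
    then show "emeasure (\<L> \<Otimes>\<^sub>M M) (space \<L> \<times> E n) < \<infinity>" using E_finite by simp
    fix z assume "z \<in> space (\<L> \<Otimes>\<^sub>M M)"
    then obtain \<eta> x where z: "z = (\<eta>, x)" "\<eta> \<in> config_set M" "x \<in> space M" by (auto simp: space_pair_measure)
    show "norm ((norm (shifted \<theta> z))\<^sup>2) \<le> K\<^sup>2"
      using shiftedD(1)[OF \<theta> z(2,3)] z(1) by (auto intro!: power_mono)
    show "(norm (shifted \<theta> z))\<^sup>2 \<noteq> 0 \<Longrightarrow> z \<in> space \<L> \<times> E n"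
      using shiftedD(2)[OF \<theta> z(2,3)] z by auto
  qed (use meas in measurable)
qed

lemma admissible_diff:
  assumes "admissible n K \<theta>" "admissible m L \<theta>'"
  shows "admissible (max n m) (K + L) (\<lambda>z. \<theta> z - \<theta>' z)"
  unfolding admissible_def
proof (intro conjI ballI)
  note 1 = admissibleD[OF assms(1)] and 2 = admissibleD[OF assms(2)]
  show "0 \<le> K + L" using 1(1) 2(1) by simp
  show "(\<lambda>z. \<theta> z - \<theta>' z) \<in> borel_measurable (config_space M \<Otimes>\<^sub>M M)" using 1(2) 2(2) by simp
  fix \<eta> x assume \<eta>: "\<eta> \<in> config_set M" "x \<in> space M"
  show "norm (\<theta> (\<eta>, x) - \<theta>' (\<eta>, x)) \<le> K + L"
    by (intro order_trans[OF norm_triangle_ineq4] add_mono 1(3)[OF \<eta>] 2(3)[OF \<eta>])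
  show "\<theta> (\<eta>, x) - \<theta>' (\<eta>, x) \<noteq> 0 \<longrightarrow> x \<in> E (max n m) \<and> locally_finite \<eta>"
    using 1(4,5)[OF \<eta>] 2(4,5)[OF \<eta>] E_mono[of n "max n m"] E_mono[of m "max n m"] by fastforce
qed

lemma compensated_diff:
  assumes "admissible n K \<theta>" "admissible m L \<theta>'" "\<eta> \<in> config_set M"
  shows "compensated M (\<lambda>z. \<theta> z - \<theta>' z) \<eta> = compensated M \<theta> \<eta> - compensated M \<theta>' \<eta>"
proof -
  have "shifted (\<lambda>z. \<theta> z - \<theta>' z) (\<eta>, x) = shifted \<theta> (\<eta>, x) - shifted \<theta>' (\<eta>, x)" for x
    by (simp add: shifted_def)
  then show ?thesis
    using integrable_config[OF assms(1,3,3)] integrable_config[OF assms(2,3,3)]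
      integrable_shifted[OF assms(1,3)] integrable_shifted[OF assms(2,3)]
    by (simp add: compensated_def)
qed

lemma admissible_diff_point:
  assumes \<theta>: "admissible n K \<theta>" and y: "y \<in> space M"
  shows "admissible n (2 * K) (\<lambda>(\<eta>, x). \<theta> (add_dirac \<eta> y, x) - \<theta> (\<eta>, x))"
  unfolding admissible_def
proof (intro conjI ballI)
  note \<theta> = admissibleD[OF \<theta>]
  show "0 \<le> 2 * K" using \<theta>(1) by simp
  note \<theta>(2) [measurable]
  show "(\<lambda>(\<eta>, x). \<theta> (add_dirac \<eta> y, x) - \<theta> (\<eta>, x)) \<in> borel_measurable (config_space M \<Otimes>\<^sub>M M)"
    using y by measurable
  fix \<eta> x assume \<eta>: "\<eta> \<in> config_set M" "x \<in> space M"
  then have \<eta>': "add_dirac \<eta> y \<in> config_set M" by simp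
  show "norm ((\<lambda>(\<eta>, x). \<theta> (add_dirac \<eta> y, x) - \<theta> (\<eta>, x)) (\<eta>, x)) \<le> 2 * K"
    using norm_triangle_ineq4[of "\<theta> (add_dirac \<eta> y, x)" "\<theta> (\<eta>, x)"] \<theta>(3)[OF \<eta>] \<theta>(3)[OF \<eta>' \<eta>(2)] by simp
  show "(\<lambda>(\<eta>, x). \<theta> (add_dirac \<eta> y, x) - \<theta> (\<eta>, x)) (\<eta>, x) \<noteq> 0 \<longrightarrow> x \<in> E n \<and> locally_finite \<eta>"
    using \<theta>(4,5)[OF \<eta>] \<theta>(4,5)[OF \<eta>' \<eta>(2)] \<eta> by (cases "\<theta> (\<eta>, x) = 0") auto
qed

text \<open>
  The commutation relation \<open>D\<^sub>y \<delta>(\<phi>) = \<phi>(y) + \<delta>(D\<^sub>y \<phi>)\<close> holds configuration by configuration: the added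
  point contributes the summand \<open>\<phi>(\<eta>, y)\<close> to the integral with respect to \<open>\<eta> + \<delta>\<^sub>y\<close>, and elsewhere it
  only changes the integrand.
\<close>

lemma compensated_add_dirac:
  assumes \<theta>: "admissible n K \<theta>" and \<eta>: "\<eta> \<in> config_set M" and y: "y \<in> space M"
  shows "compensated M \<theta> (add_dirac \<eta> y) - compensated M \<theta> \<eta> =
    shifted \<theta> (\<eta>, y) + compensated M (\<lambda>(\<eta>, x). \<theta> (add_dirac \<eta> y, x) - \<theta> (\<eta>, x)) \<eta>"
proof -
  have \<eta>': "add_dirac \<eta> y \<in> config_set M" using \<eta> by simp
  have int: "integrable \<eta> (\<lambda>x. \<theta> (add_dirac \<eta> y, x))"
    using \<eta> by (intro integrable_config[OF \<theta>]) auto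
  have "(LINT x|add_dirac \<eta> y. \<theta> (add_dirac \<eta> y, x)) =
      (LINT x|\<eta>. \<theta> (add_dirac \<eta> y, x)) + shifted \<theta> (\<eta>, y)"
    using int y config_setD(2)[OF \<eta>] by (simp add: integral_add_dirac shifted_def)
  moreover have "shifted (\<lambda>(\<eta>, x). \<theta> (add_dirac \<eta> y, x) - \<theta> (\<eta>, x)) (\<eta>, x) =
      shifted \<theta> (add_dirac \<eta> y, x) - shifted \<theta> (\<eta>, x)" for x
    by (simp add: shifted_def add_dirac_commute)
  ultimately show ?thesis
    using int integrable_config[OF \<theta> \<eta> \<eta>] integrable_shifted[OF \<theta> \<eta>] integrable_shifted[OF \<theta> \<eta>']
    by (simp add: compensated_def)
qed

subsection \<open>Duality and isometry\<close>

text \<open>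
  By the Mecke equation, \<open>\<^bold>E \<integral> \<langle>F, \<phi>(N - \<delta>\<^sub>x, x)\<rangle> N(dx) = \<^bold>E \<integral> \<langle>f(N + \<delta>\<^sub>x), \<phi>(N, x)\<rangle> \<mu>(dx)\<close>; subtracting
  \<open>\<^bold>E \<integral> \<langle>F, \<phi>(N, x)\<rangle> \<mu>(dx)\<close> on both sides gives the duality between \<open>D\<close> and the compensated integral.
\<close>

lemma duality_admissible:
  fixes \<theta> :: "_ \<Rightarrow> 'h::{real_inner,banach,second_countable_topology}"
  assumes \<theta>: "admissible n K \<theta>" and f: "square_integrable \<L> f"
  shows "integrable (\<L> \<Otimes>\<^sub>M M) (\<lambda>z. point_diff f z \<bullet> shifted \<theta> z)"
    and "(LINT z|(\<L> \<Otimes>\<^sub>M M). point_diff f z \<bullet> shifted \<theta> z) = (LINT \<eta>|\<L>. f \<eta> \<bullet> compensated M \<theta> \<eta>)"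
proof -
  note \<theta>D = admissibleD[OF \<theta>]
  have f_meas [measurable]: "f \<in> borel_measurable (config_space M)"
    using square_integrableD(1)[OF f] by (simp add: measurable_law_iff)
  note \<theta>D(2) [measurable] and measurable_shifted[OF \<theta>D(2), measurable]
  define h where "h z = f (fst z) \<bullet> \<theta> z" for z
  define h2 where "h2 z = f (fst z) \<bullet> shifted \<theta> z" for z
  have h_meas [measurable]: "h \<in> borel_measurable (config_space M \<Otimes>\<^sub>M M)" unfolding h_def by measurable
  have h2_meas [measurable]: "h2 \<in> borel_measurable (\<L> \<Otimes>\<^sub>M M)" unfolding h2_def by measurable
  have supp: "x \<in> E n \<and> emeasure \<eta> (E n) < \<infinity>"
    if "\<eta> \<in> config_set M" "x \<in> space M" "h (\<eta>, x) \<noteq> 0" for \<eta> x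
    using \<theta>D(4,5)[OF that(1,2)] that(3)
    by (cases "\<theta> (\<eta>, x) = 0") (auto simp: h_def locally_finite_def)
  have f_norm: "square_integrable \<L> (\<lambda>\<eta>. norm (f \<eta>))"
    using square_integrableD[OF f] by (simp add: square_integrable_def)
  have "(\<integral>\<^sup>+ \<eta>. \<integral>\<^sup>+ x. ennreal \<bar>h (\<eta>, x)\<bar> \<partial>\<eta> \<partial>\<L>) \<le> (\<integral>\<^sup>+ \<eta>. ennreal (K * (norm (f \<eta>) * measure \<eta> (E n))) \<partial>\<L>)"
  proof (intro nn_integral_mono)
    fix \<eta> assume "\<eta> \<in> space \<L>"
    then have \<eta>: "\<eta> \<in> config_set M" by simp
    note [simp] = config_setD(1,2)[OF \<eta>]
    show "(\<integral>\<^sup>+ x. ennreal \<bar>h (\<eta>, x)\<bar> \<partial>\<eta>) \<le> ennreal (K * (norm (f \<eta>) * measure \<eta> (E n)))"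
    proof (cases "emeasure \<eta> (E n) < \<infinity>")
      case True
      have "\<bar>h (\<eta>, x)\<bar> \<le> K * norm (f \<eta>) * indicator (E n) x" if "x \<in> space M" for x
      proof (cases "h (\<eta>, x) = 0")
        case False
        have "\<bar>h (\<eta>, x)\<bar> \<le> norm (f \<eta>) * norm (\<theta> (\<eta>, x))"
          unfolding h_def using Cauchy_Schwarz_ineq2 by simp
        also have "\<dots> \<le> norm (f \<eta>) * K" using \<theta>D(3)[OF \<eta> that] by (intro mult_left_mono) auto
        finally show ?thesis using supp[OF \<eta> that False] by (simp add: mult.commute)
      qed (use \<theta>D(1) in simp)
      then have "(\<integral>\<^sup>+ x. ennreal \<bar>h (\<eta>, x)\<bar> \<partial>\<eta>) \<le> (\<integral>\<^sup>+ x. ennreal (K * norm (f \<eta>)) * indicator (E n) x \<partial>\<eta>)"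
        by (intro nn_integral_mono) (fastforce simp: indicator_def intro!: ennreal_leI split: if_splits)
      also have "\<dots> = ennreal (K * norm (f \<eta>)) * emeasure \<eta> (E n)"
        by (simp add: nn_integral_cmult_indicator)
      also have "emeasure \<eta> (E n) = ennreal (measure \<eta> (E n))"
        using True by (intro emeasure_eq_ennreal_measure) auto
      finally show ?thesis using \<theta>D(1) by (simp add: ennreal_mult'[symmetric] mult.assoc)
    next
      case False
      then have "(\<integral>\<^sup>+ x. ennreal \<bar>h (\<eta>, x)\<bar> \<partial>\<eta>) = (\<integral>\<^sup>+ x. 0 \<partial>\<eta>)"
        using supp[OF \<eta>] by (intro nn_integral_cong) force
      then show ?thesis by simp
    qed
  qed
  also have "\<dots> < \<infinity>"
  proof -
    have "integrable \<L> (\<lambda>\<eta>. norm (f \<eta>) \<bullet> measure \<eta> (E n))"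
      by (rule square_integrable_inner[OF f_norm square_integrable_count[OF E_sets E_finite]])
    then have "integrable \<L> (\<lambda>\<eta>. K * (norm (f \<eta>) * measure \<eta> (E n)))" by simp
    then show ?thesis using \<theta>D(1) by (subst nn_integral_eq_integral) auto
  qed
  finally have fin: "(\<integral>\<^sup>+ \<eta>. \<integral>\<^sup>+ x. ennreal \<bar>h (\<eta>, x)\<bar> \<partial>\<eta> \<partial>\<L>) < \<infinity>" .
  note m = mecke_integral[OF h_meas E_sets E_finite supp fin]
  have h_inner: "(LINT x|\<eta>. h (\<eta>, x)) = f \<eta> \<bullet> (LINT x|\<eta>. \<theta> (\<eta>, x))" if "\<eta> \<in> space \<L>" for \<eta>
    using that integrable_config[OF \<theta>, of \<eta> \<eta>] by (simp add: h_def)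
  have h2_inner: "(LINT x|M. h2 (\<eta>, x)) = f \<eta> \<bullet> (LINT x|M. shifted \<theta> (\<eta>, x))" if "\<eta> \<in> space \<L>" for \<eta>
    using that integrable_shifted[OF \<theta>, of \<eta>] by (simp add: h2_def)
  have h2_int: "integrable (\<L> \<Otimes>\<^sub>M M) h2"
  proof (rule Bochner_Integration.integrable_bound)
    show "integrable (\<L> \<Otimes>\<^sub>M M) (\<lambda>z. norm (f (fst z)) * (K * indicator (E n) (snd z)))"
    proof (rule LM.Fubini_integrable)
      show "integrable \<L> (\<lambda>\<eta>. LINT x|M. norm (norm (f (fst (\<eta>, x))) * (K * indicator (E n) (snd (\<eta>, x)))))"
        using square_integrable_imp_integrable[OF f_norm] \<theta>D(1) by (simp add: abs_mult)
      show "AE \<eta> in \<L>. integrable M (\<lambda>x. norm (f (fst (\<eta>, x))) * (K * indicator (E n) (snd (\<eta>, x))))"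
        using E_finite by (intro AE_I2) simp
    qed measurable
    show "AE z in \<L> \<Otimes>\<^sub>M M. norm (h2 z) \<le> norm (norm (f (fst z)) * (K * indicator (E n) (snd z)))"
    proof (rule AE_I2)
      fix z assume "z \<in> space (\<L> \<Otimes>\<^sub>M M)"
      then obtain \<eta> x where z: "z = (\<eta>, x)" "\<eta> \<in> config_set M" "x \<in> space M" by (auto simp: space_pair_measure)
      show "norm (h2 z) \<le> norm (norm (f (fst z)) * (K * indicator (E n) (snd z)))"
      proof (cases "h2 z = 0")
        case False
        have "norm (h2 z) \<le> norm (f \<eta>) * norm (shifted \<theta> (\<eta>, x))"
          unfolding h2_def z using Cauchy_Schwarz_ineq2 by simp
        also have "\<dots> \<le> norm (f \<eta>) * K" using shiftedD(1)[OF \<theta> z(2,3)] by (intro mult_left_mono) auto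
        finally have "norm (h2 z) \<le> norm (f \<eta>) * K" .
        moreover have "x \<in> E n"
          using False shiftedD(2)[OF \<theta> z(2,3)] z(1) by (cases "shifted \<theta> (\<eta>, x) = 0") (auto simp: h2_def)
        ultimately show ?thesis using z(1) \<theta>D(1) by simp
      qed simp
    qed
  qed (rule h2_meas)
  have eq: "point_diff f z \<bullet> shifted \<theta> z = h (add_dirac (fst z) (snd z), snd z) - h2 z" for z
    by (cases z) (simp add: point_diff_def shifted_def h_def h2_def inner_diff_left)
  show "integrable (\<L> \<Otimes>\<^sub>M M) (\<lambda>z. point_diff f z \<bullet> shifted \<theta> z)"
    unfolding eq using m(1) h2_int by (rule Bochner_Integration.integrable_diff)
  have "(LINT z|(\<L> \<Otimes>\<^sub>M M). point_diff f z \<bullet> shifted \<theta> z) =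
      (LINT z|(\<L> \<Otimes>\<^sub>M M). h (add_dirac (fst z) (snd z), snd z)) - (LINT z|(\<L> \<Otimes>\<^sub>M M). h2 z)"
    unfolding eq by (rule Bochner_Integration.integral_diff[OF m(1) h2_int])
  also have "\<dots> = (LINT \<eta>|\<L>. LINT x|\<eta>. h (\<eta>, x)) - (LINT \<eta>|\<L>. LINT x|M. h2 (\<eta>, x))"
    unfolding LM.integral_fst'[OF h2_int] using m(3) by simp
  also have "\<dots> = (LINT \<eta>|\<L>. (LINT x|\<eta>. h (\<eta>, x)) - (LINT x|M. h2 (\<eta>, x)))"
    by (rule Bochner_Integration.integral_diff[OF m(2) LM.integrable_fst'[OF h2_int], symmetric])
  also have "\<dots> = (LINT \<eta>|\<L>. f \<eta> \<bullet> compensated M \<theta> \<eta>)"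
    by (intro Bochner_Integration.integral_cong refl) (simp add: h_inner h2_inner compensated_def inner_diff_right)
  finally show "(LINT z|(\<L> \<Otimes>\<^sub>M M). point_diff f z \<bullet> shifted \<theta> z) = (LINT \<eta>|\<L>. f \<eta> \<bullet> compensated M \<theta> \<eta>)" .
qed

text \<open>
  Duality with \<open>F = \<delta>(\<phi>)\<close> and the commutation relation turn the left-hand side into
  \<open>\<^bold>E \<integral> \<langle>\<phi>(y), \<psi>(y)\<rangle> \<mu>(dy) + \<integral> \<^bold>E \<langle>\<delta>(D\<^sub>y \<phi>), \<psi>(y)\<rangle> \<mu>(dy)\<close>, and for every fixed \<open>y\<close> duality with
  \<open>F = \<psi>(y)\<close>, applied to the integrand \<open>D\<^sub>y \<phi>\<close>, evaluates the second term.
\<close>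

lemma isometry_admissible:
  fixes \<theta> \<theta>' :: "_ \<Rightarrow> 'h::{real_inner,banach,second_countable_topology}"
  assumes \<theta>: "admissible n K \<theta>" and \<theta>': "admissible m K' \<theta>'"
  shows "(LINT \<eta>|\<L>. compensated M \<theta> \<eta> \<bullet> compensated M \<theta>' \<eta>) =
    (LINT z|(\<L> \<Otimes>\<^sub>M M). shifted \<theta> z \<bullet> shifted \<theta>' z) +
    (LINT w|(\<L> \<Otimes>\<^sub>M (M \<Otimes>\<^sub>M M)). process_diff (shifted \<theta>) w \<bullet> process_diff (shifted \<theta>') (swap_points w))"
proof -
  \<comment> \<open>\<open>\<theta>y y\<close> encodes the process \<open>D\<^sub>y \<phi>\<close>, and \<open>R (\<eta>, y)\<close> is \<open>\<langle>\<delta>(D\<^sub>y \<phi>), \<psi>(y)\<rangle>\<close>,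
    where \<open>\<phi> = shifted \<theta>\<close> and \<open>\<psi> = shifted \<theta>'\<close>\<close>
  define \<theta>y where "\<theta>y y = (\<lambda>(\<eta>, x). \<theta> (add_dirac \<eta> y, x) - \<theta> (\<eta>, x))" for y
  define R where "R z = compensated M (\<theta>y (snd z)) (fst z) \<bullet> shifted \<theta>' z" for z
  define G where "G w = process_diff (shifted \<theta>) w \<bullet> process_diff (shifted \<theta>') (swap_points w)" for w
  note sq = square_integrable_shifted[OF \<theta>] square_integrable_shifted[OF \<theta>']
  note dual = duality_admissible[OF \<theta>' square_integrable_compensated[OF \<theta>]]
  have [measurable]: "shifted \<theta> \<in> borel_measurable (config_space M \<Otimes>\<^sub>M M)"
    "shifted \<theta>' \<in> borel_measurable (config_space M \<Otimes>\<^sub>M M)"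
    using measurable_shifted[OF admissibleD(2)] \<theta> \<theta>' by auto
  have split: "point_diff (compensated M \<theta>) z \<bullet> shifted \<theta>' z = shifted \<theta> z \<bullet> shifted \<theta>' z + R z"
    if "z \<in> space (\<L> \<Otimes>\<^sub>M M)" for z
    using compensated_add_dirac[OF \<theta>, of "fst z" "snd z"] that
    by (auto simp: space_pair_measure point_diff_def R_def \<theta>y_def inner_add_left)
  have "integrable (\<L> \<Otimes>\<^sub>M M) (\<lambda>z. point_diff (compensated M \<theta>) z \<bullet> shifted \<theta>' z - shifted \<theta> z \<bullet> shifted \<theta>' z)"
    by (rule Bochner_Integration.integrable_diff[OF dual(1) square_integrable_inner[OF sq]])
  then have R_int: "integrable (\<L> \<Otimes>\<^sub>M M) R"
    by (rule Bochner_Integration.integrable_cong[THEN iffD1, rotated -1, OF _ refl]) (simp add: split)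
  have "(LINT \<eta>|\<L>. compensated M \<theta> \<eta> \<bullet> compensated M \<theta>' \<eta>) =
      (LINT z|(\<L> \<Otimes>\<^sub>M M). shifted \<theta> z \<bullet> shifted \<theta>' z + R z)"
    unfolding dual(2)[symmetric] by (intro Bochner_Integration.integral_cong refl split)
  also have "\<dots> = (LINT z|(\<L> \<Otimes>\<^sub>M M). shifted \<theta> z \<bullet> shifted \<theta>' z) + (LINT z|(\<L> \<Otimes>\<^sub>M M). R z)"
    by (rule Bochner_Integration.integral_add[OF square_integrable_inner[OF sq] R_int])
  also have "(LINT z|(\<L> \<Otimes>\<^sub>M M). R z) = (LINT y|M. LINT \<eta>|\<L>. R (\<eta>, y))"
    using LM.integral_snd[of "\<lambda>\<eta> y. R (\<eta>, y)"] R_int by simp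
  also have "\<dots> = (LINT y|M. LINT z|(\<L> \<Otimes>\<^sub>M M). G (fst z, y, snd z))"
  proof (intro Bochner_Integration.integral_cong refl)
    fix y assume y: "y \<in> space M"
    have \<theta>y: "admissible n (2 * K) (\<theta>y y)"
      unfolding \<theta>y_def by (rule admissible_diff_point[OF \<theta> y])
    have sq_y: "square_integrable \<L> (\<lambda>\<eta>. shifted \<theta>' (\<eta>, y))"
    proof (rule square_integrable_bound[where g="\<lambda>_. K'\<^sup>2"])
      show "(\<lambda>\<eta>. shifted \<theta>' (\<eta>, y)) \<in> borel_measurable \<L>" using y by measurable
      show "AE \<eta> in \<L>. (norm (shifted \<theta>' (\<eta>, y)))\<^sup>2 \<le> K'\<^sup>2"
        using shiftedD(1)[OF \<theta>' _ y] by (intro AE_I2 power_mono) auto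
    qed simp
    have "(LINT \<eta>|\<L>. R (\<eta>, y)) = (LINT \<eta>|\<L>. shifted \<theta>' (\<eta>, y) \<bullet> compensated M (\<theta>y y) \<eta>)"
      by (simp add: R_def inner_commute)
    also have "\<dots> = (LINT z|(\<L> \<Otimes>\<^sub>M M). point_diff (\<lambda>\<eta>. shifted \<theta>' (\<eta>, y)) z \<bullet> shifted (\<theta>y y) z)"
      by (rule duality_admissible(2)[OF \<theta>y sq_y, symmetric])
    also have "\<dots> = (LINT z|(\<L> \<Otimes>\<^sub>M M). G (fst z, y, snd z))"
      by (intro Bochner_Integration.integral_cong refl)
        (auto simp: point_diff_def process_diff_def shifted_def \<theta>y_def G_def swap_points_def add_dirac_commute[of _ y] inner_commute)
    finally show "(LINT \<eta>|\<L>. R (\<eta>, y)) = (LINT z|(\<L> \<Otimes>\<^sub>M M). G (fst z, y, snd z))" .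
  qed
  also have "\<dots> = (LINT w|(\<L> \<Otimes>\<^sub>M (M \<Otimes>\<^sub>M M)). G w)"
  proof (rule Fubini_bounded_support[OF _ E_sets E_sets E_finite E_finite])
    note measurable_process_diff [measurable]
    show "G \<in> borel_measurable (\<L> \<Otimes>\<^sub>M (M \<Otimes>\<^sub>M M))" unfolding G_def by measurable
    fix \<eta> x y assume *: "\<eta> \<in> config_set M" "x \<in> space M" "y \<in> space M"
    have 1: "norm (process_diff (shifted \<theta>) (\<eta>, x, y)) \<le> K + K"
      unfolding process_diff_def prod.case using *
      by (intro order_trans[OF norm_triangle_ineq4] add_mono shiftedD(1)[OF \<theta>]) auto
    have 2: "norm (process_diff (shifted \<theta>') (\<eta>, y, x)) \<le> K' + K'"
      unfolding process_diff_def prod.case using *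
      by (intro order_trans[OF norm_triangle_ineq4] add_mono shiftedD(1)[OF \<theta>']) auto
    have "norm (G (\<eta>, x, y)) \<le> norm (process_diff (shifted \<theta>) (\<eta>, x, y)) * norm (process_diff (shifted \<theta>') (\<eta>, y, x))"
      unfolding G_def swap_points_def using Cauchy_Schwarz_ineq2 by simp
    also have "\<dots> \<le> (K + K) * (K' + K')"
      using 1 2 admissibleD(1)[OF \<theta>] by (intro mult_mono) auto
    finally show "norm (G (\<eta>, x, y)) \<le> (K + K) * (K' + K')" .
    assume "G (\<eta>, x, y) \<noteq> 0"
    then have ne: "process_diff (shifted \<theta>) (\<eta>, x, y) \<noteq> 0" "process_diff (shifted \<theta>') (\<eta>, y, x) \<noteq> 0"
      by (auto simp: G_def swap_points_def)
    have "y \<in> E n"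
      using ne(1) shiftedD(2)[OF \<theta>, of "add_dirac \<eta> x" y] shiftedD(2)[OF \<theta>, of \<eta> y] *
      by (cases "shifted \<theta> (\<eta>, y) = 0") (auto simp: process_diff_def)
    moreover have "x \<in> E m"
      using ne(2) shiftedD(2)[OF \<theta>', of "add_dirac \<eta> y" x] shiftedD(2)[OF \<theta>', of \<eta> x] *
      by (cases "shifted \<theta>' (\<eta>, x) = 0") (auto simp: process_diff_def)
    ultimately show "x \<in> E m \<and> y \<in> E n" by simp
  qed
  finally show ?thesis unfolding G_def .
qed

text \<open>
  Exchanging the two points preserves the measure, so by the Cauchy--Schwarz inequality the second
  term of the isometry is at most \<open>\<parallel>D\<phi>\<parallel>\<^sup>2\<close>. Hence the divergence is a contraction for the graph norm of
  \<open>D\<close>.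
\<close>

lemma energy_admissible:
  fixes \<theta> \<theta>' :: "_ \<Rightarrow> 'h::{real_inner,banach,second_countable_topology}"
  assumes \<theta>: "admissible n K \<theta>" and \<theta>': "admissible m K' \<theta>'"
    and sq: "square_integrable (\<L> \<Otimes>\<^sub>M (M \<Otimes>\<^sub>M M)) (process_diff (shifted \<theta>))"
      "square_integrable (\<L> \<Otimes>\<^sub>M (M \<Otimes>\<^sub>M M)) (process_diff (shifted \<theta>'))"
  shows "sqnorm \<L> (\<lambda>\<eta>. compensated M \<theta> \<eta> - compensated M \<theta>' \<eta>) \<le>
    sqnorm (\<L> \<Otimes>\<^sub>M M) (\<lambda>z. shifted \<theta> z - shifted \<theta>' z) +
    sqnorm (\<L> \<Otimes>\<^sub>M (M \<Otimes>\<^sub>M M)) (\<lambda>w. process_diff (shifted \<theta>) w - process_diff (shifted \<theta>') w)"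
proof -
  let ?d = "\<lambda>z. \<theta> z - \<theta>' z" and ?Q = "\<L> \<Otimes>\<^sub>M (M \<Otimes>\<^sub>M M)"
  have d: "admissible (max n m) (K + K') ?d" by (rule admissible_diff[OF \<theta> \<theta>'])
  have sh: "shifted ?d = (\<lambda>z. shifted \<theta> z - shifted \<theta>' z)" by (auto simp: shifted_def)
  have di: "process_diff (shifted ?d) = (\<lambda>w. process_diff (shifted \<theta>) w - process_diff (shifted \<theta>') w)"
    by (auto simp: sh process_diff_def)
  have sq_d: "square_integrable ?Q (process_diff (shifted ?d))"
    unfolding di by (rule square_integrable_diff[OF sq])
  have "sqnorm \<L> (\<lambda>\<eta>. compensated M \<theta> \<eta> - compensated M \<theta>' \<eta>) = sqnorm \<L> (compensated M ?d)"
    unfolding sqnorm_def using compensated_diff[OF \<theta> \<theta>']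
    by (intro Bochner_Integration.integral_cong) auto
  also have "\<dots> = sqnorm (\<L> \<Otimes>\<^sub>M M) (shifted ?d) +
      (LINT w|?Q. process_diff (shifted ?d) w \<bullet> process_diff (shifted ?d) (swap_points w))"
    unfolding sqnorm_eq_inner by (rule isometry_admissible[OF d d])
  also have "(LINT w|?Q. process_diff (shifted ?d) w \<bullet> process_diff (shifted ?d) (swap_points w)) \<le>
      sqrt (sqnorm ?Q (process_diff (shifted ?d))) * sqrt (sqnorm ?Q (process_diff (shifted ?d)))"
    using Cauchy_Schwarz_integral[OF sq_d square_integrable_swap(1)[OF sq_d]]
    unfolding square_integrable_swap(2)[OF sq_d] by linarith
  also have "\<dots> = sqnorm ?Q (process_diff (shifted ?d))" by simp
  finally show ?thesis unfolding di unfolding sh by simp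
qed

end

section \<open>Extension by density\<close>

text \<open>
  The radial projection onto the ball of radius \<open>c\<close>. It is used to cut off the values of a process
  instead of multiplying by an indicator, since a Lipschitz map does not increase differences by more
  than a constant factor.
\<close>

definition trunc :: "real \<Rightarrow> 'h \<Rightarrow> 'h::real_normed_vector" where
  "trunc c a = (if norm a \<le> c then a else (c / norm a) *\<^sub>R a)"

lemma norm_trunc_le: "0 \<le> c \<Longrightarrow> norm (trunc c a) \<le> c"
  by (auto simp: trunc_def)

lemma norm_trunc_le_norm: "0 \<le> c \<Longrightarrow> norm (trunc c a) \<le> norm a"
  by (auto simp: trunc_def)

lemma trunc_lipschitz:
  assumes c: "0 \<le> c"
  shows "norm (trunc c a - trunc c b) \<le> 2 * norm (a - b)"
proof -
  have err: "norm (trunc c b - b) \<le> norm b - c" if "norm b > c" for b :: 'a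
  proof -
    have "trunc c b - b = ((c - norm b) / norm b) *\<^sub>R b"
      using that c by (simp add: trunc_def diff_divide_distrib scaleR_diff_left)
    moreover have "norm b \<noteq> 0" using that c by linarith
    ultimately have "norm (trunc c b - b) = \<bar>c - norm b\<bar>" by simp
    then show ?thesis using that by simp
  qed
  have one: "norm (trunc c a - trunc c b) \<le> 2 * norm (a - b)" if "norm a \<le> c" for a b :: 'a
  proof (cases "norm b \<le> c")
    case True
    then show ?thesis using that by (simp add: trunc_def)
  next
    case False
    have "trunc c a - trunc c b = (a - b) - (trunc c b - b)" using that by (simp add: trunc_def)
    then have "norm (trunc c a - trunc c b) \<le> norm (a - b) + norm (trunc c b - b)"
      by (metis norm_triangle_ineq4)
    also have "\<dots> \<le> norm (a - b) + (norm b - norm a)" using err[of b] False that by simp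
    also have "\<dots> \<le> 2 * norm (a - b)" using norm_triangle_ineq2[of b a] by (simp add: norm_minus_commute)
    finally show ?thesis .
  qed
  consider "norm a \<le> c" | "norm b \<le> c" | "norm a > c" "norm b > c" by linarith
  then show ?thesis
  proof cases
    case 1
    then show ?thesis by (rule one)
  next
    case 2
    then show ?thesis using one[of b a] by (simp add: norm_minus_commute)
  next
    case 3
    then have pos: "norm a > 0" "norm b > 0" using c by auto
    have "trunc c a - trunc c b = (c / norm a) *\<^sub>R ((a - b) + ((norm b - norm a) / norm b) *\<^sub>R b)"
      using 3 pos by (simp add: trunc_def algebra_simps diff_divide_distrib)
    then have "norm (trunc c a - trunc c b) = (c / norm a) * norm ((a - b) + ((norm b - norm a) / norm b) *\<^sub>R b)"
      using c by simp
    also have "\<dots> \<le> 1 * norm ((a - b) + ((norm b - norm a) / norm b) *\<^sub>R b)"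
      using 3 pos by (intro mult_right_mono) (auto simp: field_simps)
    also have "\<dots> \<le> norm (a - b) + norm (((norm b - norm a) / norm b) *\<^sub>R b)"
      unfolding mult_1 by (rule norm_triangle_ineq)
    also have "norm (((norm b - norm a) / norm b) *\<^sub>R b) = \<bar>norm b - norm a\<bar>"
      using pos by simp
    also have "norm (a - b) + \<bar>norm b - norm a\<bar> \<le> 2 * norm (a - b)"
      using norm_triangle_ineq3[of b a] by (simp add: norm_minus_commute)
    finally show ?thesis .
  qed
qed

lemma measurable_trunc [measurable]: "(trunc c :: 'h \<Rightarrow> 'h::{real_normed_vector,second_countable_topology}) \<in> borel_measurable borel"
  unfolding trunc_def[abs_def] by measurable

lemma trunc_eventually: "\<forall>\<^sub>F n in sequentially. trunc (real n) a = a"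
proof -
  obtain N :: nat where "norm a \<le> real N" using real_arch_simple by blast
  then have "\<forall>n\<ge>N. trunc (real n) a = a" by (auto simp: trunc_def)
  then show ?thesis by (auto simp: eventually_sequentially)
qed

context poisson_law
begin

text \<open>
  The adjointness relation, expressed on the law of the Poisson random measure.
\<close>

definition is_divergence ::
    "('e measure \<times> 'e \<Rightarrow> 'h::{real_inner,banach,second_countable_topology}) \<Rightarrow> ('e measure \<Rightarrow> 'h) \<Rightarrow> bool" where
  "is_divergence \<phi> g \<longleftrightarrow> square_integrable \<L> g \<and>
     (\<forall>f. square_integrable \<L> f \<longrightarrow> square_integrable (\<L> \<Otimes>\<^sub>M M) (point_diff f) \<longrightarrow>
        (LINT z|(\<L> \<Otimes>\<^sub>M M). point_diff f z \<bullet> \<phi> z) = (LINT \<eta>|\<L>. f \<eta> \<bullet> g \<eta>))"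

lemma is_divergenceD:
  assumes "is_divergence \<phi> g"
  shows "square_integrable \<L> g"
    "square_integrable \<L> f \<Longrightarrow> square_integrable (\<L> \<Otimes>\<^sub>M M) (point_diff f) \<Longrightarrow>
      (LINT z|(\<L> \<Otimes>\<^sub>M M). point_diff f z \<bullet> \<phi> z) = (LINT \<eta>|\<L>. f \<eta> \<bullet> g \<eta>)"
  using assms by (auto simp: is_divergence_def)

text \<open>
  Adding a point outside of the sets that occur in a count event does not affect the event. Hence its
  indicator has a difference supported by a set of finite measure, and belongs to the Sobolev space.
\<close>

lemma point_diff_count_event:
  fixes v :: "'h::{real_inner,banach,second_countable_topology}"
  assumes U: "U \<in> count_events M"
  shows "square_integrable \<L> (\<lambda>\<eta>. indicator U \<eta> *\<^sub>R v)"
    "square_integrable (\<L> \<Otimes>\<^sub>M M) (point_diff (\<lambda>\<eta>. indicator U \<eta> *\<^sub>R v))"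
proof -
  obtain S where S: "finite S" "\<And>B k. (B, k) \<in> S \<Longrightarrow> B \<in> sets M \<and> emeasure M B < \<infinity>"
    and U_eq: "U = {\<eta> \<in> config_set M. \<forall>(B, k)\<in>S. emeasure \<eta> B = of_nat k}"
    using U unfolding count_events_def by blast
  have U_sets [measurable]: "U \<in> sets (config_space M)"
    unfolding U_eq using S by (intro count_event_in_sets) auto
  define B where "B = (\<Union>(fst ` S))"
  have B [measurable]: "B \<in> sets M" unfolding B_def using S by (intro sets.finite_Union) auto
  have "emeasure M B \<le> (\<Sum>p\<in>S. emeasure M (fst p))"
    unfolding B_def using S by (intro emeasure_subadditive_finite) auto
  also have "\<dots> < \<infinity>" using S by auto
  finally have B_fin: "emeasure M B < \<infinity>" .
  have meas: "(\<lambda>\<eta>. indicator U \<eta> *\<^sub>R v) \<in> borel_measurable (config_space M)" by measurable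
  show "square_integrable \<L> (\<lambda>\<eta>. indicator U \<eta> *\<^sub>R v)"
  proof (rule square_integrable_bound[where g="\<lambda>_. (norm v)\<^sup>2"])
    show "AE \<eta> in \<L>. (norm (indicat_real U \<eta> *\<^sub>R v))\<^sup>2 \<le> (norm v)\<^sup>2"
      by (intro AE_I2) (simp split: split_indicator)
  qed (use meas in \<open>auto simp: measurable_law_iff\<close>)
  show "square_integrable (\<L> \<Otimes>\<^sub>M M) (point_diff (\<lambda>\<eta>. indicator U \<eta> *\<^sub>R v))"
    unfolding square_integrable_def
  proof
    show "integrable (\<L> \<Otimes>\<^sub>M M) (\<lambda>z. (norm (point_diff (\<lambda>\<eta>. indicat_real U \<eta> *\<^sub>R v) z))\<^sup>2)"
    proof (rule integrable_bounded_support[where S="space \<L> \<times> B" and c="(norm v)\<^sup>2"])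
      have "emeasure (\<L> \<Otimes>\<^sub>M M) (space \<L> \<times> B) = emeasure M B"
        by (subst M.emeasure_pair_measure_Times) (auto simp: emeasure_space_1[simplified])
      then show "emeasure (\<L> \<Otimes>\<^sub>M M) (space \<L> \<times> B) < \<infinity>" using B_fin by simp
      fix z assume "z \<in> space (\<L> \<Otimes>\<^sub>M M)"
      then obtain \<eta> x where z: "z = (\<eta>, x)" "\<eta> \<in> config_set M" "x \<in> space M" by (auto simp: space_pair_measure)
      show "norm ((norm (point_diff (\<lambda>\<eta>. indicat_real U \<eta> *\<^sub>R v) z))\<^sup>2) \<le> (norm v)\<^sup>2"
        by (simp add: z point_diff_def split: split_indicator)
      show "z \<in> space \<L> \<times> B" if "(norm (point_diff (\<lambda>\<eta>. indicat_real U \<eta> *\<^sub>R v) z))\<^sup>2 \<noteq> 0"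
      proof (rule ccontr)
        assume "z \<notin> space \<L> \<times> B"
        then have "x \<notin> B" using z by auto
        then have "emeasure (add_dirac \<eta> x) C = emeasure \<eta> C" if "(C, k) \<in> S" for C k
        proof -
          have "x \<notin> C" using that \<open>x \<notin> B\<close> by (force simp: B_def)
          then show ?thesis
            using S(2)[OF that] config_setD(1)[OF z(2)] by (simp add: emeasure_add_dirac)
        qed
        then have "add_dirac \<eta> x \<in> U \<longleftrightarrow> \<eta> \<in> U"
          using z(2) unfolding U_eq by auto
        then show False using that by (simp add: z point_diff_def split: split_indicator_asm)
      qed
    qed (use measurable_point_diff[OF meas] in measurable)
  qed (rule measurable_point_diff[OF meas])
qed

text \<open>
  The count events are a generating \<open>\<inter>\<close>-stable class and their indicators are admitted as test functions.
  So two divergences of the same process have the same integrals over all events.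
\<close>

lemma divergence_unique:
  assumes g: "is_divergence \<phi> g" and g': "is_divergence \<phi> g'"
  shows "AE \<eta> in \<L>. g \<eta> = g' \<eta>"
proof -
  define h where "h \<eta> = g \<eta> - g' \<eta>" for \<eta>
  have sq: "square_integrable \<L> g" "square_integrable \<L> g'" "square_integrable \<L> h"
    using g g' unfolding is_divergence_def h_def by auto
  have h_int: "integrable \<L> h" by (rule square_integrable_imp_integrable[OF sq(3)])
  have h_set: "set_integrable \<L> U h" if "U \<in> sets \<L>" for U
    unfolding set_integrable_def by (rule integrable_mult_indicator[OF that h_int])
  have basic: "set_lebesgue_integral \<L> U h = 0" if U: "U \<in> count_events M" for U
  proof (rule vector_eq_rdot[THEN iffD1], rule allI)
    fix v
    note dU = point_diff_count_event[OF U, of v]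
    have U_sets: "U \<in> sets \<L>"
      using U sets_config_space_count_events[OF M.sigma_finite_measure_axioms]
      by (auto simp: sets_law)
    have "set_lebesgue_integral \<L> U h \<bullet> v = (LINT \<eta>|\<L>. (indicator U \<eta> *\<^sub>R h \<eta>) \<bullet> v)"
      unfolding set_lebesgue_integral_def
      by (rule integral_inner_left[symmetric]) (use h_set[OF U_sets] in \<open>simp add: set_integrable_def\<close>)
    also have "\<dots> = (LINT \<eta>|\<L>. (indicator U \<eta> *\<^sub>R v) \<bullet> g \<eta> - (indicator U \<eta> *\<^sub>R v) \<bullet> g' \<eta>)"
      by (intro Bochner_Integration.integral_cong) (auto simp: h_def inner_diff_right inner_diff_left inner_commute right_diff_distrib)
    also have "\<dots> = (LINT \<eta>|\<L>. (indicator U \<eta> *\<^sub>R v) \<bullet> g \<eta>) - (LINT \<eta>|\<L>. (indicator U \<eta> *\<^sub>R v) \<bullet> g' \<eta>)"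
      by (rule Bochner_Integration.integral_diff[OF square_integrable_inner[OF dU(1) sq(1)] square_integrable_inner[OF dU(1) sq(2)]])
    also have "\<dots> = 0"
      unfolding is_divergenceD(2)[OF g dU, symmetric] is_divergenceD(2)[OF g' dU, symmetric] by simp
    finally show "set_lebesgue_integral \<L> U h \<bullet> v = 0 \<bullet> v" by simp
  qed
  have all: "set_lebesgue_integral \<L> U h = 0" if "U \<in> sets \<L>" for U
  proof -
    have sets: "sets \<L> = sigma_sets (config_set M) (count_events M)"
      using sets_config_space_count_events[OF M.sigma_finite_measure_axioms] by (simp add: sets_law)
    have sub: "count_events M \<subseteq> Pow (config_set M)" by (auto simp: count_events_def)
    have top: "config_set M \<in> count_events M"
      by (auto simp: count_events_def intro!: exI[of _ "{}"])
    show ?thesis using Int_stable_count_events sub that unfolding sets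
    proof (induct rule: sigma_sets_induct_disjoint)
      case (basic A)
      then show ?case by (rule \<open>\<And>U. U \<in> count_events M \<Longrightarrow> set_lebesgue_integral \<L> U h = 0\<close>)
    next
      case empty
      then show ?case by (simp add: set_lebesgue_integral_def)
    next
      case (compl A)
      then have A: "A \<in> sets \<L>" "A \<subseteq> config_set M"
        using sets sets.sets_into_space[of A \<L>] by auto
      have "set_lebesgue_integral \<L> (A \<union> (config_set M - A)) h =
          set_lebesgue_integral \<L> A h + set_lebesgue_integral \<L> (config_set M - A) h"
        using A h_set by (intro set_integral_Un) auto
      moreover have "A \<union> (config_set M - A) = config_set M" using A by auto
      ultimately show ?case using compl basic[OF top] by simp
    next
      case (union A)
      then have A: "\<And>i. A i \<in> sets \<L>" using sets by auto
      have "set_lebesgue_integral \<L> (\<Union>i. A i) h = (\<Sum>i. set_lebesgue_integral \<L> (A i) h)"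
        using A union(1) h_set by (intro lebesgue_integral_countable_add) (auto simp: disjoint_family_on_def)
      then show ?case using union by simp
    qed
  qed
  have "AE \<eta> in \<L>. h \<eta> = 0"
    using h_int all by (rule density_zero)
  then show ?thesis by eventually_elim (simp add: h_def)
qed

end

context poisson_law_exhausted
begin

text \<open>
  Truncating the values and restricting the points to \<open>E n\<close> eventually leaves the process
  unchanged at every locally finite configuration, and the differences of the truncated process are dominated by those of \<open>\<phi>\<close>. So
  dominated convergence applies to the process and to its differences alike.
\<close>

lemma approximation:
  fixes \<phi> :: "'a measure \<times> 'a \<Rightarrow> 'h::{real_inner,banach,second_countable_topology}"
  assumes \<phi>: "square_integrable (\<L> \<Otimes>\<^sub>M M) \<phi>" and D\<phi>: "square_integrable (\<L> \<Otimes>\<^sub>M (M \<Otimes>\<^sub>M M)) (process_diff \<phi>)"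
  obtains \<theta> where "\<And>n. admissible n (real n) (\<theta> n)"
    "\<And>n. square_integrable (\<L> \<Otimes>\<^sub>M (M \<Otimes>\<^sub>M M)) (process_diff (shifted (\<theta> n)))"
    "(\<lambda>n. sqnorm (\<L> \<Otimes>\<^sub>M M) (\<lambda>z. shifted (\<theta> n) z - \<phi> z)) \<longlonglongrightarrow> 0"
    "(\<lambda>n. sqnorm (\<L> \<Otimes>\<^sub>M (M \<Otimes>\<^sub>M M)) (\<lambda>w. process_diff (shifted (\<theta> n)) w - process_diff \<phi> w)) \<longlonglongrightarrow> 0"
proof -
  let ?Q = "\<L> \<Otimes>\<^sub>M (M \<Otimes>\<^sub>M M)"
  have \<phi>_meas [measurable]: "\<phi> \<in> borel_measurable (config_space M \<Otimes>\<^sub>M M)"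
    using square_integrableD(1)[OF \<phi>] by (simp add: measurable_law_pair_iff)
  define \<phi>n where "\<phi>n n z = (if snd z \<in> E n \<and> locally_finite (fst z) then trunc (real n) (\<phi> z) else 0)" for n z
  have \<phi>n_meas [measurable]: "\<phi>n n \<in> borel_measurable (config_space M \<Otimes>\<^sub>M M)" for n
    unfolding \<phi>n_def by measurable
  have "\<exists>\<theta>. admissible n (real n) \<theta> \<and> (\<forall>\<eta>\<in>config_set M. \<forall>x\<in>space M. shifted \<theta> (\<eta>, x) = \<phi>n n (\<eta>, x))" for n
  proof -
    obtain \<theta>0 where \<theta>0 [measurable]: "\<theta>0 \<in> borel_measurable (config_space M \<Otimes>\<^sub>M M)"
      and eq: "\<And>\<eta> x. \<eta> \<in> config_set M \<Longrightarrow> x \<in> space M \<Longrightarrow> \<phi>n n (\<eta>, x) = \<theta>0 (add_dirac \<eta> x, x)"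
      by (rule point_removal[OF \<phi>n_meas[of n]]) (rule that)
    \<comment> \<open>\<open>\<theta>0\<close> is not controlled where \<open>x\<close> is not an atom of \<open>\<eta>\<close>, so its support and its bound have to be enforced\<close>
    define \<theta> where "\<theta> z = (if snd z \<in> E n \<and> locally_finite (fst z) \<and> norm (\<theta>0 z) \<le> real n then \<theta>0 z else 0)" for z
    have "\<theta> \<in> borel_measurable (config_space M \<Otimes>\<^sub>M M)" unfolding \<theta>_def by measurable
    then have "admissible n (real n) \<theta>" by (auto simp: admissible_def \<theta>_def)
    moreover have "shifted \<theta> (\<eta>, x) = \<phi>n n (\<eta>, x)" if *: "\<eta> \<in> config_set M" "x \<in> space M" for \<eta> x
    proof -
      have "norm (\<theta>0 (add_dirac \<eta> x, x)) \<le> real n"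
        unfolding eq[OF *, symmetric] by (simp add: \<phi>n_def norm_trunc_le)
      then show ?thesis using * eq[OF *] by (auto simp: shifted_def \<theta>_def \<phi>n_def)
    qed
    ultimately show ?thesis by blast
  qed
  then have "\<exists>\<theta>. \<forall>n. admissible n (real n) (\<theta> n) \<and>
      (\<forall>\<eta>\<in>config_set M. \<forall>x\<in>space M. shifted (\<theta> n) (\<eta>, x) = \<phi>n n (\<eta>, x))"
    by (intro choice allI)
  then obtain \<theta> where *: "\<forall>n. admissible n (real n) (\<theta> n) \<and>
      (\<forall>\<eta>\<in>config_set M. \<forall>x\<in>space M. shifted (\<theta> n) (\<eta>, x) = \<phi>n n (\<eta>, x))"
    by (rule exE)
  then have \<theta>: "admissible n (real n) (\<theta> n)"
    and sh: "\<eta> \<in> config_set M \<Longrightarrow> x \<in> space M \<Longrightarrow> shifted (\<theta> n) (\<eta>, x) = \<phi>n n (\<eta>, x)" for n \<eta> x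
    by simp_all
  have sh_meas [measurable]: "shifted (\<theta> n) \<in> borel_measurable (config_space M \<Otimes>\<^sub>M M)" for n
    by (rule measurable_shifted[OF admissibleD(2)[OF \<theta>]])
  note measurable_process_diff [measurable]
  have in_E: "\<forall>\<^sub>F n in sequentially. x \<in> E n" if x: "x \<in> space M" for x
  proof -
    obtain N where "x \<in> E N" using x E_cover by blast
    then have "\<forall>n\<ge>N. x \<in> E n" using E_mono by blast
    then show ?thesis by (auto simp: eventually_sequentially)
  qed
  have ev: "\<forall>\<^sub>F n in sequentially. \<phi>n n (\<eta>, x) = \<phi> (\<eta>, x)" if "locally_finite \<eta>" "x \<in> space M" for \<eta> x
    using in_E[OF that(2)] trunc_eventually[of "\<phi> (\<eta>, x)"] by eventually_elim (simp add: \<phi>n_def that)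
  have AE1: "AE z in \<L> \<Otimes>\<^sub>M M. locally_finite (fst z)"
    using AE_locally_finite by (intro LM.AE_pair_measure) auto
  have AE2: "AE w in ?Q. locally_finite (fst w)"
    using AE_locally_finite by (intro LMM.AE_pair_measure) auto
  have norm_\<phi>n: "norm (\<phi>n n z) \<le> norm (\<phi> z)" for n z
    by (simp add: \<phi>n_def norm_trunc_le_norm)
  have norm_d: "norm (process_diff (shifted (\<theta> n)) (\<eta>, x, y)) \<le> 2 * norm (process_diff \<phi> (\<eta>, x, y))"
    if "\<eta> \<in> config_set M" "x \<in> space M" "y \<in> space M" for n \<eta> x y
    using that trunc_lipschitz[of "real n" "\<phi> (add_dirac \<eta> x, y)" "\<phi> (\<eta>, y)"]
    by (simp add: process_diff_def sh \<phi>n_def)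
  have "(\<lambda>n. sqnorm (\<L> \<Otimes>\<^sub>M M) (\<lambda>z. shifted (\<theta> n) z - \<phi> z)) \<longlonglongrightarrow> 0"
  proof (rule sqnorm_tendsto_0[where g="\<lambda>z. 4 * (norm (\<phi> z))\<^sup>2"])
    show "(\<lambda>z. shifted (\<theta> n) z - \<phi> z) \<in> borel_measurable (\<L> \<Otimes>\<^sub>M M)" for n by measurable
    show "integrable (\<L> \<Otimes>\<^sub>M M) (\<lambda>z. 4 * (norm (\<phi> z))\<^sup>2)" using square_integrableD(2)[OF \<phi>] by simp
    show "AE z in \<L> \<Otimes>\<^sub>M M. (norm (shifted (\<theta> n) z - \<phi> z))\<^sup>2 \<le> 4 * (norm (\<phi> z))\<^sup>2" for n
    proof (rule AE_I2)
      fix z assume "z \<in> space (\<L> \<Otimes>\<^sub>M M)"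
      then have eq: "shifted (\<theta> n) z = \<phi>n n z" using sh by (auto simp: space_pair_measure)
      have "(norm (\<phi>n n z))\<^sup>2 \<le> (norm (\<phi> z))\<^sup>2" by (intro power_mono norm_\<phi>n) simp
      then show "(norm (shifted (\<theta> n) z - \<phi> z))\<^sup>2 \<le> 4 * (norm (\<phi> z))\<^sup>2"
        unfolding eq using norm_diff_sq_le[of "\<phi>n n z" "\<phi> z"] by linarith
    qed
    show "AE z in \<L> \<Otimes>\<^sub>M M. (\<lambda>n. shifted (\<theta> n) z - \<phi> z) \<longlonglongrightarrow> 0"
      using AE1 AE_space
    proof eventually_elim
      fix z assume *: "locally_finite (fst z)" "z \<in> space (\<L> \<Otimes>\<^sub>M M)"
      then obtain \<eta> x where z: "z = (\<eta>, x)" "\<eta> \<in> config_set M" "x \<in> space M" by (auto simp: space_pair_measure)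
      have "\<forall>\<^sub>F n in sequentially. shifted (\<theta> n) z - \<phi> z = 0"
        using ev[of \<eta> x] * z by (auto simp: sh elim: eventually_mono)
      then show "(\<lambda>n. shifted (\<theta> n) z - \<phi> z) \<longlonglongrightarrow> 0" by (rule tendsto_eventually)
    qed
  qed
  moreover have "square_integrable ?Q (process_diff (shifted (\<theta> n)))" for n
  proof (rule square_integrable_bound[where g="\<lambda>w. 4 * (norm (process_diff \<phi> w))\<^sup>2"])
    show "integrable ?Q (\<lambda>w. 4 * (norm (process_diff \<phi> w))\<^sup>2)" using square_integrableD(2)[OF D\<phi>] by simp
    show "AE w in ?Q. (norm (process_diff (shifted (\<theta> n)) w))\<^sup>2 \<le> 4 * (norm (process_diff \<phi> w))\<^sup>2"
    proof (rule AE_I2)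
      fix w assume "w \<in> space ?Q"
      then have "norm (process_diff (shifted (\<theta> n)) w) \<le> 2 * norm (process_diff \<phi> w)"
        using norm_d by (auto simp: space_pair_measure)
      then have "(norm (process_diff (shifted (\<theta> n)) w))\<^sup>2 \<le> (2 * norm (process_diff \<phi> w))\<^sup>2" by (intro power_mono) auto
      then show "(norm (process_diff (shifted (\<theta> n)) w))\<^sup>2 \<le> 4 * (norm (process_diff \<phi> w))\<^sup>2"
        by (simp add: power_mult_distrib)
    qed
  qed measurable
  moreover have "(\<lambda>n. sqnorm ?Q (\<lambda>w. process_diff (shifted (\<theta> n)) w - process_diff \<phi> w)) \<longlonglongrightarrow> 0"
  \<comment> \<open>\<open>10 = 2 \<cdot> 2\<^sup>2 + 2\<close>, where \<open>2\<close> is the Lipschitz constant of the truncation\<close>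
  proof (rule sqnorm_tendsto_0[where g="\<lambda>w. 10 * (norm (process_diff \<phi> w))\<^sup>2"])
    show "(\<lambda>w. process_diff (shifted (\<theta> n)) w - process_diff \<phi> w) \<in> borel_measurable ?Q" for n by measurable
    show "integrable ?Q (\<lambda>w. 10 * (norm (process_diff \<phi> w))\<^sup>2)" using square_integrableD(2)[OF D\<phi>] by simp
    show "AE w in ?Q. (norm (process_diff (shifted (\<theta> n)) w - process_diff \<phi> w))\<^sup>2 \<le> 10 * (norm (process_diff \<phi> w))\<^sup>2" for n
    proof (rule AE_I2)
      fix w assume "w \<in> space ?Q"
      then have "norm (process_diff (shifted (\<theta> n)) w) \<le> 2 * norm (process_diff \<phi> w)"
        using norm_d by (auto simp: space_pair_measure)
      then have "(norm (process_diff (shifted (\<theta> n)) w))\<^sup>2 \<le> (2 * norm (process_diff \<phi> w))\<^sup>2" by (intro power_mono) auto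
      then show "(norm (process_diff (shifted (\<theta> n)) w - process_diff \<phi> w))\<^sup>2 \<le> 10 * (norm (process_diff \<phi> w))\<^sup>2"
        using norm_diff_sq_le[of "process_diff (shifted (\<theta> n)) w" "process_diff \<phi> w"] by (simp add: power_mult_distrib)
    qed
    show "AE w in ?Q. (\<lambda>n. process_diff (shifted (\<theta> n)) w - process_diff \<phi> w) \<longlonglongrightarrow> 0"
      using AE2 AE_space
    proof eventually_elim
      fix w assume *: "locally_finite (fst w)" "w \<in> space ?Q"
      then obtain \<eta> x y where w: "w = (\<eta>, x, y)" "\<eta> \<in> config_set M" "x \<in> space M" "y \<in> space M"
        by (auto simp: space_pair_measure)
      have "\<forall>\<^sub>F n in sequentially. \<phi>n n (add_dirac \<eta> x, y) = \<phi> (add_dirac \<eta> x, y)"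
        "\<forall>\<^sub>F n in sequentially. \<phi>n n (\<eta>, y) = \<phi> (\<eta>, y)"
        using * w by (auto intro!: ev)
      then have "\<forall>\<^sub>F n in sequentially. process_diff (shifted (\<theta> n)) w - process_diff \<phi> w = 0"
        by eventually_elim (use w in \<open>simp add: process_diff_def sh\<close>)
      then show "(\<lambda>n. process_diff (shifted (\<theta> n)) w - process_diff \<phi> w) \<longlonglongrightarrow> 0" by (rule tendsto_eventually)
    qed
  qed
  ultimately show ?thesis by (intro that[of \<theta>] \<theta>)
qed

text \<open>
  By the contraction property the divergences of the approximating processes form a Cauchy sequence.
  Its limit inherits the duality relation.
\<close>

lemma divergence_approximation:
  fixes \<phi> :: "'a measure \<times> 'a \<Rightarrow> 'h::{real_inner,banach,second_countable_topology}"
  assumes \<phi>: "square_integrable (\<L> \<Otimes>\<^sub>M M) \<phi>" and D\<phi>: "square_integrable (\<L> \<Otimes>\<^sub>M (M \<Otimes>\<^sub>M M)) (process_diff \<phi>)"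
  obtains \<theta> g where "\<And>n. admissible n (real n) (\<theta> n)"
    "\<And>n. square_integrable (\<L> \<Otimes>\<^sub>M (M \<Otimes>\<^sub>M M)) (process_diff (shifted (\<theta> n)))"
    "(\<lambda>n. sqnorm (\<L> \<Otimes>\<^sub>M M) (\<lambda>z. shifted (\<theta> n) z - \<phi> z)) \<longlonglongrightarrow> 0"
    "(\<lambda>n. sqnorm (\<L> \<Otimes>\<^sub>M (M \<Otimes>\<^sub>M M)) (\<lambda>w. process_diff (shifted (\<theta> n)) w - process_diff \<phi> w)) \<longlonglongrightarrow> 0"
    "(\<lambda>n. sqnorm \<L> (\<lambda>\<eta>. compensated M (\<theta> n) \<eta> - g \<eta>)) \<longlonglongrightarrow> 0"
    "is_divergence \<phi> g"
proof -
  let ?Q = "\<L> \<Otimes>\<^sub>M (M \<Otimes>\<^sub>M M)"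
  obtain \<theta> where \<theta>: "\<And>n. admissible n (real n) (\<theta> n)"
    and sq_d: "\<And>n. square_integrable ?Q (process_diff (shifted (\<theta> n)))"
    and lim: "(\<lambda>n. sqnorm (\<L> \<Otimes>\<^sub>M M) (\<lambda>z. shifted (\<theta> n) z - \<phi> z)) \<longlonglongrightarrow> 0"
      "(\<lambda>n. sqnorm ?Q (\<lambda>w. process_diff (shifted (\<theta> n)) w - process_diff \<phi> w)) \<longlonglongrightarrow> 0"
    by (rule approximation[OF \<phi> D\<phi>]) (rule that)
  note sq_s = square_integrable_shifted[OF \<theta>]
  define e where "e n = sqnorm (\<L> \<Otimes>\<^sub>M M) (\<lambda>z. shifted (\<theta> n) z - \<phi> z) +
    sqnorm ?Q (\<lambda>w. process_diff (shifted (\<theta> n)) w - process_diff \<phi> w)" for n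
  have e: "e \<longlonglongrightarrow> 0" unfolding e_def using tendsto_add[OF lim] by simp
  have le: "sqnorm \<L> (\<lambda>\<eta>. compensated M (\<theta> m) \<eta> - compensated M (\<theta> n) \<eta>) \<le> 2 * e m + 2 * e n" for m n
  proof -
    have "sqnorm \<L> (\<lambda>\<eta>. compensated M (\<theta> m) \<eta> - compensated M (\<theta> n) \<eta>) \<le>
      sqnorm (\<L> \<Otimes>\<^sub>M M) (\<lambda>z. shifted (\<theta> m) z - shifted (\<theta> n) z) +
      sqnorm ?Q (\<lambda>w. process_diff (shifted (\<theta> m)) w - process_diff (shifted (\<theta> n)) w)"
      by (rule energy_admissible[OF \<theta> \<theta> sq_d sq_d])
    also have "\<dots> \<le> 2 * e m + 2 * e n"
      using sqnorm_triangle[OF square_integrable_diff[OF sq_s[of m] \<phi>] square_integrable_diff[OF sq_s[of n] \<phi>]]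
        sqnorm_triangle[OF square_integrable_diff[OF sq_d[of m] D\<phi>] square_integrable_diff[OF sq_d[of n] D\<phi>]]
      by (simp add: e_def)
    finally show ?thesis .
  qed
  have sq_c: "square_integrable \<L> (compensated M (\<theta> n))" for n
    by (rule square_integrable_compensated[OF \<theta>])
  have cauchy: "\<exists>k. \<forall>m\<ge>k. \<forall>n\<ge>k. sqnorm \<L> (\<lambda>\<eta>. compensated M (\<theta> m) \<eta> - compensated M (\<theta> n) \<eta>) < r" if "r > 0" for r
  proof -
    have "\<forall>\<^sub>F n in sequentially. e n < r / 4" using e that by (intro order_tendstoD(2)[OF e]) simp
    then obtain k where k: "\<And>n. n \<ge> k \<Longrightarrow> e n < r / 4" by (auto simp: eventually_sequentially)
    have "sqnorm \<L> (\<lambda>\<eta>. compensated M (\<theta> m) \<eta> - compensated M (\<theta> n) \<eta>) < r" if "m \<ge> k" "n \<ge> k" for m n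
      using le[of m n] k[OF that(1)] k[OF that(2)] by linarith
    then show ?thesis by blast
  qed
  obtain g where g: "square_integrable \<L> g" "(\<lambda>n. sqnorm \<L> (\<lambda>\<eta>. compensated M (\<theta> n) \<eta> - g \<eta>)) \<longlonglongrightarrow> 0"
    by (rule L2_complete[OF sq_c cauchy])
  have "is_divergence \<phi> g"
    unfolding is_divergence_def
  proof (intro conjI allI impI g(1))
    fix f :: "'a measure \<Rightarrow> 'h"
    assume f: "square_integrable \<L> f" and df: "square_integrable (\<L> \<Otimes>\<^sub>M M) (point_diff f)"
    have "(\<lambda>n. LINT z|(\<L> \<Otimes>\<^sub>M M). point_diff f z \<bullet> shifted (\<theta> n) z) \<longlonglongrightarrow> (LINT z|(\<L> \<Otimes>\<^sub>M M). point_diff f z \<bullet> \<phi> z)"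
      by (rule integral_inner_tendsto[OF df df sq_s \<phi> _ lim(1)]) (simp add: sqnorm_def)
    moreover have "(\<lambda>n. LINT \<eta>|\<L>. f \<eta> \<bullet> compensated M (\<theta> n) \<eta>) \<longlonglongrightarrow> (LINT \<eta>|\<L>. f \<eta> \<bullet> g \<eta>)"
      by (rule integral_inner_tendsto[OF f f sq_c g(1) _ g(2)]) (simp add: sqnorm_def)
    ultimately show "(LINT z|(\<L> \<Otimes>\<^sub>M M). point_diff f z \<bullet> \<phi> z) = (LINT \<eta>|\<L>. f \<eta> \<bullet> g \<eta>)"
      unfolding duality_admissible(2)[OF \<theta> f] by (rule LIMSEQ_unique)
  qed
  show ?thesis by (rule that[OF \<theta> sq_d lim g(2) \<open>is_divergence \<phi> g\<close>])
qed

end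

context poisson_law
begin

lemma exhausted: "\<exists>E. poisson_law_exhausted M \<L> E"
proof -
  obtain E :: "nat \<Rightarrow> _" where E: "range E \<subseteq> sets M" "(\<Union>i. E i) = space M" "\<And>i. emeasure M (E i) \<noteq> \<infinity>" "incseq E"
    using M.sigma_finite_incseq by metis
  have "poisson_law_exhausted M \<L> E"
    using E by unfold_locales (auto simp: incseq_def less_top)
  then show ?thesis by (intro exI[of _ E])
qed

lemma divergence_exists:
  fixes \<phi> :: "'e measure \<times> 'e \<Rightarrow> 'h::{real_inner,banach,second_countable_topology}"
  assumes \<phi>: "square_integrable (\<L> \<Otimes>\<^sub>M M) \<phi>" and D\<phi>: "square_integrable (\<L> \<Otimes>\<^sub>M (M \<Otimes>\<^sub>M M)) (process_diff \<phi>)"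
  obtains g where "is_divergence \<phi> g"
proof -
  obtain E where "poisson_law_exhausted M \<L> E" using exhausted by blast
  then interpret poisson_law_exhausted M \<L> E .
  show ?thesis by (rule divergence_approximation[OF \<phi> D\<phi>]) (rule that)
qed

theorem divergence_isometry:
  fixes \<phi> \<psi> :: "'e measure \<times> 'e \<Rightarrow> 'h::{real_inner,banach,second_countable_topology}"
  assumes \<phi>: "square_integrable (\<L> \<Otimes>\<^sub>M M) \<phi>" and D\<phi>: "square_integrable (\<L> \<Otimes>\<^sub>M (M \<Otimes>\<^sub>M M)) (process_diff \<phi>)"
    and \<psi>: "square_integrable (\<L> \<Otimes>\<^sub>M M) \<psi>" and D\<psi>: "square_integrable (\<L> \<Otimes>\<^sub>M (M \<Otimes>\<^sub>M M)) (process_diff \<psi>)"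
    and g: "is_divergence \<phi> g" and h: "is_divergence \<psi> h"
  shows "(LINT \<eta>|\<L>. g \<eta> \<bullet> h \<eta>) = (LINT z|(\<L> \<Otimes>\<^sub>M M). \<phi> z \<bullet> \<psi> z) +
    (LINT w|(\<L> \<Otimes>\<^sub>M (M \<Otimes>\<^sub>M M)). process_diff \<phi> w \<bullet> process_diff \<psi> (swap_points w))"
proof -
  let ?Q = "\<L> \<Otimes>\<^sub>M (M \<Otimes>\<^sub>M M)"
  obtain E where "poisson_law_exhausted M \<L> E" using exhausted by blast
  then interpret poisson_law_exhausted M \<L> E .
  obtain \<theta> g' where \<theta>: "\<And>n. admissible n (real n) (\<theta> n)" "\<And>n. square_integrable ?Q (process_diff (shifted (\<theta> n)))"
    and lim\<theta>: "(\<lambda>n. sqnorm (\<L> \<Otimes>\<^sub>M M) (\<lambda>z. shifted (\<theta> n) z - \<phi> z)) \<longlonglongrightarrow> 0"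
    "(\<lambda>n. sqnorm ?Q (\<lambda>w. process_diff (shifted (\<theta> n)) w - process_diff \<phi> w)) \<longlonglongrightarrow> 0"
    "(\<lambda>n. sqnorm \<L> (\<lambda>\<eta>. compensated M (\<theta> n) \<eta> - g' \<eta>)) \<longlonglongrightarrow> 0"
    and g': "is_divergence \<phi> g'"
    by (rule divergence_approximation[OF \<phi> D\<phi>]) (rule that)
  obtain \<xi> h' where \<xi>: "\<And>n. admissible n (real n) (\<xi> n)" "\<And>n. square_integrable ?Q (process_diff (shifted (\<xi> n)))"
    and lim\<xi>: "(\<lambda>n. sqnorm (\<L> \<Otimes>\<^sub>M M) (\<lambda>z. shifted (\<xi> n) z - \<psi> z)) \<longlonglongrightarrow> 0"
    "(\<lambda>n. sqnorm ?Q (\<lambda>w. process_diff (shifted (\<xi> n)) w - process_diff \<psi> w)) \<longlonglongrightarrow> 0"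
    "(\<lambda>n. sqnorm \<L> (\<lambda>\<eta>. compensated M (\<xi> n) \<eta> - h' \<eta>)) \<longlonglongrightarrow> 0"
    and h': "is_divergence \<psi> h'"
    by (rule divergence_approximation[OF \<psi> D\<psi>]) (rule that)
  have sq: "square_integrable \<L> g" "square_integrable \<L> h" "square_integrable \<L> g'" "square_integrable \<L> h'"
    using g h g' h' by (auto simp: is_divergence_def)
  have "(\<lambda>n. LINT \<eta>|\<L>. compensated M (\<theta> n) \<eta> \<bullet> compensated M (\<xi> n) \<eta>) \<longlonglongrightarrow> (LINT \<eta>|\<L>. g' \<eta> \<bullet> h' \<eta>)"
    by (rule integral_inner_tendsto[OF _ sq(3) _ sq(4) lim\<theta>(3) lim\<xi>(3)])
      (rule square_integrable_compensated[OF \<theta>(1)], rule square_integrable_compensated[OF \<xi>(1)])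
  moreover have "(\<lambda>n. (LINT z|(\<L> \<Otimes>\<^sub>M M). shifted (\<theta> n) z \<bullet> shifted (\<xi> n) z) +
      (LINT w|?Q. process_diff (shifted (\<theta> n)) w \<bullet> process_diff (shifted (\<xi> n)) (swap_points w))) \<longlonglongrightarrow>
      (LINT z|(\<L> \<Otimes>\<^sub>M M). \<phi> z \<bullet> \<psi> z) + (LINT w|?Q. process_diff \<phi> w \<bullet> process_diff \<psi> (swap_points w))"
  proof (intro tendsto_add)
    show "(\<lambda>n. LINT z|(\<L> \<Otimes>\<^sub>M M). shifted (\<theta> n) z \<bullet> shifted (\<xi> n) z) \<longlonglongrightarrow> (LINT z|(\<L> \<Otimes>\<^sub>M M). \<phi> z \<bullet> \<psi> z)"
      by (rule integral_inner_tendsto[OF square_integrable_shifted[OF \<theta>(1)] \<phi>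
            square_integrable_shifted[OF \<xi>(1)] \<psi> lim\<theta>(1) lim\<xi>(1)])
    have "(\<lambda>n. sqnorm ?Q (\<lambda>w. process_diff (shifted (\<xi> n)) (swap_points w) - process_diff \<psi> (swap_points w))) \<longlonglongrightarrow> 0"
      using lim\<xi>(2) square_integrable_swap(2)[OF square_integrable_diff[OF \<xi>(2) D\<psi>]] by simp
    then show "(\<lambda>n. LINT w|?Q. process_diff (shifted (\<theta> n)) w \<bullet> process_diff (shifted (\<xi> n)) (swap_points w)) \<longlonglongrightarrow>
        (LINT w|?Q. process_diff \<phi> w \<bullet> process_diff \<psi> (swap_points w))"
      by (rule integral_inner_tendsto[OF \<theta>(2) D\<phi> square_integrable_swap(1)[OF \<xi>(2)]
            square_integrable_swap(1)[OF D\<psi>] lim\<theta>(2)])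
  qed
  ultimately have "(LINT \<eta>|\<L>. g' \<eta> \<bullet> h' \<eta>) = (LINT z|(\<L> \<Otimes>\<^sub>M M). \<phi> z \<bullet> \<psi> z) +
      (LINT w|?Q. process_diff \<phi> w \<bullet> process_diff \<psi> (swap_points w))"
    unfolding isometry_admissible[OF \<theta>(1) \<xi>(1)] by (rule LIMSEQ_unique)
  moreover have "(LINT \<eta>|\<L>. g \<eta> \<bullet> h \<eta>) = (LINT \<eta>|\<L>. g' \<eta> \<bullet> h' \<eta>)"
  proof (rule integral_cong_AE)
    show "AE \<eta> in \<L>. g \<eta> \<bullet> h \<eta> = g' \<eta> \<bullet> h' \<eta>"
      using divergence_unique[OF g g'] divergence_unique[OF h h'] by eventually_elim simp
  qed (use sq[THEN square_integrableD(1)] in measurable)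
  ultimately show ?thesis by simp
qed

lemma divergence_diff:
  fixes \<phi> \<psi> :: "'e measure \<times> 'e \<Rightarrow> 'h::{real_inner,banach,second_countable_topology}"
  assumes g: "is_divergence \<phi> g" and h: "is_divergence \<psi> h"
    and \<phi>: "square_integrable (\<L> \<Otimes>\<^sub>M M) \<phi>" and \<psi>: "square_integrable (\<L> \<Otimes>\<^sub>M M) \<psi>"
  shows "is_divergence (\<lambda>z. \<phi> z - \<psi> z) (\<lambda>\<eta>. g \<eta> - h \<eta>)"
  unfolding is_divergence_def
proof (intro conjI allI impI)
  have sq: "square_integrable \<L> g" "square_integrable \<L> h"
    using g h by (auto simp: is_divergence_def)
  then show "square_integrable \<L> (\<lambda>\<eta>. g \<eta> - h \<eta>)" by (rule square_integrable_diff)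
  fix f :: "'e measure \<Rightarrow> 'h"
  assume f: "square_integrable \<L> f" "square_integrable (\<L> \<Otimes>\<^sub>M M) (point_diff f)"
  have "(LINT z|(\<L> \<Otimes>\<^sub>M M). point_diff f z \<bullet> (\<phi> z - \<psi> z)) =
      (LINT z|(\<L> \<Otimes>\<^sub>M M). point_diff f z \<bullet> \<phi> z) - (LINT z|(\<L> \<Otimes>\<^sub>M M). point_diff f z \<bullet> \<psi> z)"
    unfolding inner_diff_right
    by (rule Bochner_Integration.integral_diff[OF square_integrable_inner[OF f(2) \<phi>] square_integrable_inner[OF f(2) \<psi>]])
  also have "\<dots> = (LINT \<eta>|\<L>. f \<eta> \<bullet> g \<eta>) - (LINT \<eta>|\<L>. f \<eta> \<bullet> h \<eta>)"
    unfolding is_divergenceD(2)[OF g f] is_divergenceD(2)[OF h f] ..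
  also have "\<dots> = (LINT \<eta>|\<L>. f \<eta> \<bullet> (g \<eta> - h \<eta>))"
    unfolding inner_diff_right
    by (rule Bochner_Integration.integral_diff[OF square_integrable_inner[OF f(1) sq(1)] square_integrable_inner[OF f(1) sq(2)], symmetric])
  finally show "(LINT z|(\<L> \<Otimes>\<^sub>M M). point_diff f z \<bullet> (\<phi> z - \<psi> z)) = (LINT \<eta>|\<L>. f \<eta> \<bullet> (g \<eta> - h \<eta>))" .
qed

lemma divergence_bound:
  fixes \<phi> :: "'e measure \<times> 'e \<Rightarrow> 'h::{real_inner,banach,second_countable_topology}"
  assumes \<phi>: "square_integrable (\<L> \<Otimes>\<^sub>M M) \<phi>" and D\<phi>: "square_integrable (\<L> \<Otimes>\<^sub>M (M \<Otimes>\<^sub>M M)) (process_diff \<phi>)"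
    and g: "is_divergence \<phi> g"
  shows "sqnorm \<L> g \<le> sqnorm (\<L> \<Otimes>\<^sub>M M) \<phi> + sqnorm (\<L> \<Otimes>\<^sub>M (M \<Otimes>\<^sub>M M)) (process_diff \<phi>)"
  using divergence_isometry[OF \<phi> D\<phi> \<phi> D\<phi> g g] Cauchy_Schwarz_integral[OF D\<phi> square_integrable_swap(1)[OF D\<phi>]]
  unfolding square_integrable_swap(2)[OF D\<phi>] by (simp add: sqnorm_eq_inner[symmetric])

end

section \<open>Functionals of the Poisson random measure\<close>

lemma Lp_space_2: "Lp_space 2 Q = {f. square_integrable Q f}"
  by (simp add: Lp_space_def square_integrable_def)

lemma Lp_norm_2: "Lp_norm 2 Q f = sqrt (sqnorm Q f)"
  by (simp add: Lp_norm_def sqnorm_def powr_half_sqrt)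

lemma sobolev_norm_2_sq:
  "sobolev_norm 2 P M N F powr 2 = sqnorm P F + sqnorm (P \<Otimes>\<^sub>M M) (diff_op P M N F)"
  by (simp add: sobolev_norm_def Lp_norm_2 powr_half_sqrt)

lemma restr_to_subalg_completion_AE:
  assumes sub: "subalgebra P V" and A: "A \<in> sets (completion (restr_to_subalg P V))"
  shows "\<exists>S\<in>sets V. AE x in P. x \<in> A \<longleftrightarrow> x \<in> S"
proof -
  obtain S N N' where A_eq: "A = S \<union> N" and N: "N \<subseteq> N'" "N' \<in> null_sets (restr_to_subalg P V)"
    and S: "S \<in> sets (restr_to_subalg P V)"
    using A by (rule sets_completionE)
  have "N' \<in> null_sets P"
    using N(2) sub by (auto simp: null_sets_def sets_restr_to_subalg emeasure_restr_to_subalg subalgebra_def)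
  then have "AE x in P. x \<notin> N'" by (rule AE_not_in)
  then have "AE x in P. x \<in> A \<longleftrightarrow> x \<in> S"
    by eventually_elim (use A_eq N(1) in auto)
  moreover have "S \<in> sets V" using S sub by (simp add: sets_restr_to_subalg)
  ultimately show ?thesis by blast
qed

text \<open>
  Independence is available for families indexed by natural numbers only, so the finite index set has to
  be enumerated.
\<close>

lemma prm_joint_law:
  fixes Q :: "'i set" and k :: "'i \<Rightarrow> nat"
  assumes "prob_space P" and prm: "poisson_random_measure P M N"
    and Q: "finite Q" "disjoint_family_on C Q"
    and C: "\<And>J. J \<in> Q \<Longrightarrow> C J \<in> sets M \<and> emeasure M (C J) < \<infinity>"
  shows "measure P {\<omega> \<in> space P. \<forall>J\<in>Q. emeasure (N \<omega>) (C J) = of_nat (k J)} =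
    (\<Prod>J\<in>Q. exp (- measure M (C J)) * measure M (C J) ^ k J / fact (k J))"
proof (cases "Q = {}")
  case True
  interpret prob_space P by fact
  show ?thesis using True by (simp add: prob_space)
next
  case False
  interpret prob_space P by fact
  obtain h where h: "bij_betw h Q {0..<card Q}" using ex_bij_betw_finite_nat[OF Q(1)] by blast
  define g where "g = inv_into Q h"
  have g: "bij_betw g {0..<card Q} Q" unfolding g_def by (rule bij_betw_inv_into[OF h])
  let ?I = "{0..<card Q}"
  have gQ: "g i \<in> Q" if "i \<in> ?I" for i using g that by (auto simp: bij_betw_def)
  have g_img: "g ` ?I = Q" and g_inj: "inj_on g ?I" using g by (auto simp: bij_betw_def)
  have "disjoint_family_on (\<lambda>i. C (g i)) ?I"
    unfolding disjoint_family_on_def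
  proof (intro ballI impI)
    fix i j assume "i \<in> ?I" "j \<in> ?I" "i \<noteq> j"
    then have "g i \<noteq> g j" using inj_onD[OF g_inj, of i j] by blast
    then show "C (g i) \<inter> C (g j) = {}"
      using Q(2) gQ[OF \<open>i \<in> ?I\<close>] gQ[OF \<open>j \<in> ?I\<close>] unfolding disjoint_family_on_def by blast
  qed
  then have ind: "indep_vars (\<lambda>_. borel) (\<lambda>i \<omega>. emeasure (N \<omega>) (C (g i))) ?I"
    using prm C gQ unfolding poisson_random_measure_def by (auto simp: image_subset_iff)
  have "measure P {\<omega> \<in> space P. \<forall>J\<in>Q. emeasure (N \<omega>) (C J) = of_nat (k J)} =
      measure P (\<Inter>i\<in>?I. (\<lambda>\<omega>. emeasure (N \<omega>) (C (g i))) -` {of_nat (k (g i))} \<inter> space P)"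
  proof (rule arg_cong[where f="measure P"])
    have "?I \<noteq> {}" using False Q(1) by (simp add: card_gt_0_iff)
    moreover have "(\<forall>J\<in>Q. emeasure (N \<omega>) (C J) = of_nat (k J)) \<longleftrightarrow>
        (\<forall>i\<in>?I. emeasure (N \<omega>) (C (g i)) = of_nat (k (g i)))" for \<omega>
      by (rule bij_betw_ball[OF g])
    ultimately show "{\<omega> \<in> space P. \<forall>J\<in>Q. emeasure (N \<omega>) (C J) = of_nat (k J)} =
      (\<Inter>i\<in>?I. (\<lambda>\<omega>. emeasure (N \<omega>) (C (g i))) -` {of_nat (k (g i))} \<inter> space P)"
      by auto
  qed
  also have "\<dots> = (\<Prod>i\<in>?I. measure P ((\<lambda>\<omega>. emeasure (N \<omega>) (C (g i))) -` {of_nat (k (g i))} \<inter> space P))"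
    using False Q(1) by (intro indep_varsD[OF ind]) (auto simp: card_gt_0_iff)
  also have "\<dots> = (\<Prod>i\<in>?I. exp (- measure M (C (g i))) * measure M (C (g i)) ^ k (g i) / fact (k (g i)))"
  proof (intro prod.cong refl)
    fix i assume "i \<in> ?I"
    then have "C (g i) \<in> sets M" "emeasure M (C (g i)) < \<infinity>" using C gQ by auto
    then have "measure P {\<omega> \<in> space P. emeasure (N \<omega>) (C (g i)) = of_nat (k (g i))} =
        exp (- measure M (C (g i))) * measure M (C (g i)) ^ k (g i) / fact (k (g i))"
      using prm unfolding poisson_random_measure_def by blast
    moreover have "{\<omega> \<in> space P. emeasure (N \<omega>) (C (g i)) = of_nat (k (g i))} =
        (\<lambda>\<omega>. emeasure (N \<omega>) (C (g i))) -` {of_nat (k (g i))} \<inter> space P" by auto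
    ultimately show "measure P ((\<lambda>\<omega>. emeasure (N \<omega>) (C (g i))) -` {of_nat (k (g i))} \<inter> space P) =
        exp (- measure M (C (g i))) * measure M (C (g i)) ^ k (g i) / fact (k (g i))" by simp
  qed
  also have "\<dots> = (\<Prod>J\<in>Q. exp (- measure M (C J)) * measure M (C J) ^ k J / fact (k J))"
    by (rule prod.reindex_bij_betw[OF g])
  finally show ?thesis .
qed

locale poisson_functionals = M: sigma_finite_measure M + P: prob_space P
  for M :: "'e measure" and P :: "'w measure" +
  fixes N :: "'w \<Rightarrow> 'e measure"
  assumes prm: "poisson_random_measure P M N"
    and generated: "sets P = sets (completion (restr_to_subalg P (vimage_algebra (space P) N (config_space M))))"
begin

definition law :: "'e measure measure" where
  "law = distr P (config_space M) N"

lemma N_measurable [measurable]: "N \<in> P \<rightarrow>\<^sub>M config_space M"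
  using prm by (simp add: poisson_random_measure_def)

sublocale L: poisson_law M law
proof -
  interpret L: prob_space law unfolding law_def by (rule P.prob_space_distr) measurable
  show "poisson_law M law"
  proof
    show "sets law = sets (config_space M)" by (simp add: law_def)
    fix Q :: "'e set set set" and C k
    assume Q: "finite Q" "disjoint_family_on C Q" "\<And>J. J \<in> Q \<Longrightarrow> C J \<in> sets M \<and> emeasure M (C J) < \<infinity>"
    let ?V = "{\<eta> \<in> config_set M. \<forall>J\<in>Q. emeasure \<eta> (C J) = of_nat (k J)}"
    have "?V = {\<eta> \<in> config_set M. \<forall>(B, k)\<in>(\<lambda>J. (C J, k J)) ` Q. emeasure \<eta> B = of_nat k}" by auto
    also have "\<dots> \<in> sets (config_space M)" using Q by (intro count_event_in_sets) auto
    finally have "measure law ?V = measure P (N -` ?V \<inter> space P)"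
      unfolding law_def by (rule measure_distr[OF N_measurable])
    also have "N -` ?V \<inter> space P = {\<omega> \<in> space P. \<forall>J\<in>Q. emeasure (N \<omega>) (C J) = of_nat (k J)}"
      using measurable_space[OF N_measurable] by auto
    also have "measure P \<dots> = (\<Prod>J\<in>Q. exp (- measure M (C J)) * measure M (C J) ^ k J / fact (k J))"
      by (rule prm_joint_law[OF P.prob_space_axioms prm Q])
    finally show "measure law ?V = (\<Prod>J\<in>Q. exp (- measure M (C J)) * measure M (C J) ^ k J / fact (k J))" .
  qed
qed

sublocale PM: pair_sigma_finite P M ..

sublocale PMM: pair_sigma_finite P "M \<Otimes>\<^sub>M M" ..

text \<open>
  This is where it matters that the randomness comes from \<open>N\<close> alone: the events are the completion of
  the \<open>\<sigma>\<close>-algebra generated by \<open>N\<close>.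
\<close>

lemma events_AE_eq_vimage:
  assumes "A \<in> sets P"
  shows "\<exists>B\<in>sets (config_space M). AE \<omega> in P. \<omega> \<in> A \<longleftrightarrow> N \<omega> \<in> B"
proof -
  let ?V = "vimage_algebra (space P) N (config_space M)"
  have N_space: "N \<in> space P \<rightarrow> space (config_space M)"
    using measurable_space[OF N_measurable] by blast
  have sub: "subalgebra P ?V"
    unfolding subalgebra_def using measurable_sets[OF N_measurable]
    by (auto simp: sets_vimage_algebra2[OF N_space])
  obtain S where S: "S \<in> sets ?V" "AE \<omega> in P. \<omega> \<in> A \<longleftrightarrow> \<omega> \<in> S"
    using restr_to_subalg_completion_AE[OF sub] assms generated by blast
  then obtain B where B: "B \<in> sets (config_space M)" "S = N -` B \<inter> space P"
    by (auto simp: sets_vimage_algebra2[OF N_space])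
  have "AE \<omega> in P. \<omega> \<in> A \<longleftrightarrow> N \<omega> \<in> B"
    using S(2) AE_space by eventually_elim (use B in auto)
  then show ?thesis using B(1) by blast
qed

definition on_config :: "'w \<times> 'b \<Rightarrow> 'e measure \<times> 'b" where
  "on_config = (\<lambda>(\<omega>, x). (N \<omega>, x))"

lemma on_config_measurable [measurable]: "on_config \<in> P \<Otimes>\<^sub>M K \<rightarrow>\<^sub>M config_space M \<Otimes>\<^sub>M K"
  unfolding on_config_def by measurable

lemma distr_on_config:
  assumes "sigma_finite_measure K"
  shows "distr (P \<Otimes>\<^sub>M K) (config_space M \<Otimes>\<^sub>M K) on_config = law \<Otimes>\<^sub>M K"
  using pair_measure_distr[OF N_measurable, of "\<lambda>x. x" K K] assms
  by (simp add: law_def on_config_def distr_id)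

text \<open>
  Being a preimage up to a null set is stable under complements and countable unions, and it passes to
  rectangles by \<open>events_AE_eq_vimage\<close>.
\<close>

lemma product_events_AE_eq_vimage:
  assumes "A \<in> sets (P \<Otimes>\<^sub>M M)"
  shows "\<exists>B\<in>sets (config_space M \<Otimes>\<^sub>M M). AE z in P \<Otimes>\<^sub>M M. z \<in> A \<longleftrightarrow> on_config z \<in> B"
  using assms unfolding sets_pair_measure[of P M]
proof induct
  case (Basic A)
  then obtain a b where A: "A = a \<times> b" "a \<in> sets P" "b \<in> sets M" by blast
  obtain B where B: "B \<in> sets (config_space M)" "AE \<omega> in P. \<omega> \<in> a \<longleftrightarrow> N \<omega> \<in> B"
    using events_AE_eq_vimage[OF A(2)] by blast
  have "AE z in P \<Otimes>\<^sub>M M. z \<in> A \<longleftrightarrow> on_config z \<in> B \<times> b"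
    using AE_pair_fst[OF M.sigma_finite_measure_axioms B(2)]
    by eventually_elim (auto simp: A on_config_def)
  then show ?case using B(1) A(3) by blast
next
  case Empty
  then show ?case by (intro bexI[of _ "{}"]) auto
next
  case (Compl A)
  then obtain B where B: "B \<in> sets (config_space M \<Otimes>\<^sub>M M)" "AE z in P \<Otimes>\<^sub>M M. z \<in> A \<longleftrightarrow> on_config z \<in> B"
    by blast
  have "AE z in P \<Otimes>\<^sub>M M. z \<in> space P \<times> space M - A \<longleftrightarrow> on_config z \<in> space (config_space M \<Otimes>\<^sub>M M) - B"
    using B(2) AE_space
    by eventually_elim (use measurable_space[OF on_config_measurable[of M]] in \<open>auto simp: space_pair_measure\<close>)
  then show ?case using B(1) by blast
next
  case (Union A)
  then have "\<forall>i. \<exists>B. B \<in> sets (config_space M \<Otimes>\<^sub>M M) \<and> (AE z in P \<Otimes>\<^sub>M M. z \<in> A i \<longleftrightarrow> on_config z \<in> B)"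
    by blast
  from choice[OF this] obtain B where B: "\<And>i::nat. B i \<in> sets (config_space M \<Otimes>\<^sub>M M)"
    "\<And>i. AE z in P \<Otimes>\<^sub>M M. z \<in> A i \<longleftrightarrow> on_config z \<in> B i"
    by blast
  have "AE z in P \<Otimes>\<^sub>M M. \<forall>i. z \<in> A i \<longleftrightarrow> on_config z \<in> B i"
    using B(2) by (simp add: AE_all_countable)
  then have "AE z in P \<Otimes>\<^sub>M M. z \<in> (\<Union>i. A i) \<longleftrightarrow> on_config z \<in> (\<Union>i. B i)"
    by eventually_elim auto
  then show ?case using B(1) by (intro bexI[of _ "\<Union>i. B i"]) auto
qed

subsection \<open>Transport between the probability space and the law\<close>

lemma transport:
  fixes u :: "'e measure \<times> 'b \<Rightarrow> 'h::{real_inner,banach,second_countable_topology}"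
  assumes K: "sigma_finite_measure K" and u: "u \<in> borel_measurable (config_space M \<Otimes>\<^sub>M K)"
  shows "integrable (P \<Otimes>\<^sub>M K) (\<lambda>z. u (on_config z)) \<longleftrightarrow> integrable (law \<Otimes>\<^sub>M K) u"
    "(LINT z|(P \<Otimes>\<^sub>M K). u (on_config z)) = (LINT z|(law \<Otimes>\<^sub>M K). u z)"
    "square_integrable (P \<Otimes>\<^sub>M K) (\<lambda>z. u (on_config z)) \<longleftrightarrow> square_integrable (law \<Otimes>\<^sub>M K) u"
    "sqnorm (P \<Otimes>\<^sub>M K) (\<lambda>z. u (on_config z)) = sqnorm (law \<Otimes>\<^sub>M K) u"
proof -
  note u [measurable]
  have [measurable]: "u \<in> borel_measurable (law \<Otimes>\<^sub>M K)" by (simp add: L.measurable_law_pair_iff u)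
  show "integrable (P \<Otimes>\<^sub>M K) (\<lambda>z. u (on_config z)) \<longleftrightarrow> integrable (law \<Otimes>\<^sub>M K) u"
    "(LINT z|(P \<Otimes>\<^sub>M K). u (on_config z)) = (LINT z|(law \<Otimes>\<^sub>M K). u z)"
    unfolding distr_on_config[OF K, symmetric]
    by (subst integrable_distr_eq integral_distr; simp)+
  have *: "integrable (P \<Otimes>\<^sub>M K) (\<lambda>z. (norm (u (on_config z)))\<^sup>2) \<longleftrightarrow> integrable (law \<Otimes>\<^sub>M K) (\<lambda>z. (norm (u z))\<^sup>2)"
    "(LINT z|(P \<Otimes>\<^sub>M K). (norm (u (on_config z)))\<^sup>2) = (LINT z|(law \<Otimes>\<^sub>M K). (norm (u z))\<^sup>2)"
    unfolding distr_on_config[OF K, symmetric]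
    by (subst integrable_distr_eq integral_distr; simp)+
  show "square_integrable (P \<Otimes>\<^sub>M K) (\<lambda>z. u (on_config z)) \<longleftrightarrow> square_integrable (law \<Otimes>\<^sub>M K) u"
    unfolding square_integrable_def * by simp
  show "sqnorm (P \<Otimes>\<^sub>M K) (\<lambda>z. u (on_config z)) = sqnorm (law \<Otimes>\<^sub>M K) u"
    unfolding sqnorm_def * ..
qed

lemma transport_law:
  fixes u :: "'e measure \<Rightarrow> 'h::{real_inner,banach,second_countable_topology}"
  assumes u: "u \<in> borel_measurable (config_space M)"
  shows "(LINT \<omega>|P. u (N \<omega>)) = (LINT \<eta>|law. u \<eta>)"
    "square_integrable P (\<lambda>\<omega>. u (N \<omega>)) \<longleftrightarrow> square_integrable law u"
    "sqnorm P (\<lambda>\<omega>. u (N \<omega>)) = sqnorm law u"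
proof -
  note u [measurable]
  have [measurable]: "u \<in> borel_measurable law" by (simp add: L.measurable_law_iff u)
  show "(LINT \<omega>|P. u (N \<omega>)) = (LINT \<eta>|law. u \<eta>)"
    unfolding law_def by (subst integral_distr; simp)
  have *: "integrable P (\<lambda>\<omega>. (norm (u (N \<omega>)))\<^sup>2) \<longleftrightarrow> integrable law (\<lambda>\<eta>. (norm (u \<eta>))\<^sup>2)"
    "(LINT \<omega>|P. (norm (u (N \<omega>)))\<^sup>2) = (LINT \<eta>|law. (norm (u \<eta>))\<^sup>2)"
    unfolding law_def by (subst integrable_distr_eq integral_distr; simp)+
  show "square_integrable P (\<lambda>\<omega>. u (N \<omega>)) \<longleftrightarrow> square_integrable law u"
    unfolding square_integrable_def * by simp
  show "sqnorm P (\<lambda>\<omega>. u (N \<omega>)) = sqnorm law u"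
    unfolding sqnorm_def * ..
qed

lemma AE_law_pair:
  assumes K: "sigma_finite_measure K" and "AE z in law \<Otimes>\<^sub>M K. Q z"
  shows "AE z in P \<Otimes>\<^sub>M K. Q (on_config z)"
  using assms(2) unfolding distr_on_config[OF K, symmetric] by (rule AE_distrD[OF on_config_measurable])

lemma AE_law_eqI:
  fixes f g :: "'e measure \<Rightarrow> 'h::{banach,second_countable_topology}"
  assumes [measurable]: "f \<in> borel_measurable (config_space M)" "g \<in> borel_measurable (config_space M)"
    and eq: "AE \<omega> in P. f (N \<omega>) = g (N \<omega>)"
  shows "AE \<eta> in law. f \<eta> = g \<eta>"
proof -
  have "(\<lambda>\<eta>. f \<eta> - g \<eta>) -` {0} \<inter> space (config_space M) \<in> sets (config_space M)"
    by (rule measurable_sets[where A=borel]) auto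
  also have "(\<lambda>\<eta>. f \<eta> - g \<eta>) -` {0} \<inter> space (config_space M) = {\<eta> \<in> space (config_space M). f \<eta> = g \<eta>}"
    by auto
  finally show ?thesis
    unfolding law_def using eq by (subst AE_distr_iff[OF N_measurable])
qed

lemma point_diff_AE_cong:
  assumes "AE \<eta> in law. f \<eta> = g \<eta>"
  shows "AE z in law \<Otimes>\<^sub>M M. point_diff f z = point_diff g z"
  using L.AE_add_dirac[OF assms] AE_pair_fst[OF M.sigma_finite_measure_axioms assms]
  by eventually_elim (simp add: point_diff_def split_beta)

subsection \<open>Representatives\<close>

definition representative ::
    "('w \<Rightarrow> 'h::{real_inner,banach,second_countable_topology}) \<Rightarrow> 'e measure \<Rightarrow> 'h" where
  "representative F = (SOME f. f \<in> borel_measurable (config_space M) \<and> (AE \<omega> in P. F \<omega> = f (N \<omega>)))"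

definition process_representative ::
    "('w \<times> 'e \<Rightarrow> 'h::{real_inner,banach,second_countable_topology}) \<Rightarrow> 'e measure \<times> 'e \<Rightarrow> 'h" where
  "process_representative \<Phi> = (SOME \<phi>. \<phi> \<in> borel_measurable (config_space M \<Otimes>\<^sub>M M) \<and>
     (AE (\<omega>, y) in P \<Otimes>\<^sub>M M. \<Phi> (\<omega>, y) = \<phi> (N \<omega>, y)))"

lemma representative:
  assumes "F \<in> borel_measurable P"
  shows "representative F \<in> borel_measurable (config_space M)" "AE \<omega> in P. F \<omega> = representative F (N \<omega>)"
proof -
  obtain f where "f \<in> borel_measurable (config_space M)" "AE \<omega> in P. F \<omega> = f (N \<omega>)"
    by (rule AE_factorization[OF N_measurable events_AE_eq_vimage assms])
  then have "\<exists>f. f \<in> borel_measurable (config_space M) \<and> (AE \<omega> in P. F \<omega> = f (N \<omega>))" by blast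
  from someI_ex[OF this]
  show "representative F \<in> borel_measurable (config_space M)" "AE \<omega> in P. F \<omega> = representative F (N \<omega>)"
    unfolding representative_def by auto
qed

lemma process_representative:
  assumes "\<Phi> \<in> borel_measurable (P \<Otimes>\<^sub>M M)"
  shows "process_representative \<Phi> \<in> borel_measurable (config_space M \<Otimes>\<^sub>M M)"
    "AE z in P \<Otimes>\<^sub>M M. \<Phi> z = process_representative \<Phi> (on_config z)"
proof -
  obtain \<phi> where "\<phi> \<in> borel_measurable (config_space M \<Otimes>\<^sub>M M)" "AE z in P \<Otimes>\<^sub>M M. \<Phi> z = \<phi> (on_config z)"
    by (rule AE_factorization[OF on_config_measurable product_events_AE_eq_vimage assms])
  then have "\<exists>\<phi>. \<phi> \<in> borel_measurable (config_space M \<Otimes>\<^sub>M M) \<and>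
      (AE (\<omega>, y) in P \<Otimes>\<^sub>M M. \<Phi> (\<omega>, y) = \<phi> (N \<omega>, y))"
    by (auto simp: on_config_def split_beta')
  from someI_ex[OF this]
  show "process_representative \<Phi> \<in> borel_measurable (config_space M \<Otimes>\<^sub>M M)"
    "AE z in P \<Otimes>\<^sub>M M. \<Phi> z = process_representative \<Phi> (on_config z)"
    unfolding process_representative_def by (auto simp: on_config_def split_beta')
qed

lemma diff_op_eq: "diff_op P M N F = (\<lambda>z. point_diff (representative F) (on_config z))"
  by (simp add: fun_eq_iff diff_op_def representative_def point_diff_def on_config_def Let_def)

lemma diff_op_process_eq: "diff_op_process P M N \<Phi> = (\<lambda>w. process_diff (process_representative \<Phi>) (on_config w))"
  by (simp add: fun_eq_iff diff_op_process_def process_representative_def process_diff_def on_config_def Let_def)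

lemma point_diff_config_measurable:
  fixes f :: "_ \<Rightarrow> 'h::{real_normed_vector,second_countable_topology}"
  assumes "f \<in> borel_measurable (config_space M)"
  shows "point_diff f \<in> borel_measurable (config_space M \<Otimes>\<^sub>M M)"
  using L.measurable_point_diff[OF assms] by (simp add: L.measurable_law_pair_iff)

lemma process_diff_config_measurable:
  fixes \<phi> :: "_ \<Rightarrow> 'h::{real_normed_vector,second_countable_topology}"
  assumes "\<phi> \<in> borel_measurable (config_space M \<Otimes>\<^sub>M M)"
  shows "process_diff \<phi> \<in> borel_measurable (config_space M \<Otimes>\<^sub>M (M \<Otimes>\<^sub>M M))"
  using L.measurable_process_diff[OF assms] by (simp add: L.measurable_law_pair_iff)

text \<open>
  Two representatives of \<open>F\<close> agree almost everywhere with respect to the law of \<open>N\<close>, hence also after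
  adding a point.
\<close>

lemma diff_op_AE:
  fixes F :: "'w \<Rightarrow> 'h::{real_inner,banach,second_countable_topology}"
  assumes F: "F \<in> borel_measurable P" and f: "f \<in> borel_measurable (config_space M)"
    and eq: "AE \<omega> in P. F \<omega> = f (N \<omega>)"
  shows "diff_op P M N F \<in> borel_measurable (P \<Otimes>\<^sub>M M)"
    "AE z in P \<Otimes>\<^sub>M M. diff_op P M N F z = point_diff f (on_config z)"
proof -
  note rep = representative[OF F]
  show "diff_op P M N F \<in> borel_measurable (P \<Otimes>\<^sub>M M)"
    unfolding diff_op_eq by (rule measurable_compose[OF on_config_measurable point_diff_config_measurable[OF rep(1)]])
  have "AE \<omega> in P. representative F (N \<omega>) = f (N \<omega>)"
    using rep(2) eq by eventually_elim simp
  then have "AE \<eta> in law. representative F \<eta> = f \<eta>"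
    by (rule AE_law_eqI[OF rep(1) f])
  from AE_law_pair[OF M.sigma_finite_measure_axioms point_diff_AE_cong[OF this]]
  show "AE z in P \<Otimes>\<^sub>M M. diff_op P M N F z = point_diff f (on_config z)"
    unfolding diff_op_eq .
qed

lemma sobolev_iff:
  fixes F :: "'w \<Rightarrow> 'h::{real_inner,banach,second_countable_topology}"
  assumes F: "F \<in> borel_measurable P" and f: "f \<in> borel_measurable (config_space M)"
    and eq: "AE \<omega> in P. F \<omega> = f (N \<omega>)"
  shows "F \<in> sobolev 2 P M N \<longleftrightarrow> square_integrable law f \<and> square_integrable (law \<Otimes>\<^sub>M M) (point_diff f)"
    "sobolev_norm 2 P M N F powr 2 = sqnorm law f + sqnorm (law \<Otimes>\<^sub>M M) (point_diff f)"
proof -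
  note d = diff_op_AE[OF F f eq] and d1 = point_diff_config_measurable[OF f]
  have fN: "(\<lambda>\<omega>. f (N \<omega>)) \<in> borel_measurable P" using f by measurable
  have dN: "(\<lambda>z. point_diff f (on_config z)) \<in> borel_measurable (P \<Otimes>\<^sub>M M)"
    by (rule measurable_compose[OF on_config_measurable d1])
  note c1 = square_integrable_cong_AE[OF F fN eq] and c2 = square_integrable_cong_AE[OF d(1) dN d(2)]
  note t1 = transport_law(2,3)[OF f] and t2 = transport(3,4)[OF M.sigma_finite_measure_axioms d1]
  show "F \<in> sobolev 2 P M N \<longleftrightarrow> square_integrable law f \<and> square_integrable (law \<Otimes>\<^sub>M M) (point_diff f)"
    by (simp add: sobolev_def Lp_space_2 c1(1) c2(1) t1(1) t2(1))
  show "sobolev_norm 2 P M N F powr 2 = sqnorm law f + sqnorm (law \<Otimes>\<^sub>M M) (point_diff f)"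
    unfolding sobolev_norm_2_sq c1(2) c2(2) t1(2) t2(2) ..
qed

text \<open>
  Passing to representatives identifies the adjoint of the difference operator on \<open>\<Omega>\<close> with the one on
  the space of configurations. Every square-integrable \<open>f\<close> with square-integrable difference is the
  representative of an element of the Sobolev space, and vice versa.
\<close>

lemma KS_adjoint_iff:
  fixes \<Phi> :: "'w \<times> 'e \<Rightarrow> 'h::{real_inner,banach,second_countable_topology}"
  assumes \<Phi>: "\<Phi> \<in> borel_measurable (P \<Otimes>\<^sub>M M)" and \<phi>: "\<phi> \<in> borel_measurable (config_space M \<Otimes>\<^sub>M M)"
    and \<Phi>_eq: "AE z in P \<Otimes>\<^sub>M M. \<Phi> z = \<phi> (on_config z)"
    and G: "G \<in> borel_measurable P" and g: "g \<in> borel_measurable (config_space M)"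
    and G_eq: "AE \<omega> in P. G \<omega> = g (N \<omega>)"
  shows "KS_adjoint P M N \<Phi> G \<longleftrightarrow> L.is_divergence \<phi> g"
proof -
  note [measurable] = \<Phi> \<phi> G g
  have sq: "G \<in> Lp_space 2 P \<longleftrightarrow> square_integrable law g"
    using square_integrable_cong_AE(1)[OF G _ G_eq] transport_law(2)[OF g] by (simp add: Lp_space_2)
  have eqs: "(LINT z|(P \<Otimes>\<^sub>M M). diff_op P M N F z \<bullet> \<Phi> z) = (LINT z|(law \<Otimes>\<^sub>M M). point_diff f z \<bullet> \<phi> z)"
    "(LINT \<omega>|P. F \<omega> \<bullet> G \<omega>) = (LINT \<eta>|law. f \<eta> \<bullet> g \<eta>)"
    if F [measurable]: "F \<in> borel_measurable P" and f [measurable]: "f \<in> borel_measurable (config_space M)"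
      and eq: "AE \<omega> in P. F \<omega> = f (N \<omega>)" for F f
  proof -
    note d = diff_op_AE[OF F f eq] and [measurable] = point_diff_config_measurable[OF f]
    have "(LINT z|(P \<Otimes>\<^sub>M M). diff_op P M N F z \<bullet> \<Phi> z) = (LINT z|(P \<Otimes>\<^sub>M M). (\<lambda>z. point_diff f z \<bullet> \<phi> z) (on_config z))"
    proof (rule integral_cong_AE)
      show "AE z in P \<Otimes>\<^sub>M M. diff_op P M N F z \<bullet> \<Phi> z = point_diff f (on_config z) \<bullet> \<phi> (on_config z)"
        using d(2) \<Phi>_eq by eventually_elim simp
    qed (use d(1) in measurable)
    also have "\<dots> = (LINT z|(law \<Otimes>\<^sub>M M). point_diff f z \<bullet> \<phi> z)"
      by (rule transport(2)[OF M.sigma_finite_measure_axioms]) measurable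
    finally show "(LINT z|(P \<Otimes>\<^sub>M M). diff_op P M N F z \<bullet> \<Phi> z) = (LINT z|(law \<Otimes>\<^sub>M M). point_diff f z \<bullet> \<phi> z)" .
    have "(LINT \<omega>|P. F \<omega> \<bullet> G \<omega>) = (LINT \<omega>|P. (\<lambda>\<eta>. f \<eta> \<bullet> g \<eta>) (N \<omega>))"
    proof (rule integral_cong_AE)
      show "AE \<omega> in P. F \<omega> \<bullet> G \<omega> = f (N \<omega>) \<bullet> g (N \<omega>)"
        using eq G_eq by eventually_elim simp
    qed measurable
    also have "\<dots> = (LINT \<eta>|law. f \<eta> \<bullet> g \<eta>)"
      by (rule transport_law(1)) measurable
    finally show "(LINT \<omega>|P. F \<omega> \<bullet> G \<omega>) = (LINT \<eta>|law. f \<eta> \<bullet> g \<eta>)" .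
  qed
  show ?thesis
  proof
    assume adj: "KS_adjoint P M N \<Phi> G"
    show "L.is_divergence \<phi> g"
      unfolding L.is_divergence_def
    proof (intro conjI allI impI)
      show "square_integrable law g" using adj sq by (simp add: KS_adjoint_def)
      fix f :: "'e measure \<Rightarrow> 'h"
      assume f: "square_integrable law f" "square_integrable (law \<Otimes>\<^sub>M M) (point_diff f)"
      have f_meas [measurable]: "f \<in> borel_measurable (config_space M)"
        using square_integrableD(1)[OF f(1)] by (simp add: L.measurable_law_iff)
      have F: "(\<lambda>\<omega>. f (N \<omega>)) \<in> borel_measurable P" by measurable
      have "(\<lambda>\<omega>. f (N \<omega>)) \<in> sobolev 2 P M N"
        using sobolev_iff(1)[OF F f_meas] f by simp
      then show "(LINT z|(law \<Otimes>\<^sub>M M). point_diff f z \<bullet> \<phi> z) = (LINT \<eta>|law. f \<eta> \<bullet> g \<eta>)"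
        using adj eqs[OF F f_meas] by (simp add: KS_adjoint_def)
    qed
  next
    assume div: "L.is_divergence \<phi> g"
    show "KS_adjoint P M N \<Phi> G"
      unfolding KS_adjoint_def
    proof (intro conjI ballI)
      show "G \<in> Lp_space 2 P" using sq L.is_divergenceD(1)[OF div] by simp
      fix F :: "'w \<Rightarrow> 'h" assume F: "F \<in> sobolev 2 P M N"
      then have F_meas: "F \<in> borel_measurable P" by (simp add: sobolev_def Lp_space_def)
      note rep = representative[OF F_meas]
      show "(LINT z|(P \<Otimes>\<^sub>M M). diff_op P M N F z \<bullet> \<Phi> z) = (LINT \<omega>|P. F \<omega> \<bullet> G \<omega>)"
        unfolding eqs[OF F_meas rep]
        using F sobolev_iff(1)[OF F_meas rep] by (intro L.is_divergenceD(2)[OF div]) auto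
    qed
  qed
qed

subsection \<open>The space of square-integrable Sobolev-valued functions\<close>

text \<open>
  By Fubini's theorem a representative of the process yields representatives of almost all of its
  sections, so that \<open>I y\<close> is the squared Sobolev norm of the section at \<open>y\<close>, the value \<open>\<infinity>\<close> indicating that
  the section is not in the Sobolev space. Integrating over \<open>y\<close> gives the squared graph norm of the
  process, which therefore is the squared norm in \<open>L\<^sup>2(E; \<D>\<^bsub>1,2\<^esub>(H))\<close>.
\<close>

lemma slice_energy:
  fixes \<Phi> :: "'w \<times> 'e \<Rightarrow> 'h::{real_inner,banach,second_countable_topology}"
  assumes \<Phi>: "\<Phi> \<in> borel_measurable (P \<Otimes>\<^sub>M M)" and \<phi>: "\<phi> \<in> borel_measurable (config_space M \<Otimes>\<^sub>M M)"
    and eq: "AE z in P \<Otimes>\<^sub>M M. \<Phi> z = \<phi> (on_config z)"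
  defines "I \<equiv> \<lambda>y. (\<integral>\<^sup>+ \<eta>. ennreal ((norm (\<phi> (\<eta>, y)))\<^sup>2) \<partial>law) +
    (\<integral>\<^sup>+ z. ennreal ((norm (process_diff \<phi> (fst z, snd z, y)))\<^sup>2) \<partial>(law \<Otimes>\<^sub>M M))"
  shows "AE y in M. ((\<lambda>\<omega>. \<Phi> (\<omega>, y)) \<in> sobolev 2 P M N \<longleftrightarrow> I y < \<infinity>) \<and>
      (I y < \<infinity> \<longrightarrow> ennreal (sobolev_norm 2 P M N (\<lambda>\<omega>. \<Phi> (\<omega>, y)) powr 2) = I y)"
    and "(\<integral>\<^sup>+ y. I y \<partial>M) = (\<integral>\<^sup>+ z. ennreal ((norm (\<phi> z))\<^sup>2) \<partial>(law \<Otimes>\<^sub>M M)) +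
      (\<integral>\<^sup>+ w. ennreal ((norm (process_diff \<phi> w))\<^sup>2) \<partial>(law \<Otimes>\<^sub>M (M \<Otimes>\<^sub>M M)))"
    and "I \<in> borel_measurable M"
proof -
  note [measurable] = \<Phi> \<phi> process_diff_config_measurable[OF \<phi>]
  have swap_law: "AE y in M. AE \<omega> in P. \<Phi> (\<omega>, y) = \<phi> (N \<omega>, y)"
  proof -
    have "AE \<omega> in P. AE y in M. \<Phi> (\<omega>, y) = \<phi> (N \<omega>, y)"
      using PM.AE_pair[OF eq] by (simp add: on_config_def)
    then show ?thesis by (subst (asm) PM.AE_commute) auto
  qed
  show "AE y in M. ((\<lambda>\<omega>. \<Phi> (\<omega>, y)) \<in> sobolev 2 P M N \<longleftrightarrow> I y < \<infinity>) \<and>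
      (I y < \<infinity> \<longrightarrow> ennreal (sobolev_norm 2 P M N (\<lambda>\<omega>. \<Phi> (\<omega>, y)) powr 2) = I y)"
    using swap_law AE_space
  proof eventually_elim
    fix y assume y: "AE \<omega> in P. \<Phi> (\<omega>, y) = \<phi> (N \<omega>, y)" "y \<in> space M"
    let ?f = "\<lambda>\<eta>. \<phi> (\<eta>, y)"
    have F: "(\<lambda>\<omega>. \<Phi> (\<omega>, y)) \<in> borel_measurable P" and f: "?f \<in> borel_measurable (config_space M)"
      using y(2) by measurable
    have d1: "point_diff ?f = (\<lambda>z. process_diff \<phi> (fst z, snd z, y))" by (auto simp: point_diff_def process_diff_def)
    have fl: "?f \<in> borel_measurable law" "point_diff ?f \<in> borel_measurable (law \<Otimes>\<^sub>M M)"
      using f L.measurable_point_diff[OF f] by (simp_all add: L.measurable_law_iff)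
    have I_eq: "I y = (\<integral>\<^sup>+ \<eta>. ennreal ((norm (?f \<eta>))\<^sup>2) \<partial>law) + (\<integral>\<^sup>+ z. ennreal ((norm (point_diff ?f z))\<^sup>2) \<partial>(law \<Otimes>\<^sub>M M))"
      by (simp add: I_def d1)
    have iff: "I y < \<infinity> \<longleftrightarrow> square_integrable law ?f \<and> square_integrable (law \<Otimes>\<^sub>M M) (point_diff ?f)"
      unfolding I_eq square_integrable_iff_nn[OF fl(1)] square_integrable_iff_nn[OF fl(2)] by simp
    note s = sobolev_iff[OF F f y(1)]
    show "((\<lambda>\<omega>. \<Phi> (\<omega>, y)) \<in> sobolev 2 P M N \<longleftrightarrow> I y < \<infinity>) \<and>
      (I y < \<infinity> \<longrightarrow> ennreal (sobolev_norm 2 P M N (\<lambda>\<omega>. \<Phi> (\<omega>, y)) powr 2) = I y)"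
    proof (intro conjI impI)
      show "(\<lambda>\<omega>. \<Phi> (\<omega>, y)) \<in> sobolev 2 P M N \<longleftrightarrow> I y < \<infinity>" unfolding s(1) iff ..
      assume "I y < \<infinity>"
      then have "square_integrable law ?f" "square_integrable (law \<Otimes>\<^sub>M M) (point_diff ?f)" using iff by auto
      then show "ennreal (sobolev_norm 2 P M N (\<lambda>\<omega>. \<Phi> (\<omega>, y)) powr 2) = I y"
        unfolding s(2) I_eq by (simp add: nn_integral_sqnorm)
    qed
  qed
  have m1: "(\<lambda>y. \<integral>\<^sup>+ \<eta>. ennreal ((norm (\<phi> (\<eta>, y)))\<^sup>2) \<partial>law) \<in> borel_measurable M" by measurable
  have m2: "(\<lambda>y. \<integral>\<^sup>+ z. ennreal ((norm (process_diff \<phi> (fst z, snd z, y)))\<^sup>2) \<partial>(law \<Otimes>\<^sub>M M)) \<in> borel_measurable M"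
    by measurable
  show "I \<in> borel_measurable M" unfolding I_def using m1 m2 by measurable
  have "(\<integral>\<^sup>+ y. I y \<partial>M) = (\<integral>\<^sup>+ y. \<integral>\<^sup>+ \<eta>. ennreal ((norm (\<phi> (\<eta>, y)))\<^sup>2) \<partial>law \<partial>M) +
      (\<integral>\<^sup>+ y. \<integral>\<^sup>+ z. ennreal ((norm (process_diff \<phi> (fst z, snd z, y)))\<^sup>2) \<partial>(law \<Otimes>\<^sub>M M) \<partial>M)"
    unfolding I_def by (rule nn_integral_add[OF m1 m2])
  also have "(\<integral>\<^sup>+ y. \<integral>\<^sup>+ \<eta>. ennreal ((norm (\<phi> (\<eta>, y)))\<^sup>2) \<partial>law \<partial>M) =
      (\<integral>\<^sup>+ z. ennreal ((norm (\<phi> z))\<^sup>2) \<partial>(law \<Otimes>\<^sub>M M))"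
    by (rule L.LM.nn_integral_snd[where f="\<lambda>z. ennreal ((norm (\<phi> z))\<^sup>2)"]) measurable
  also have "(\<integral>\<^sup>+ y. \<integral>\<^sup>+ z. ennreal ((norm (process_diff \<phi> (fst z, snd z, y)))\<^sup>2) \<partial>(law \<Otimes>\<^sub>M M) \<partial>M) =
      (\<integral>\<^sup>+ w. ennreal ((norm (process_diff \<phi> w))\<^sup>2) \<partial>(law \<Otimes>\<^sub>M (M \<Otimes>\<^sub>M M)))"
  proof -
    let ?e = "\<lambda>w. ennreal ((norm (process_diff \<phi> w))\<^sup>2)"
    have "(\<integral>\<^sup>+ y. \<integral>\<^sup>+ z. ?e (fst z, snd z, y) \<partial>(law \<Otimes>\<^sub>M M) \<partial>M) =
        (\<integral>\<^sup>+ y. \<integral>\<^sup>+ \<eta>. \<integral>\<^sup>+ x. ?e (\<eta>, x, y) \<partial>M \<partial>law \<partial>M)"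
    proof (intro nn_integral_cong)
      fix y assume "y \<in> space M"
      then have "(\<lambda>z. ?e (fst z, snd z, y)) \<in> borel_measurable (law \<Otimes>\<^sub>M M)" by measurable
      from M.nn_integral_fst[OF this]
      show "(\<integral>\<^sup>+ z. ?e (fst z, snd z, y) \<partial>(law \<Otimes>\<^sub>M M)) = (\<integral>\<^sup>+ \<eta>. \<integral>\<^sup>+ x. ?e (\<eta>, x, y) \<partial>M \<partial>law)" by simp
    qed
    also have "\<dots> = (\<integral>\<^sup>+ \<eta>. \<integral>\<^sup>+ y. \<integral>\<^sup>+ x. ?e (\<eta>, x, y) \<partial>M \<partial>M \<partial>law)"
      by (rule L.LM.Fubini') measurable
    also have "\<dots> = (\<integral>\<^sup>+ \<eta>. \<integral>\<^sup>+ p. ?e (\<eta>, p) \<partial>(M \<Otimes>\<^sub>M M) \<partial>law)"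
    proof (intro nn_integral_cong)
      fix \<eta> assume "\<eta> \<in> space law"
      then have [measurable]: "(\<lambda>p. process_diff \<phi> (\<eta>, p)) \<in> borel_measurable (M \<Otimes>\<^sub>M M)"
        using measurable_Pair2[OF process_diff_config_measurable[OF \<phi>], of \<eta>] by simp
      have "(\<lambda>p. ?e (\<eta>, p)) \<in> borel_measurable (M \<Otimes>\<^sub>M M)" by measurable
      from L.MM.nn_integral_snd[OF this]
      show "(\<integral>\<^sup>+ y. \<integral>\<^sup>+ x. ?e (\<eta>, x, y) \<partial>M \<partial>M) = (\<integral>\<^sup>+ p. ?e (\<eta>, p) \<partial>(M \<Otimes>\<^sub>M M))" .
    qed
    also have "\<dots> = (\<integral>\<^sup>+ w. ?e w \<partial>(law \<Otimes>\<^sub>M (M \<Otimes>\<^sub>M M)))"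
      by (rule L.MM.P.nn_integral_fst) measurable
    finally show ?thesis .
  qed
  finally show "(\<integral>\<^sup>+ y. I y \<partial>M) = (\<integral>\<^sup>+ z. ennreal ((norm (\<phi> z))\<^sup>2) \<partial>(law \<Otimes>\<^sub>M M)) +
      (\<integral>\<^sup>+ w. ennreal ((norm (process_diff \<phi> w))\<^sup>2) \<partial>(law \<Otimes>\<^sub>M (M \<Otimes>\<^sub>M M)))" .
qed

lemma L2_sobolev_square_integrable:
  fixes \<Phi> :: "'w \<times> 'e \<Rightarrow> 'h::{real_inner,banach,second_countable_topology}"
  assumes \<Phi>: "\<Phi> \<in> L2_sobolev P M N" and \<phi>: "\<phi> \<in> borel_measurable (config_space M \<Otimes>\<^sub>M M)"
    and eq: "AE z in P \<Otimes>\<^sub>M M. \<Phi> z = \<phi> (on_config z)"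
  shows "square_integrable (law \<Otimes>\<^sub>M M) \<phi>" "square_integrable (law \<Otimes>\<^sub>M (M \<Otimes>\<^sub>M M)) (process_diff \<phi>)"
proof -
  have meas: "\<Phi> \<in> borel_measurable (P \<Otimes>\<^sub>M M)"
    and AE_sob: "AE y in M. (\<lambda>\<omega>. \<Phi> (\<omega>, y)) \<in> sobolev 2 P M N"
    and fin: "(\<integral>\<^sup>+ y. ennreal (sobolev_norm 2 P M N (\<lambda>\<omega>. \<Phi> (\<omega>, y)) powr 2) \<partial>M) < \<infinity>"
    using \<Phi> by (auto simp: L2_sobolev_def bochner_Lp_def)
  note s = slice_energy[OF meas \<phi> eq]
  have \<phi>': "\<phi> \<in> borel_measurable (law \<Otimes>\<^sub>M M)" "process_diff \<phi> \<in> borel_measurable (law \<Otimes>\<^sub>M (M \<Otimes>\<^sub>M M))"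
    using \<phi> L.measurable_process_diff[OF \<phi>] by (simp_all add: L.measurable_law_pair_iff)
  have "(\<integral>\<^sup>+ z. ennreal ((norm (\<phi> z))\<^sup>2) \<partial>(law \<Otimes>\<^sub>M M)) +
      (\<integral>\<^sup>+ w. ennreal ((norm (process_diff \<phi> w))\<^sup>2) \<partial>(law \<Otimes>\<^sub>M (M \<Otimes>\<^sub>M M))) =
      (\<integral>\<^sup>+ y. ennreal (sobolev_norm 2 P M N (\<lambda>\<omega>. \<Phi> (\<omega>, y)) powr 2) \<partial>M)"
    unfolding s(2)[symmetric]
    by (intro nn_integral_cong_AE, use s(1) AE_sob in eventually_elim) simp
  then show "square_integrable (law \<Otimes>\<^sub>M M) \<phi>" "square_integrable (law \<Otimes>\<^sub>M (M \<Otimes>\<^sub>M M)) (process_diff \<phi>)"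
    unfolding square_integrable_iff_nn[OF \<phi>'(1)] square_integrable_iff_nn[OF \<phi>'(2)]
    using fin by (metis ennreal_add_less_top infinity_ennreal_def)+
qed

lemma L2_sobolev_norm_eq:
  fixes \<Phi> :: "'w \<times> 'e \<Rightarrow> 'h::{real_inner,banach,second_countable_topology}"
  assumes meas: "\<Phi> \<in> borel_measurable (P \<Otimes>\<^sub>M M)"
    and eq: "AE z in P \<Otimes>\<^sub>M M. \<Phi> z = \<phi> (on_config z)"
    and sq: "square_integrable (law \<Otimes>\<^sub>M M) \<phi>" "square_integrable (law \<Otimes>\<^sub>M (M \<Otimes>\<^sub>M M)) (process_diff \<phi>)"
  shows "L2_sobolev_norm P M N \<Phi> =
    sqrt (sqnorm (law \<Otimes>\<^sub>M M) \<phi> + sqnorm (law \<Otimes>\<^sub>M (M \<Otimes>\<^sub>M M)) (process_diff \<phi>))"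
proof -
  have \<phi>: "\<phi> \<in> borel_measurable (config_space M \<Otimes>\<^sub>M M)"
    using square_integrableD(1)[OF sq(1)] by (simp add: L.measurable_law_pair_iff)
  note s = slice_energy[OF meas \<phi> eq]
  let ?I = "\<lambda>y. (\<integral>\<^sup>+ \<eta>. ennreal ((norm (\<phi> (\<eta>, y)))\<^sup>2) \<partial>law) +
    (\<integral>\<^sup>+ z. ennreal ((norm (process_diff \<phi> (fst z, snd z, y)))\<^sup>2) \<partial>(law \<Otimes>\<^sub>M M))"
  have I: "(\<integral>\<^sup>+ y. ?I y \<partial>M) = ennreal (sqnorm (law \<Otimes>\<^sub>M M) \<phi> + sqnorm (law \<Otimes>\<^sub>M (M \<Otimes>\<^sub>M M)) (process_diff \<phi>))"
    unfolding s(2) using sq by (simp add: nn_integral_sqnorm)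
  then have "AE y in M. ?I y \<noteq> \<infinity>"
    by (intro nn_integral_PInf_AE s(3)) simp
  with s(1) have "AE y in M. ennreal (sobolev_norm 2 P M N (\<lambda>\<omega>. \<Phi> (\<omega>, y)) powr 2) = ?I y"
    by eventually_elim (simp add: less_top)
  then have "(\<integral>\<^sup>+ y. ennreal (sobolev_norm 2 P M N (\<lambda>\<omega>. \<Phi> (\<omega>, y)) powr 2) \<partial>M) = (\<integral>\<^sup>+ y. ?I y \<partial>M)"
    by (rule nn_integral_cong_AE)
  then show ?thesis
    unfolding L2_sobolev_norm_def bochner_norm_def I
    by (simp add: powr_half_sqrt ennreal_plus[symmetric] del: ennreal_plus)
qed

subsection \<open>The Kabanov--Skorohod integral\<close>

lemma KS_integral_divergence:
  fixes \<Phi> :: "'w \<times> 'e \<Rightarrow> 'h::{real_inner,banach,second_countable_topology}"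
  assumes \<Phi>: "\<Phi> \<in> L2_sobolev P M N"
  obtains g where "g \<in> borel_measurable (config_space M)" "AE \<omega> in P. KS_integral P M N \<Phi> \<omega> = g (N \<omega>)"
    "L.is_divergence (process_representative \<Phi>) g"
    "KS_integral P M N \<Phi> \<in> borel_measurable P" "\<Phi> \<in> KS_dom P M N"
proof -
  have \<Phi>_meas: "\<Phi> \<in> borel_measurable (P \<Otimes>\<^sub>M M)" using \<Phi> by (simp add: L2_sobolev_def)
  note rep = process_representative[OF \<Phi>_meas]
  note sq = L2_sobolev_square_integrable[OF \<Phi> rep]
  obtain d where d: "L.is_divergence (process_representative \<Phi>) d"
    by (rule L.divergence_exists[OF sq])
  have d_meas [measurable]: "d \<in> borel_measurable (config_space M)"
    using square_integrableD(1)[OF L.is_divergenceD(1)[OF d]] by (simp add: L.measurable_law_iff)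
  have "KS_adjoint P M N \<Phi> (\<lambda>\<omega>. d (N \<omega>))"
    using KS_adjoint_iff[OF \<Phi>_meas rep _ d_meas, of "\<lambda>\<omega>. d (N \<omega>)"] d by auto
  then have ex: "\<exists>G. KS_adjoint P M N \<Phi> G" by blast
  have adj: "KS_adjoint P M N \<Phi> (KS_integral P M N \<Phi>)"
    unfolding KS_integral_def by (rule someI_ex[OF ex])
  have meas: "KS_integral P M N \<Phi> \<in> borel_measurable P"
    using adj by (simp add: KS_adjoint_def Lp_space_def)
  note r = representative[OF meas]
  have "(\<lambda>z. process_representative \<Phi> (on_config z)) \<in> borel_measurable (P \<Otimes>\<^sub>M M)"
    by (rule measurable_compose[OF on_config_measurable rep(1)])
  then have "square_integrable (P \<Otimes>\<^sub>M M) \<Phi>"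
    using square_integrable_cong_AE(1)[OF \<Phi>_meas _ rep(2)] transport(3)[OF M.sigma_finite_measure_axioms rep(1)] sq(1)
    by simp
  then have "\<Phi> \<in> KS_dom P M N" using ex by (simp add: KS_dom_def Lp_space_2)
  then show ?thesis
    using that[OF r _ meas] KS_adjoint_iff[OF \<Phi>_meas rep meas r] adj by blast
qed

text \<open>
  The Kabanov--Skorohod integral is linear up to null sets and does not increase norms, by
  \<open>divergence_bound\<close> applied to a difference of two processes.
\<close>

lemma KS_integral_continuous:
  "continuous_wrt (L2_sobolev P M N :: ('w \<times> 'e \<Rightarrow> 'h::{real_inner,banach,second_countable_topology}) set)
     (L2_sobolev_norm P M N) (Lp_norm 2 P) (KS_integral P M N)"
proof -
  have contraction: "Lp_norm 2 P (KS_integral P M N \<Psi> - KS_integral P M N \<Phi>) \<le> L2_sobolev_norm P M N (\<Psi> - \<Phi>)"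
    if \<Phi>: "\<Phi> \<in> L2_sobolev P M N" and \<Psi>: "\<Psi> \<in> L2_sobolev P M N" for \<Phi> \<Psi> :: "'w \<times> 'e \<Rightarrow> 'h"
  proof -
    have meas [measurable]: "\<Phi> \<in> borel_measurable (P \<Otimes>\<^sub>M M)" "\<Psi> \<in> borel_measurable (P \<Otimes>\<^sub>M M)"
      using \<Phi> \<Psi> by (simp_all add: L2_sobolev_def)
    let ?\<phi> = "process_representative \<Phi>" and ?\<psi> = "process_representative \<Psi>"
    note rep1 = process_representative[OF meas(1)] and rep2 = process_representative[OF meas(2)]
    note sq1 = L2_sobolev_square_integrable[OF \<Phi> rep1] and sq2 = L2_sobolev_square_integrable[OF \<Psi> rep2]
    obtain g where g: "g \<in> borel_measurable (config_space M)" "AE \<omega> in P. KS_integral P M N \<Phi> \<omega> = g (N \<omega>)"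
      "L.is_divergence ?\<phi> g" "KS_integral P M N \<Phi> \<in> borel_measurable P"
      using KS_integral_divergence[OF \<Phi>] by blast
    obtain h where h: "h \<in> borel_measurable (config_space M)" "AE \<omega> in P. KS_integral P M N \<Psi> \<omega> = h (N \<omega>)"
      "L.is_divergence ?\<psi> h" "KS_integral P M N \<Psi> \<in> borel_measurable P"
      using KS_integral_divergence[OF \<Psi>] by blast
    let ?\<chi> = "\<lambda>z. ?\<psi> z - ?\<phi> z"
    have \<chi>: "square_integrable (law \<Otimes>\<^sub>M M) ?\<chi>" by (rule square_integrable_diff[OF sq2(1) sq1(1)])
    have "process_diff ?\<chi> = (\<lambda>w. process_diff ?\<psi> w - process_diff ?\<phi> w)" by (auto simp: process_diff_def)
    then have D\<chi>: "square_integrable (law \<Otimes>\<^sub>M (M \<Otimes>\<^sub>M M)) (process_diff ?\<chi>)"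
      using square_integrable_diff[OF sq2(2) sq1(2)] by simp
    have div: "L.is_divergence ?\<chi> (\<lambda>\<eta>. h \<eta> - g \<eta>)"
      by (rule L.divergence_diff[OF h(3) g(3) sq2(1) sq1(1)])
    have "sqnorm P (KS_integral P M N \<Psi> - KS_integral P M N \<Phi>) = sqnorm P (\<lambda>\<omega>. (\<lambda>\<eta>. h \<eta> - g \<eta>) (N \<omega>))"
    proof (rule square_integrable_cong_AE(2))
      show "KS_integral P M N \<Psi> - KS_integral P M N \<Phi> \<in> borel_measurable P"
        using g(4) h(4) by (simp add: fun_diff_def)
      show "(\<lambda>\<omega>. (\<lambda>\<eta>. h \<eta> - g \<eta>) (N \<omega>)) \<in> borel_measurable P"
        using g(1) h(1) by measurable
      show "AE \<omega> in P. (KS_integral P M N \<Psi> - KS_integral P M N \<Phi>) \<omega> = (\<lambda>\<eta>. h \<eta> - g \<eta>) (N \<omega>)"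
        using g(2) h(2) by eventually_elim simp
    qed
    also have "\<dots> = sqnorm law (\<lambda>\<eta>. h \<eta> - g \<eta>)"
      using g(1) h(1) by (intro transport_law(3)) measurable
    also have "\<dots> \<le> sqnorm (law \<Otimes>\<^sub>M M) ?\<chi> + sqnorm (law \<Otimes>\<^sub>M (M \<Otimes>\<^sub>M M)) (process_diff ?\<chi>)"
      by (rule L.divergence_bound[OF \<chi> D\<chi> div])
    finally have "Lp_norm 2 P (KS_integral P M N \<Psi> - KS_integral P M N \<Phi>) \<le>
        sqrt (sqnorm (law \<Otimes>\<^sub>M M) ?\<chi> + sqnorm (law \<Otimes>\<^sub>M (M \<Otimes>\<^sub>M M)) (process_diff ?\<chi>))"
      unfolding Lp_norm_2 by (rule real_sqrt_le_mono)
    also have "\<dots> = L2_sobolev_norm P M N (\<Psi> - \<Phi>)"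
    proof (rule L2_sobolev_norm_eq[symmetric, OF _ _ \<chi> D\<chi>])
      show "\<Psi> - \<Phi> \<in> borel_measurable (P \<Otimes>\<^sub>M M)" using meas by (simp add: fun_diff_def)
      show "AE z in P \<Otimes>\<^sub>M M. (\<Psi> - \<Phi>) z = ?\<psi> (on_config z) - ?\<phi> (on_config z)"
        using rep1(2) rep2(2) by eventually_elim simp
    qed
    finally show ?thesis .
  qed
  show ?thesis
    unfolding continuous_wrt_def
  proof (intro ballI allI impI)
    fix \<Phi> :: "'w \<times> 'e \<Rightarrow> 'h" and \<epsilon> :: real
    assume "\<Phi> \<in> L2_sobolev P M N" "\<epsilon> > 0"
    then show "\<exists>d>0. \<forall>\<Psi>\<in>L2_sobolev P M N. L2_sobolev_norm P M N (\<Psi> - \<Phi>) < d \<longrightarrow>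
        Lp_norm 2 P (KS_integral P M N \<Psi> - KS_integral P M N \<Phi>) < \<epsilon>"
      using contraction by (intro exI[of _ \<epsilon>]) (auto intro: le_less_trans)
  qed
qed

lemma KS_integral_isometry:
  fixes \<Phi> \<Psi> :: "'w \<times> 'e \<Rightarrow> 'h::{real_inner,banach,second_countable_topology}"
  assumes \<Phi>: "\<Phi> \<in> L2_sobolev P M N" and \<Psi>: "\<Psi> \<in> L2_sobolev P M N"
  defines "D \<equiv> diff_op_process P M N :: ('w \<times> 'e \<Rightarrow> 'h) \<Rightarrow> 'w \<times> 'e \<times> 'e \<Rightarrow> 'h"
  shows "integrable (P \<Otimes>\<^sub>M (M \<Otimes>\<^sub>M M)) (\<lambda>(\<omega>, x, y). D \<Phi> (\<omega>, x, y) \<bullet> D \<Psi> (\<omega>, y, x))"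
    and "(LINT \<omega>|P. KS_integral P M N \<Phi> \<omega> \<bullet> KS_integral P M N \<Psi> \<omega>) =
      (LINT \<omega>|P. LINT x|M. \<Phi> (\<omega>, x) \<bullet> \<Psi> (\<omega>, x)) +
      (LINT \<omega>|P. LINT x|M. LINT y|M. D \<Phi> (\<omega>, x, y) \<bullet> D \<Psi> (\<omega>, y, x))"
proof -
  have meas [measurable]: "\<Phi> \<in> borel_measurable (P \<Otimes>\<^sub>M M)" "\<Psi> \<in> borel_measurable (P \<Otimes>\<^sub>M M)"
    using \<Phi> \<Psi> by (simp_all add: L2_sobolev_def)
  define \<phi> where "\<phi> = process_representative \<Phi>"
  define \<psi> where "\<psi> = process_representative \<Psi>"
  note rep1 = process_representative[OF meas(1), folded \<phi>_def]
    and rep2 = process_representative[OF meas(2), folded \<psi>_def]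
  note sq1 = L2_sobolev_square_integrable[OF \<Phi> rep1] and sq2 = L2_sobolev_square_integrable[OF \<Psi> rep2]
  note [measurable] = rep1(1) rep2(1) process_diff_config_measurable[OF rep1(1)] process_diff_config_measurable[OF rep2(1)]
  have MM: "sigma_finite_measure (M \<Otimes>\<^sub>M M)" by (rule L.MM.P.sigma_finite_measure_axioms)
  obtain g where g: "g \<in> borel_measurable (config_space M)" "AE \<omega> in P. KS_integral P M N \<Phi> \<omega> = g (N \<omega>)"
    "L.is_divergence \<phi> g" "KS_integral P M N \<Phi> \<in> borel_measurable P"
    using KS_integral_divergence[OF \<Phi>] unfolding \<phi>_def by blast
  obtain h where h: "h \<in> borel_measurable (config_space M)" "AE \<omega> in P. KS_integral P M N \<Psi> \<omega> = h (N \<omega>)"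
    "L.is_divergence \<psi> h" "KS_integral P M N \<Psi> \<in> borel_measurable P"
    using KS_integral_divergence[OF \<Psi>] unfolding \<psi>_def by blast
  have swap_meas [measurable]: "swap_points \<in> config_space M \<Otimes>\<^sub>M (M \<Otimes>\<^sub>M M) \<rightarrow>\<^sub>M config_space M \<Otimes>\<^sub>M (M \<Otimes>\<^sub>M M)"
    unfolding swap_points_def by measurable
  define v where "v = (\<lambda>w. process_diff \<phi> w \<bullet> process_diff \<psi> (swap_points w))"
  have v_meas [measurable]: "v \<in> borel_measurable (config_space M \<Otimes>\<^sub>M (M \<Otimes>\<^sub>M M))" unfolding v_def by measurable
  have v_eq: "(\<lambda>(\<omega>, x, y). D \<Phi> (\<omega>, x, y) \<bullet> D \<Psi> (\<omega>, y, x)) = (\<lambda>w. v (on_config w))"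
    by (simp add: fun_eq_iff D_def diff_op_process_eq v_def \<phi>_def \<psi>_def on_config_def swap_points_def)
  have "integrable (law \<Otimes>\<^sub>M (M \<Otimes>\<^sub>M M)) v"
    unfolding v_def by (rule square_integrable_inner[OF sq1(2) L.square_integrable_swap(1)[OF sq2(2)]])
  then have v_int: "integrable (P \<Otimes>\<^sub>M (M \<Otimes>\<^sub>M M)) (\<lambda>w. v (on_config w))"
    using transport(1)[OF MM v_meas] by simp
  then show "integrable (P \<Otimes>\<^sub>M (M \<Otimes>\<^sub>M M)) (\<lambda>(\<omega>, x, y). D \<Phi> (\<omega>, x, y) \<bullet> D \<Psi> (\<omega>, y, x))"
    unfolding v_eq .
  have "(LINT \<omega>|P. KS_integral P M N \<Phi> \<omega> \<bullet> KS_integral P M N \<Psi> \<omega>) = (LINT \<omega>|P. (\<lambda>\<eta>. g \<eta> \<bullet> h \<eta>) (N \<omega>))"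
  proof (rule integral_cong_AE)
    show "AE \<omega> in P. KS_integral P M N \<Phi> \<omega> \<bullet> KS_integral P M N \<Psi> \<omega> = (\<lambda>\<eta>. g \<eta> \<bullet> h \<eta>) (N \<omega>)"
      using g(2) h(2) by eventually_elim simp
  qed (use g(1,4) h(1,4) in measurable)
  also have "\<dots> = (LINT \<eta>|law. g \<eta> \<bullet> h \<eta>)"
    using g(1) h(1) by (intro transport_law(1)) measurable
  also have "\<dots> = (LINT z|(law \<Otimes>\<^sub>M M). \<phi> z \<bullet> \<psi> z) + (LINT w|(law \<Otimes>\<^sub>M (M \<Otimes>\<^sub>M M)). v w)"
    unfolding v_def by (rule L.divergence_isometry[OF sq1 sq2 g(3) h(3)])
  also have "(LINT z|(law \<Otimes>\<^sub>M M). \<phi> z \<bullet> \<psi> z) = (LINT \<omega>|P. LINT x|M. \<Phi> (\<omega>, x) \<bullet> \<Psi> (\<omega>, x))"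
  proof -
    let ?u = "\<lambda>z. \<phi> z \<bullet> \<psi> z"
    have u_meas: "?u \<in> borel_measurable (config_space M \<Otimes>\<^sub>M M)" by measurable
    have AE: "AE z in P \<Otimes>\<^sub>M M. ?u (on_config z) = \<Phi> z \<bullet> \<Psi> z"
      using rep1(2) rep2(2) by eventually_elim simp
    have m: "(\<lambda>z. ?u (on_config z)) \<in> borel_measurable (P \<Otimes>\<^sub>M M)" "(\<lambda>z. \<Phi> z \<bullet> \<Psi> z) \<in> borel_measurable (P \<Otimes>\<^sub>M M)"
      by measurable
    have "integrable (P \<Otimes>\<^sub>M M) (\<lambda>z. ?u (on_config z))"
      unfolding transport(1)[OF M.sigma_finite_measure_axioms u_meas] by (rule square_integrable_inner[OF sq1(1) sq2(1)])
    then have int: "integrable (P \<Otimes>\<^sub>M M) (\<lambda>z. \<Phi> z \<bullet> \<Psi> z)"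
      unfolding integrable_cong_AE[OF m AE] .
    have "(LINT z|(law \<Otimes>\<^sub>M M). ?u z) = (LINT z|(P \<Otimes>\<^sub>M M). ?u (on_config z))"
      by (rule transport(2)[OF M.sigma_finite_measure_axioms u_meas, symmetric])
    also have "\<dots> = (LINT z|(P \<Otimes>\<^sub>M M). \<Phi> z \<bullet> \<Psi> z)" by (rule integral_cong_AE[OF m AE])
    also have "\<dots> = (LINT \<omega>|P. LINT x|M. \<Phi> (\<omega>, x) \<bullet> \<Psi> (\<omega>, x))"
      by (rule PM.integral_fst'[OF int, symmetric])
    finally show ?thesis .
  qed
  also have "(LINT w|(law \<Otimes>\<^sub>M (M \<Otimes>\<^sub>M M)). v w) =
      (LINT \<omega>|P. LINT x|M. LINT y|M. D \<Phi> (\<omega>, x, y) \<bullet> D \<Psi> (\<omega>, y, x))"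
  proof -
    have "(LINT w|(law \<Otimes>\<^sub>M (M \<Otimes>\<^sub>M M)). v w) = (LINT w|(P \<Otimes>\<^sub>M (M \<Otimes>\<^sub>M M)). v (on_config w))"
      by (rule transport(2)[OF MM v_meas, symmetric])
    also have "\<dots> = (LINT \<omega>|P. LINT p|(M \<Otimes>\<^sub>M M). v (on_config (\<omega>, p)))"
      by (rule PMM.integral_fst'[OF v_int, symmetric])
    also have "\<dots> = (LINT \<omega>|P. LINT x|M. LINT y|M. v (on_config (\<omega>, x, y)))"
    proof (rule integral_cong_AE)
      show "AE \<omega> in P. (LINT p|(M \<Otimes>\<^sub>M M). v (on_config (\<omega>, p))) = (LINT x|M. LINT y|M. v (on_config (\<omega>, x, y)))"
        using PMM.AE_integrable_fst'[OF v_int]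
        by eventually_elim (rule L.MM.integral_fst'[symmetric])
      show "(\<lambda>\<omega>. LINT p|(M \<Otimes>\<^sub>M M). v (on_config (\<omega>, p))) \<in> borel_measurable P"
        using PMM.integrable_fst'[OF v_int] by (rule borel_measurable_integrable)
      show "(\<lambda>\<omega>. LINT x|M. LINT y|M. v (on_config (\<omega>, x, y))) \<in> borel_measurable P"
        by measurable
    qed
    also have "\<dots> = (LINT \<omega>|P. LINT x|M. LINT y|M. D \<Phi> (\<omega>, x, y) \<bullet> D \<Psi> (\<omega>, y, x))"
      by (intro Bochner_Integration.integral_cong refl) (use fun_cong[OF v_eq] in \<open>force\<close>)
    finally show ?thesis .
  qed
  finally show "(LINT \<omega>|P. KS_integral P M N \<Phi> \<omega> \<bullet> KS_integral P M N \<Psi> \<omega>) =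
      (LINT \<omega>|P. LINT x|M. \<Phi> (\<omega>, x) \<bullet> \<Psi> (\<omega>, x)) +
      (LINT \<omega>|P. LINT x|M. LINT y|M. D \<Phi> (\<omega>, x, y) \<bullet> D \<Psi> (\<omega>, y, x))" .
qed

end

section \<open>The isometry formula\<close>

theorem proposition3p22:
  fixes M :: "'e measure" and P :: "'w measure" and N :: "'w \<Rightarrow> 'e measure"
  assumes "sigma_finite_measure M"
    and "{(x, y) \<in> space M \<times> space M. x = y} \<in> sets (M \<Otimes>\<^sub>M M)"
    and "prob_space P"
    and "complete_measure P"
    and "poisson_random_measure P M N"
    and "sum_of_diracs P M N"
    and "sets P = sets (completion (restr_to_subalg P (vimage_algebra (space P) N (config_space M))))"
    and "borel_isomorphic M"
  defines "L2D12 \<equiv> (L2_sobolev P M N ::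
             ('w \<times> 'e \<Rightarrow> 'h::{real_inner,banach,second_countable_topology}) set)"
    and "\<delta> \<equiv> (KS_integral P M N :: ('w \<times> 'e \<Rightarrow> 'h) \<Rightarrow> 'w \<Rightarrow> 'h)"
    and "D \<equiv> (diff_op_process P M N :: ('w \<times> 'e \<Rightarrow> 'h) \<Rightarrow> 'w \<times> 'e \<times> 'e \<Rightarrow> 'h)"
  shows "L2D12 \<subseteq> KS_dom P M N \<and>
    continuous_wrt L2D12 (L2_sobolev_norm P M N) (Lp_norm 2 P) \<delta> \<and>
    (\<forall>\<Phi>\<in>L2D12. \<forall>\<Psi>\<in>L2D12.
       integrable (P \<Otimes>\<^sub>M (M \<Otimes>\<^sub>M M)) (\<lambda>(\<omega>, x, y). D \<Phi> (\<omega>, x, y) \<bullet> D \<Psi> (\<omega>, y, x)) \<and>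
       (LINT \<omega>|P. \<delta> \<Phi> \<omega> \<bullet> \<delta> \<Psi> \<omega>) =
         (LINT \<omega>|P. LINT x|M. \<Phi> (\<omega>, x) \<bullet> \<Psi> (\<omega>, x)) +
         (LINT \<omega>|P. LINT x|M. LINT y|M. D \<Phi> (\<omega>, x, y) \<bullet> D \<Psi> (\<omega>, y, x)))"
proof -
  interpret poisson_functionals M P N
    using assms(1,3,5,7) by (intro poisson_functionals.intro poisson_functionals_axioms.intro)
  show ?thesis
    unfolding L2D12_def \<delta>_def D_def
  proof (intro conjI ballI subsetI)
    show "\<Phi> \<in> KS_dom P M N" if "\<Phi> \<in> L2_sobolev P M N" for \<Phi> :: "'w \<times> 'e \<Rightarrow> 'h"
      by (rule KS_integral_divergence[OF that])
  qed (fact KS_integral_continuous KS_integral_isometry)+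
qed

end
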